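(* Let $X=(X_t)_{t\ge0}$ be a Lévy process on $\mathbb{R}$ with $\mathbb{P}\{X_1<0\}>0$, and let $a>0$. Then the following assertions are equivalent (where in each assertion containing "for some/every $r$", the version with "for some $r$" and the version with "for every $r$" are both included in the list of equivalent assertions): (1) $\mathbb{E}[e^{a\varrho_r}]<\infty$ for some/every $r\ge0$; (2) $U_a(r):=\int_0^\infty e^{at}\,\mathbb{P}\{X_t\le r\}\,dt<\infty$ for some/every $r\in\mathbb{R}$; (3) $\mathbb{E}[e^{a\varrho^1_r}]<\infty$ for some/every $r\ge0$; (4) $U_a^1(r):=\sum_{n\ge0}e^{an}\,\mathbb{P}\{X_n\le r\}<\infty$ for some/every $r\in\mathbb{R}$; (5) $a<R:=-\log\inf_{\theta\ge0}\varphi(\theta)$, or $a=R$ and $\mathbb{E}[X_1e^{-\gamma X_1}]>0$, where $\gamma$ is the unique positive number with $\mathbb{E}[e^{-\gamma X_1}]=e^{-R}$. Here $\varphi(\theta)=\mathbb{E}[e^{-\theta X_1}]$, $\theta\ge0$.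
   Context: A Lévy process $X=(X_t)_{t\ge0}$ on $\mathbb{R}$ is a stochastically continuous process with independent and stationary increments and $X_0=0$; its paths are assumed right-continuous with finite left limits. The Laplace transform $\varphi$ takes values in $(0,\infty]$. For $r\ge0$, $\varrho_r:=\sup\{t\ge0:X_t\le r\}$ is the last exit time of $X$ from $(-\infty,r]$, and $\varrho^1_r:=\sup\{k\in\mathbb{N}_0:X_k\le r\}$ is the last exit time from $(-\infty,r]$ of the embedded random walk $(X_k)_{k\in\mathbb{N}_0}$. Both may equal $\infty$; the expectation of $e^{aY}$ is understood to be $+\infty$ if $Y=\infty$ with positive probability. *)

theory Defs
  imports "HOL-Probability.Probability"
begin

text \<open>
  Only the values \<open>X t\<close> with \<open>t \<ge> 0\<close> are constrained. Path properties and \<open>X 0 = 0\<close>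
  are required on all of the sample space. No completeness of the probability space is assumed.
\<close>

locale levy_process = prob_space M
  for M :: "'w measure" and X :: "real \<Rightarrow> 'w \<Rightarrow> real" +
  assumes random_variable: "t \<ge> 0 \<Longrightarrow> X t \<in> borel_measurable M"
    and start_zero: "\<omega> \<in> space M \<Longrightarrow> X 0 \<omega> = 0"
    and indep_increments:
      "\<lbrakk>0 \<le> \<tau> 0; \<And>i. i < n \<Longrightarrow> \<tau> i \<le> \<tau> (Suc i)\<rbrakk> \<Longrightarrow>
        indep_vars (\<lambda>_. borel) (\<lambda>i \<omega>. X (\<tau> (Suc i)) \<omega> - X (\<tau> i) \<omega>) {..<n::nat}"
    and stationary_increments:
      "\<lbrakk>0 \<le> s; 0 \<le> h\<rbrakk> \<Longrightarrow>
        distr M borel (\<lambda>\<omega>. X (s + h) \<omega> - X s \<omega>) = distr M borel (\<lambda>\<omega>. X h \<omega> - X 0 \<omega>)"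
    and stochastically_continuous:
      "\<lbrakk>0 \<le> t; 0 < \<epsilon>\<rbrakk> \<Longrightarrow>
        ((\<lambda>s. prob {\<omega> \<in> space M. \<bar>X s \<omega> - X t \<omega>\<bar> > \<epsilon>}) \<longlongrightarrow> 0) (at t within {0..})"
    and right_continuous_paths:
      "\<lbrakk>\<omega> \<in> space M; 0 \<le> t\<rbrakk> \<Longrightarrow> continuous (at_right t) (\<lambda>s. X s \<omega>)"
    and left_limits:
      "\<lbrakk>\<omega> \<in> space M; 0 < t\<rbrakk> \<Longrightarrow> \<exists>l. ((\<lambda>s. X s \<omega>) \<longlongrightarrow> l) (at_left t)"

definition last_exit :: "(real \<Rightarrow> 'w \<Rightarrow> real) \<Rightarrow> real \<Rightarrow> 'w \<Rightarrow> ennreal" where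
  "last_exit X r \<omega> = (SUP t \<in> {t. 0 \<le> t \<and> X t \<omega> \<le> r}. ennreal t)"

definition last_exit_walk :: "(real \<Rightarrow> 'w \<Rightarrow> real) \<Rightarrow> real \<Rightarrow> 'w \<Rightarrow> ennreal" where
  "last_exit_walk X r \<omega> = (SUP k \<in> {k::nat. X (real k) \<omega> \<le> r}. of_nat k)"

text \<open>
  The expectation of \<open>e\<^sup>a\<^sup>Y\<close> for \<open>a > 0\<close> and \<open>Y\<close> with values in \<open>[0, \<infinity>]\<close>; it is infinite if
  \<open>Y = \<infinity>\<close> with positive probability. The function \<^term>\<open>last_exit X r\<close> may only be
  measurable with respect to the completion of the underlying measure. This does not
  matter, since \<^term>\<open>nn_integral (completion M) f = nn_integral M f\<close> for every function \<open>f\<close>.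
\<close>

definition exp_moment :: "'w measure \<Rightarrow> real \<Rightarrow> ('w \<Rightarrow> ennreal) \<Rightarrow> ennreal" where
  "exp_moment M a Y =
    (\<integral>\<^sup>+\<omega>. (if Y \<omega> = \<infinity> then \<infinity> else ennreal (exp (a * enn2real (Y \<omega>)))) \<partial>M)"

definition potential :: "'w measure \<Rightarrow> (real \<Rightarrow> 'w \<Rightarrow> real) \<Rightarrow> real \<Rightarrow> real \<Rightarrow> ennreal" where
  "potential M X a r =
    (\<integral>\<^sup>+t\<in>{0..}. ennreal (exp (a * t) * measure M {\<omega> \<in> space M. X t \<omega> \<le> r}) \<partial>lborel)"

definition potential_walk :: "'w measure \<Rightarrow> (real \<Rightarrow> 'w \<Rightarrow> real) \<Rightarrow> real \<Rightarrow> real \<Rightarrow> ennreal" where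
  "potential_walk M X a r =
    (\<Sum>n. ennreal (exp (a * real n) * measure M {\<omega> \<in> space M. X (real n) \<omega> \<le> r}))"

definition laplace :: "'w measure \<Rightarrow> (real \<Rightarrow> 'w \<Rightarrow> real) \<Rightarrow> real \<Rightarrow> ennreal" where
  "laplace M X \<theta> = (\<integral>\<^sup>+\<omega>. ennreal (exp (- \<theta> * X 1 \<omega>)) \<partial>M)"

text \<open>
  The infimum is at most \<open>laplace M X 0 = 1\<close>, and it is positive if \<open>X 1 < 0\<close> has positive
  probability, because \<open>laplace M X \<theta>\<close> is then bounded below by that probability for
  \<open>\<theta> \<ge> 0\<close>. So \<^const>\<open>enn2real\<close> and \<^const>\<open>ln\<close> are not applied outside their proper domains.
\<close>

definition decay_rate :: "'w measure \<Rightarrow> (real \<Rightarrow> 'w \<Rightarrow> real) \<Rightarrow> real" where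
  "decay_rate M X = - ln (enn2real (INF \<theta>\<in>{0..}. laplace M X \<theta>))"

definition is_tilt_parameter :: "'w measure \<Rightarrow> (real \<Rightarrow> 'w \<Rightarrow> real) \<Rightarrow> real \<Rightarrow> bool" where
  "is_tilt_parameter M X \<gamma> \<longleftrightarrow> \<gamma> > 0 \<and> laplace M X \<gamma> = ennreal (exp (- decay_rate M X))"

text \<open>Meaningful only if there is a unique such number.\<close>

definition tilt_parameter :: "'w measure \<Rightarrow> (real \<Rightarrow> 'w \<Rightarrow> real) \<Rightarrow> real" where
  "tilt_parameter M X = (THE \<gamma>. is_tilt_parameter M X \<gamma>)"

text \<open>
  The expectation of \<open>X\<^sub>1 e\<^sup>-\<^sup>\<gamma>\<^sup>X\<^sup>1\<close> exists in \<open>[-\<infinity>, \<infinity>)\<close> for \<open>\<gamma> > 0\<close>, since the positive part of the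
  integrand is bounded. The Bochner integral is \<open>0\<close> where the expectation is \<open>-\<infinity>\<close>, so
  asking it to be positive has the intended meaning in either case.
\<close>

definition tilted_mean :: "'w measure \<Rightarrow> (real \<Rightarrow> 'w \<Rightarrow> real) \<Rightarrow> real \<Rightarrow> real" where
  "tilted_mean M X \<gamma> = (\<integral>\<omega>. X 1 \<omega> * exp (- \<gamma> * X 1 \<omega>) \<partial>M)"

end

theory Submission
  imports Defs
begin

text \<open>
  Let \<open>\<phi>\<close> be the Laplace transform of \<open>X 1\<close> and \<open>m = exp (- R)\<close> its infimum over \<open>[0, \<infinity>)\<close>. The
  embedded walk \<open>S n = X n\<close> carries the whole argument. Three quantities attached to it have to be
  compared: the potential \<open>\<Sum>n. e\<^sup>a\<^sup>n P (S n \<le> r)\<close> (called \<open>green\<close> below), the exponential moment of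
  the last visit to \<open>(-\<infinity>, r]\<close> (called \<open>last_visit_mgf\<close>), and the condition on \<open>a\<close> and \<open>R\<close>.

  From the condition to finite potentials. If \<open>a < R\<close>, some \<open>\<theta> \<ge> 0\<close> has \<open>e\<^sup>a \<phi> \<theta> < 1\<close> and the Chernoff
  bound gives a geometric series (\<open>green_finite_subcritical\<close>). If \<open>a = R\<close>, the infimum is attained
  at some \<open>\<gamma> > 0\<close>, and tilting the step law by \<open>e\<^sup>a e\<^sup>-\<^sup>\<gamma>\<^sup>x\<close> turns the potential into the expected
  number of visits of the tilted walk to \<open>(-\<infinity>, r]\<close>, each visit at \<open>x\<close> weighted by \<open>e\<^sup>\<gamma>\<^sup>x\<close>. A walk with
  positive mean has positive probability to stay bounded below (Lindley's recursion), so it visits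
  all windows of a given length a uniformly bounded number of times on average
  (\<open>sum_window_le\<close>), and the weights are summable over the windows
  (\<open>positive_mean_weighted_visits_finite\<close>).

  From finite moments back to the condition. The function \<open>G r = last_visit_mgf a r\<close> is positive,
  nondecreasing and superharmonic: \<open>e\<^sup>a E (G (r - S 1)) \<le> G r\<close>. Geometric means of superharmonic
  functions are superharmonic, and the geometric mean of many translates of \<open>G\<close> is nearly an
  exponential function. In the limit this produces, for each \<open>\<eta> > 0\<close>, some \<open>\<theta> \<ge> 0\<close> with
  \<open>e\<^sup>a \<phi> \<theta> \<le> e\<^sup>\<eta>\<close> (\<open>superharmonic_exponent\<close>), hence \<open>a \<le> R\<close>. If \<open>a = R\<close>, minimality of \<open>\<phi>\<close> at \<open>\<gamma>\<close> makes the tilted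
  mean nonnegative (\<open>tilted_mean_nonneg\<close>). It cannot vanish: a finite last visit means that
  the walk escapes with positive probability, so every window is visited finitely often on average
  by the tilted walk, whereas a walk with mean zero and \<open>E \<bar>S n\<bar> = o(n)\<close> spends half of the first \<open>n\<close>
  steps in an interval much shorter than \<open>n\<close> (\<open>mean_zero_visits_infinite\<close>).

  From the walk to the process. With a constant \<open>C\<close> for which \<open>P (X s \<le> C)\<close> is bounded below for
  \<open>s\<close> in \<open>[0, 1]\<close>, the distributions of \<open>X t\<close> and of \<open>X\<close> at the neighbouring integers are comparable,
  which settles the potentials. The same constant and a maximal inequality on dyadic grids
  (\<open>ottaviani\<close>, \<open>dips_bound\<close>) bound the probability that \<open>X\<close> goes below \<open>r\<close> during
  \<open>[k, k + 1]\<close> by a constant times that of \<open>X (k + 1) \<le> r + C\<close>, so the last exit of the process has a finite moment as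
  soon as the potentials of the walk are finite. Since the last exit of the walk is at most
  that of the process, the circle closes.
\<close>

section \<open>Random walks with a given step law\<close>

lemma ennreal_suminf_swap:
  fixes f :: "nat \<Rightarrow> nat \<Rightarrow> ennreal"
  shows "(\<Sum>n. \<Sum>i. f n i) = (\<Sum>i. \<Sum>n. f n i)"
proof -
  have "(\<integral>\<^sup>+n. (\<Sum>i. f n i) \<partial>count_space UNIV) = (\<Sum>i. \<integral>\<^sup>+n. f n i \<partial>count_space UNIV)"
    by (rule nn_integral_suminf) simp
  then show ?thesis by (simp add: nn_integral_count_space_nat)
qed

definition walk :: "(nat \<Rightarrow> real) \<Rightarrow> nat \<Rightarrow> real" where
  "walk \<omega> n = (\<Sum>i<n. \<omega> i)"

definition drop_steps :: "nat \<Rightarrow> (nat \<Rightarrow> 'a) \<Rightarrow> nat \<Rightarrow> 'a" where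
  "drop_steps n \<omega> = (\<lambda>i. \<omega> (n + i))"

lemma walk_0 [simp]: "walk \<omega> 0 = 0"
  by (simp add: walk_def)

lemma walk_drop_steps: "walk (drop_steps n \<omega>) j = walk \<omega> (n + j) - walk \<omega> n"
  by (induction j) (simp_all add: walk_def drop_steps_def)

lemma walk_Suc: "walk \<omega> (Suc n) = \<omega> 0 + walk (drop_steps 1 \<omega>) n"
  by (simp add: walk_drop_steps) (simp add: walk_def)

lemma walk_cong: "(\<And>i. i < n \<Longrightarrow> \<omega> i = \<omega>' i) \<Longrightarrow> walk \<omega> n = walk \<omega>' n"
  by (simp add: walk_def)

locale step_law = prob_space \<nu> for \<nu> :: "real measure" +
  assumes sets_law [measurable_cong]: "sets \<nu> = sets borel"

sublocale step_law \<subseteq> seq: sequence_space \<nu>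
  by unfold_locales

context step_law
begin

abbreviation "Paths \<equiv> Pi\<^sub>M (UNIV :: nat set) (\<lambda>_. \<nu>)"

definition laplace_tr :: "real \<Rightarrow> ennreal" where
  "laplace_tr \<theta> = (\<integral>\<^sup>+x. ennreal (exp (- \<theta> * x)) \<partial>\<nu>)"

lemma space_law [simp]: "space \<nu> = UNIV"
  using sets_eq_imp_space_eq[OF sets_law] by simp

lemma space_Paths [simp]: "space Paths = UNIV"
  by (simp add: space_PiM)

lemma sets_Collect_Paths: "Measurable.pred Paths A \<Longrightarrow> {\<omega>. A \<omega>} \<in> sets Paths"
  by (simp add: pred_def)

lemma emeasure_Collect_Paths:
  assumes "Measurable.pred Paths A"
  shows "emeasure Paths {\<omega>. A \<omega>} = (\<integral>\<^sup>+\<omega>. (if A \<omega> then 1 else 0) \<partial>Paths)"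
proof -
  have "(\<integral>\<^sup>+\<omega>. (if A \<omega> then 1 else 0) \<partial>Paths) = (\<integral>\<^sup>+\<omega>. indicator {\<omega>. A \<omega>} \<omega> \<partial>Paths)"
    by (intro nn_integral_cong) (simp add: indicator_def)
  then show ?thesis
    using sets_Collect_Paths[OF assms] by simp
qed

lemma measurable_walk [measurable]: "(\<lambda>\<omega>. walk \<omega> n) \<in> borel_measurable Paths"
  unfolding walk_def by measurable

lemma measurable_drop_steps [measurable]: "drop_steps n \<in> measurable Paths Paths"
  unfolding drop_steps_def[abs_def] by (rule measurable_PiM_single') (auto simp: space_PiM)

lemma drop_steps_comb_seq [simp]: "drop_steps n (comb_seq n \<omega> \<omega>') = \<omega>'"
  by (simp add: drop_steps_def comb_seq_def)

lemma drop_steps_case_nat [simp]: "drop_steps (Suc 0) (case_nat x \<omega>) = \<omega>"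
  by (simp add: drop_steps_def)

text \<open>
  The Markov property of the walk at the fixed time \<open>n\<close>: gluing the first \<open>n\<close> coordinates of one
  path to an independent second path reproduces the product measure.
\<close>
lemma nn_integral_past_future:
  fixes F H :: "(nat \<Rightarrow> real) \<Rightarrow> ennreal"
  assumes [measurable]: "F \<in> borel_measurable Paths" "H \<in> borel_measurable Paths"
    and past: "\<And>\<omega> \<omega>'. (\<And>i. i < n \<Longrightarrow> \<omega> i = \<omega>' i) \<Longrightarrow> F \<omega> = F \<omega>'"
  shows "(\<integral>\<^sup>+\<omega>. F \<omega> * H (drop_steps n \<omega>) \<partial>Paths) = (\<integral>\<^sup>+\<omega>. F \<omega> \<partial>Paths) * (\<integral>\<^sup>+\<omega>. H \<omega> \<partial>Paths)"
proof -
  have F: "F (comb_seq n \<omega> \<omega>') = F \<omega>" for \<omega> \<omega>'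
    by (rule past) (simp add: comb_seq_def)
  have "(\<integral>\<^sup>+\<omega>. F \<omega> * H (drop_steps n \<omega>) \<partial>Paths)
      = (\<integral>\<^sup>+\<omega>. F \<omega> * H (drop_steps n \<omega>) \<partial>distr (Paths \<Otimes>\<^sub>M Paths) Paths (\<lambda>(\<omega>, \<omega>'). comb_seq n \<omega> \<omega>'))"
    by (simp add: seq.PiM_comb_seq)
  also have "\<dots> = (\<integral>\<^sup>+p. F (fst p) * H (snd p) \<partial>(Paths \<Otimes>\<^sub>M Paths))"
    by (subst nn_integral_distr) (auto simp: split_beta F intro!: nn_integral_cong)
  also have "\<dots> = (\<integral>\<^sup>+\<omega>. \<integral>\<^sup>+\<omega>'. F \<omega> * H \<omega>' \<partial>Paths \<partial>Paths)"
    by (subst seq.P.nn_integral_fst[symmetric]) auto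
  finally show ?thesis
    by (simp add: nn_integral_cmult nn_integral_multc)
qed

lemma emeasure_past_future:
  assumes [measurable]: "Measurable.pred Paths A" "Measurable.pred Paths B"
    and past: "\<And>\<omega> \<omega>'. (\<And>i. i < n \<Longrightarrow> \<omega> i = \<omega>' i) \<Longrightarrow> A \<omega> = A \<omega>'"
  shows "emeasure Paths {\<omega>. A \<omega> \<and> B (drop_steps n \<omega>)} = emeasure Paths {\<omega>. A \<omega>} * emeasure Paths {\<omega>. B \<omega>}"
proof -
  have "emeasure Paths {\<omega>. A \<omega> \<and> B (drop_steps n \<omega>)}
      = (\<integral>\<^sup>+\<omega>. (if A \<omega> then 1 else 0) * (if B (drop_steps n \<omega>) then 1 else 0) \<partial>Paths)"
    by (subst emeasure_Collect_Paths) (auto intro!: nn_integral_cong)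
  also have "\<dots> = (\<integral>\<^sup>+\<omega>. (if A \<omega> then 1 else 0) \<partial>Paths) * (\<integral>\<^sup>+\<omega>. (if B \<omega> then 1 else 0) \<partial>Paths)"
  proof (rule nn_integral_past_future[where F = "\<lambda>\<omega>. if A \<omega> then 1 else 0" and H = "\<lambda>\<omega>. if B \<omega> then 1 else 0"])
    show "(if A \<omega> then 1 else 0 :: ennreal) = (if A \<omega>' then 1 else 0)" if "\<And>i. i < n \<Longrightarrow> \<omega> i = \<omega>' i" for \<omega> \<omega>'
      using past[OF that] by simp
  qed measurable
  finally show ?thesis by (simp add: emeasure_Collect_Paths)
qed

lemma nn_integral_first_step:
  fixes F :: "(nat \<Rightarrow> real) \<Rightarrow> ennreal"
  assumes [measurable]: "F \<in> borel_measurable Paths"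
  shows "(\<integral>\<^sup>+\<omega>. F \<omega> \<partial>Paths) = (\<integral>\<^sup>+x. \<integral>\<^sup>+\<omega>. F (case_nat x \<omega>) \<partial>Paths \<partial>\<nu>)"
proof -
  have "(\<integral>\<^sup>+\<omega>. F \<omega> \<partial>Paths) = (\<integral>\<^sup>+\<omega>. F \<omega> \<partial>distr (\<nu> \<Otimes>\<^sub>M Paths) Paths (\<lambda>(x, \<omega>). case_nat x \<omega>))"
    by (simp add: seq.PiM_iter)
  also have "\<dots> = (\<integral>\<^sup>+p. F (case_nat (fst p) (snd p)) \<partial>(\<nu> \<Otimes>\<^sub>M Paths))"
    by (subst nn_integral_distr) (auto simp: split_beta)
  also have "\<dots> = (\<integral>\<^sup>+x. \<integral>\<^sup>+\<omega>. F (case_nat x \<omega>) \<partial>Paths \<partial>\<nu>)"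
    by (subst seq.P.nn_integral_fst[symmetric]) auto
  finally show ?thesis .
qed

lemma walk_case_nat [simp]: "walk (case_nat x \<omega>) (Suc n) = x + walk \<omega> n"
  by (simp add: walk_Suc del: One_nat_def) simp

text \<open>
  Two independent stretches of the walk below \<open>x\<close> and below \<open>y\<close> concatenate.
\<close>
lemma emeasure_walk_add:
  "emeasure Paths {\<omega>. walk \<omega> n \<le> x} * emeasure Paths {\<omega>. walk \<omega> k \<le> y}
    \<le> emeasure Paths {\<omega>. walk \<omega> (n + k) \<le> x + y}"
proof -
  have "emeasure Paths {\<omega>. walk \<omega> n \<le> x} * emeasure Paths {\<omega>. walk \<omega> k \<le> y}
     = emeasure Paths {\<omega>. walk \<omega> n \<le> x \<and> walk (drop_steps n \<omega>) k \<le> y}"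
  proof (rule emeasure_past_future[symmetric])
    show "(walk \<omega> n \<le> x) = (walk \<omega>' n \<le> x)" if "\<And>i. i < n \<Longrightarrow> \<omega> i = \<omega>' i" for \<omega> \<omega>'
      using walk_cong[OF that] by simp
  qed measurable
  also have "\<dots> \<le> emeasure Paths {\<omega>. walk \<omega> (n + k) \<le> x + y}"
    by (rule emeasure_mono) (auto simp: walk_drop_steps intro!: sets_Collect_Paths)
  finally show ?thesis .
qed

lemma emeasure_walk_power:
  "emeasure Paths {\<omega>. walk \<omega> 1 \<le> x} ^ n \<le> emeasure Paths {\<omega>. walk \<omega> n \<le> real n * x}"
proof (induction n)
  case 0
  show ?case using seq.P.emeasure_space_1 by simp
next
  case (Suc n)
  have "emeasure Paths {\<omega>. walk \<omega> 1 \<le> x} ^ Suc n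
      \<le> emeasure Paths {\<omega>. walk \<omega> n \<le> real n * x} * emeasure Paths {\<omega>. walk \<omega> 1 \<le> x}"
    unfolding power_Suc2 by (rule mult_right_mono[OF Suc]) simp
  also have "\<dots> \<le> emeasure Paths {\<omega>. walk \<omega> (n + 1) \<le> real n * x + x}"
    by (rule emeasure_walk_add)
  finally show ?case by (simp add: algebra_simps)
qed

lemma nn_integral_exp_walk: "(\<integral>\<^sup>+\<omega>. ennreal (exp (- \<theta> * walk \<omega> n)) \<partial>Paths) = laplace_tr \<theta> ^ n"
proof (induction n)
  case 0
  show ?case using seq.P.emeasure_space_1 by simp
next
  case (Suc n)
  have "(\<integral>\<^sup>+\<omega>. ennreal (exp (- \<theta> * walk \<omega> (Suc n))) \<partial>Paths)
     = (\<integral>\<^sup>+x. \<integral>\<^sup>+\<omega>. ennreal (exp (- \<theta> * x)) * ennreal (exp (- \<theta> * walk \<omega> n)) \<partial>Paths \<partial>\<nu>)"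
    by (subst nn_integral_first_step)
       (auto simp: exp_add[symmetric] ennreal_mult[symmetric] algebra_simps)
  also have "\<dots> = laplace_tr \<theta> * laplace_tr \<theta> ^ n"
    using Suc by (simp add: nn_integral_cmult nn_integral_multc laplace_tr_def)
  finally show ?case by simp
qed

lemma chernoff:
  assumes "\<theta> \<ge> 0"
  shows "emeasure Paths {\<omega>. walk \<omega> n \<le> r} \<le> ennreal (exp (\<theta> * r)) * laplace_tr \<theta> ^ n"
proof -
  have "emeasure Paths {\<omega>. walk \<omega> n \<le> r} \<le> (\<integral>\<^sup>+\<omega>. ennreal (exp (\<theta> * r)) * ennreal (exp (- \<theta> * walk \<omega> n)) \<partial>Paths)"
    using assms by (subst emeasure_Collect_Paths)
      (auto intro!: nn_integral_mono simp: exp_add[symmetric] ennreal_mult[symmetric] mult_left_mono)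
  also have "\<dots> = ennreal (exp (\<theta> * r)) * laplace_tr \<theta> ^ n"
    by (subst nn_integral_cmult) (simp_all flip: nn_integral_exp_walk)
  finally show ?thesis .
qed

text \<open>
  Exponential change of measure. The densities of the single steps multiply up to a function of
  the position at time \<open>n\<close> alone, so the law at time \<open>n\<close> is tilted by the same exponential.
\<close>
lemma nn_integral_tilt:
  assumes tilt: "step_law \<mu>" and \<mu>: "\<mu> = density \<nu> (\<lambda>x. ennreal (c * exp (- \<gamma> * x)))" and c: "c \<ge> 0"
    and [measurable]: "f \<in> borel_measurable borel"
  shows "(\<integral>\<^sup>+\<omega>. f (walk \<omega> n) \<partial>(Pi\<^sub>M UNIV (\<lambda>_. \<mu>))) =
    (\<integral>\<^sup>+\<omega>. ennreal (c ^ n * exp (- \<gamma> * walk \<omega> n)) * f (walk \<omega> n) \<partial>Paths)"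
  using assms(4)
proof (induction n arbitrary: f)
  case 0
  interpret t: step_law \<mu> by fact
  show ?case using seq.P.emeasure_space_1 t.seq.P.emeasure_space_1 by simp
next
  case (Suc n f)
  interpret t: step_law \<mu> by fact
  note [measurable] = Suc.prems
  define g where "g x = (\<integral>\<^sup>+\<omega>. ennreal (c ^ n * exp (- \<gamma> * walk \<omega> n)) * f (x + walk \<omega> n) \<partial>Paths)" for x
  have [measurable]: "g \<in> borel_measurable borel"
    unfolding g_def by measurable
  have "(\<integral>\<^sup>+\<omega>. f (walk \<omega> (Suc n)) \<partial>(Pi\<^sub>M UNIV (\<lambda>_. \<mu>)))
     = (\<integral>\<^sup>+x. \<integral>\<^sup>+\<omega>. f (x + walk \<omega> n) \<partial>(Pi\<^sub>M UNIV (\<lambda>_. \<mu>)) \<partial>\<mu>)"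
    by (subst t.nn_integral_first_step) auto
  also have "\<dots> = (\<integral>\<^sup>+x. g x \<partial>\<mu>)"
    unfolding g_def by (intro nn_integral_cong Suc.IH) measurable
  also have "\<dots> = (\<integral>\<^sup>+x. ennreal (c * exp (- \<gamma> * x)) * g x \<partial>\<nu>)"
    unfolding \<mu> by (subst nn_integral_density) auto
  also have "\<dots> = (\<integral>\<^sup>+x. \<integral>\<^sup>+\<omega>. ennreal (c ^ Suc n * exp (- \<gamma> * (x + walk \<omega> n))) * f (x + walk \<omega> n) \<partial>Paths \<partial>\<nu>)"
  proof (rule nn_integral_cong)
    fix x
    have eq: "ennreal (c ^ Suc n * exp (- \<gamma> * (x + w))) = ennreal (c * exp (- \<gamma> * x)) * ennreal (c ^ n * exp (- \<gamma> * w))" for w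
      using c by (simp add: ennreal_mult[symmetric] exp_add[symmetric] algebra_simps)
    show "ennreal (c * exp (- \<gamma> * x)) * g x = (\<integral>\<^sup>+\<omega>. ennreal (c ^ Suc n * exp (- \<gamma> * (x + walk \<omega> n))) * f (x + walk \<omega> n) \<partial>Paths)"
      unfolding g_def eq by (subst nn_integral_cmult[symmetric]) (simp_all add: mult.assoc)
  qed
  also have "\<dots> = (\<integral>\<^sup>+\<omega>. ennreal (c ^ Suc n * exp (- \<gamma> * walk \<omega> (Suc n))) * f (walk \<omega> (Suc n)) \<partial>Paths)"
    by (subst (2) nn_integral_first_step) auto
  finally show ?case .
qed

section \<open>Visits to a window and a maximal inequality\<close>

text \<open>
  Call a visit to the window good if from \<open>m\<close> steps after it the walk stays at distance at least \<open>b\<close>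
  from the visited point, hence outside the window, whose length is \<open>b\<close>. All good visits of a path lie
  within \<open>m\<close> steps of the first one, so there are at most \<open>m\<close> of them. By the Markov property
  the left-hand side is the expected number of good visits. The bound is uniform in \<open>y\<close>.
\<close>
lemma sum_window_le:
  "(\<Sum>n. emeasure Paths {\<omega>. y - b < walk \<omega> n \<and> walk \<omega> n \<le> y}) * emeasure Paths {\<omega>. \<forall>j\<ge>m. b \<le> \<bar>walk \<omega> j\<bar>}
    \<le> of_nat m"
proof -
  define good where "good \<omega> = {n. (y - b < walk \<omega> n \<and> walk \<omega> n \<le> y) \<and> (\<forall>j\<ge>m. b \<le> \<bar>walk \<omega> (n + j) - walk \<omega> n\<bar>)}" for \<omega>
  have [measurable]: "Measurable.pred Paths (\<lambda>\<omega>. n \<in> good \<omega>)" for n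
    unfolding good_def mem_Collect_eq by measurable
  have "emeasure Paths {\<omega>. y - b < walk \<omega> n \<and> walk \<omega> n \<le> y} * emeasure Paths {\<omega>. \<forall>j\<ge>m. b \<le> \<bar>walk \<omega> j\<bar>}
     = emeasure Paths {\<omega>. n \<in> good \<omega>}" for n
  proof -
    have "emeasure Paths {\<omega>. (y - b < walk \<omega> n \<and> walk \<omega> n \<le> y) \<and> (\<forall>j\<ge>m. b \<le> \<bar>walk (drop_steps n \<omega>) j\<bar>)}
       = emeasure Paths {\<omega>. y - b < walk \<omega> n \<and> walk \<omega> n \<le> y} * emeasure Paths {\<omega>. \<forall>j\<ge>m. b \<le> \<bar>walk \<omega> j\<bar>}"
    proof (rule emeasure_past_future)
      show "(y - b < walk \<omega> n \<and> walk \<omega> n \<le> y) = (y - b < walk \<omega>' n \<and> walk \<omega>' n \<le> y)"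
        if "\<And>i. i < n \<Longrightarrow> \<omega> i = \<omega>' i" for \<omega> \<omega>'
        using walk_cong[OF that] by simp
    qed measurable
    then show ?thesis
      by (simp add: good_def walk_drop_steps)
  qed
  then have "(\<Sum>n. emeasure Paths {\<omega>. y - b < walk \<omega> n \<and> walk \<omega> n \<le> y}) * emeasure Paths {\<omega>. \<forall>j\<ge>m. b \<le> \<bar>walk \<omega> j\<bar>}
     = (\<Sum>n. emeasure Paths {\<omega>. n \<in> good \<omega>})"
    by (simp flip: ennreal_suminf_multc)
  also have "\<dots> = (\<integral>\<^sup>+\<omega>. (\<Sum>n. if n \<in> good \<omega> then 1 else 0) \<partial>Paths)"
    by (subst nn_integral_suminf) (auto simp: emeasure_Collect_Paths)
  also have "\<dots> \<le> (\<integral>\<^sup>+\<omega>. of_nat m \<partial>Paths)"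
  proof (rule nn_integral_mono)
    fix \<omega>
    have sub: "\<exists>n0. good \<omega> \<subseteq> {n0..<n0 + m}"
    proof (cases "good \<omega> = {}")
      case False
      define n0 where "n0 = (LEAST n. n \<in> good \<omega>)"
      have n0: "n0 \<in> good \<omega>"
        unfolding n0_def using False by (metis LeastI_ex all_not_in_conv)
      have "n < n0 + m" if n: "n \<in> good \<omega>" for n
      proof (rule ccontr)
        assume "\<not> n < n0 + m"
        then have "m \<le> n - n0" by simp
        then have "b \<le> \<bar>walk \<omega> (n0 + (n - n0)) - walk \<omega> n0\<bar>"
          using n0 unfolding good_def by blast
        moreover have "n0 + (n - n0) = n"
          using \<open>\<not> n < n0 + m\<close> by simp
        ultimately show False
          using n n0 unfolding good_def by auto
      qed
      moreover have "n0 \<le> n" if n: "n \<in> good \<omega>" for n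
        unfolding n0_def using n by (rule Least_le)
      ultimately have "good \<omega> \<subseteq> {n0..<n0 + m}" by auto
      then show ?thesis by blast
    qed auto
    then obtain n0 where n0: "good \<omega> \<subseteq> {n0..<n0 + m}" by blast
    have "(\<Sum>n. if n \<in> good \<omega> then 1 else 0 :: ennreal) = (\<Sum>n\<in>{n0..<n0 + m}. if n \<in> good \<omega> then 1 else 0)"
      by (rule suminf_finite) (use n0 in auto)
    also have "\<dots> \<le> (\<Sum>n\<in>{n0..<n0 + m}. 1)"
      by (intro sum_mono) auto
    finally show "(\<Sum>n. if n \<in> good \<omega> then 1 else 0 :: ennreal) \<le> of_nat m"
      by simp
  qed
  also have "\<dots> = of_nat m"
    using seq.P.emeasure_space_1 by simp
  finally show ?thesis .
qed

text \<open>
  Decompose according to the first time \<open>j\<close> at which the walk is below \<open>r\<close>; from there it ends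
  below \<open>r + C\<close> as soon as the independent increment up to time \<open>p + q\<close> is at most \<open>C\<close>.
\<close>
lemma ottaviani:
  assumes \<kappa>: "\<And>i. i \<le> q \<Longrightarrow> \<kappa> \<le> emeasure Paths {\<omega>. walk \<omega> i \<le> C}"
  shows "\<kappa> * emeasure Paths {\<omega>. \<exists>j\<in>{p..p + q}. walk \<omega> j < r} \<le> emeasure Paths {\<omega>. walk \<omega> (p + q) \<le> r + C}"
proof -
  define hit where "hit j \<omega> \<longleftrightarrow> walk \<omega> j < r \<and> (\<forall>i\<in>{p..<j}. r \<le> walk \<omega> i)" for j \<omega>
  have [measurable]: "Measurable.pred Paths (hit j)" for j
    unfolding hit_def[abs_def] by measurable
  have hit_cong: "hit j \<omega> = hit j \<omega>'" if "\<And>i. i < j \<Longrightarrow> \<omega> i = \<omega>' i" for j \<omega> \<omega>'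
  proof -
    have "walk \<omega> i = walk \<omega>' i" if "i \<le> j" for i
      by (rule walk_cong) (use that \<open>\<And>i. i < j \<Longrightarrow> \<omega> i = \<omega>' i\<close> in auto)
    then show ?thesis
      unfolding hit_def by auto
  qed
  have uniq: "j = j'" if "hit j \<omega>" "hit j' \<omega>" "p \<le> j" "p \<le> j'" for j j' \<omega>
    using that unfolding hit_def by (metis atLeastLessThan_iff linorder_neqE_nat not_le)
  have "{\<omega>. \<exists>j\<in>{p..p + q}. walk \<omega> j < r} \<subseteq> (\<Union>j\<in>{p..p + q}. {\<omega>. hit j \<omega>})"
  proof clarify
    fix \<omega> j assume j: "j \<in> {p..p + q}" "walk \<omega> j < r"
    define k where "k = (LEAST k. p \<le> k \<and> walk \<omega> k < r)"
    have k: "p \<le> k \<and> walk \<omega> k < r" "k \<le> j"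
      unfolding k_def using j LeastI[of "\<lambda>k. p \<le> k \<and> walk \<omega> k < r" j] Least_le[of "\<lambda>k. p \<le> k \<and> walk \<omega> k < r" j] by auto
    have "hit k \<omega>"
      unfolding hit_def using k not_less_Least[of _ "\<lambda>k. p \<le> k \<and> walk \<omega> k < r"] k_def
      by (metis atLeastLessThan_iff not_le)
    then show "\<omega> \<in> (\<Union>j\<in>{p..p + q}. {\<omega>. hit j \<omega>})"
      using k j by auto
  qed
  then have "emeasure Paths {\<omega>. \<exists>j\<in>{p..p + q}. walk \<omega> j < r} \<le> emeasure Paths (\<Union>j\<in>{p..p + q}. {\<omega>. hit j \<omega>})"
    by (intro emeasure_mono sets.finite_UN) (auto intro!: sets_Collect_Paths)
  also have "\<dots> \<le> (\<Sum>j\<in>{p..p + q}. emeasure Paths {\<omega>. hit j \<omega>})"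
    by (intro emeasure_subadditive_finite) (auto intro!: sets_Collect_Paths)
  finally have "\<kappa> * emeasure Paths {\<omega>. \<exists>j\<in>{p..p + q}. walk \<omega> j < r} \<le> \<kappa> * (\<Sum>j\<in>{p..p + q}. emeasure Paths {\<omega>. hit j \<omega>})"
    by (rule mult_left_mono) simp
  also have "\<dots> = (\<Sum>j\<in>{p..p + q}. emeasure Paths {\<omega>. hit j \<omega>} * \<kappa>)"
    by (simp add: sum_distrib_left mult.commute)
  also have "\<dots> \<le> (\<Sum>j\<in>{p..p + q}. emeasure Paths {\<omega>. hit j \<omega>} * emeasure Paths {\<omega>. walk \<omega> (p + q - j) \<le> C})"
    by (intro sum_mono mult_left_mono \<kappa>) auto
  also have "\<dots> = (\<Sum>j\<in>{p..p + q}. emeasure Paths {\<omega>. hit j \<omega> \<and> walk (drop_steps j \<omega>) (p + q - j) \<le> C})"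
  proof (rule sum.cong[OF refl])
    fix j
    show "emeasure Paths {\<omega>. hit j \<omega>} * emeasure Paths {\<omega>. walk \<omega> (p + q - j) \<le> C}
        = emeasure Paths {\<omega>. hit j \<omega> \<and> walk (drop_steps j \<omega>) (p + q - j) \<le> C}"
    proof (rule emeasure_past_future[symmetric])
      show "hit j \<omega> = hit j \<omega>'" if "\<And>i. i < j \<Longrightarrow> \<omega> i = \<omega>' i" for \<omega> \<omega>'
        using that by (rule hit_cong)
    qed measurable
  qed
  also have "\<dots> = emeasure Paths (\<Union>j\<in>{p..p + q}. {\<omega>. hit j \<omega> \<and> walk (drop_steps j \<omega>) (p + q - j) \<le> C})"
    by (intro sum_emeasure) (auto simp: disjoint_family_on_def intro!: sets_Collect_Paths dest: uniq)
  also have "\<dots> \<le> emeasure Paths {\<omega>. walk \<omega> (p + q) \<le> r + C}"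
    by (intro emeasure_mono) (auto simp: walk_drop_steps hit_def intro!: sets_Collect_Paths)
  finally show ?thesis .
qed

section \<open>Positive drift\<close>

lemma distr_drop_steps: "distr Paths Paths (drop_steps n) = Paths"
proof (rule measure_eqI)
  fix A assume "A \<in> sets (distr Paths Paths (drop_steps n))"
  then have [measurable]: "A \<in> sets Paths" by simp
  have "emeasure Paths {\<omega>. True \<and> drop_steps n \<omega> \<in> A} = emeasure Paths {\<omega>. True} * emeasure Paths {\<omega>. \<omega> \<in> A}"
    by (rule emeasure_past_future) auto
  then show "emeasure (distr Paths Paths (drop_steps n)) A = emeasure Paths A"
    using seq.P.emeasure_space_1 by (subst emeasure_distr) (auto simp: vimage_def)
qed simp

lemma integrable_component:
  fixes g :: "real \<Rightarrow> real"
  assumes "integrable \<nu> g"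
  shows "integrable Paths (\<lambda>\<omega>. g (\<omega> i))" "(\<integral>\<omega>. g (\<omega> i) \<partial>Paths) = (\<integral>x. g x \<partial>\<nu>)"
proof -
  have [measurable]: "g \<in> borel_measurable \<nu>" using assms by auto
  have eq: "distr Paths \<nu> (\<lambda>\<omega>. \<omega> i) = \<nu>" by (rule seq.PiM_component) simp
  have "integrable (distr Paths \<nu> (\<lambda>\<omega>. \<omega> i)) g" using assms by (simp add: eq)
  then show "integrable Paths (\<lambda>\<omega>. g (\<omega> i))" by (subst (asm) integrable_distr_eq) auto
  have "(\<integral>\<omega>. g (\<omega> i) \<partial>Paths) = (\<integral>x. g x \<partial>distr Paths \<nu> (\<lambda>\<omega>. \<omega> i))"
    by (rule integral_distr[symmetric]) auto
  then show "(\<integral>\<omega>. g (\<omega> i) \<partial>Paths) = (\<integral>x. g x \<partial>\<nu>)" by (simp add: eq)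
qed

text \<open>
  The maximum of \<open>- walk \<omega> k\<close> over \<open>k \<le> n\<close>, written as Lindley's recursion so that the first step
  splits off.
\<close>
fun depth :: "nat \<Rightarrow> (nat \<Rightarrow> real) \<Rightarrow> real" where
  "depth 0 \<omega> = 0"
| "depth (Suc n) \<omega> = max 0 (depth n (drop_steps 1 \<omega>) - \<omega> 0)"

lemma depth_ge: "k \<le> n \<Longrightarrow> - walk \<omega> k \<le> depth n \<omega>"
proof (induction n arbitrary: k \<omega>)
  case (Suc n)
  show ?case
  proof (cases k)
    case (Suc k')
    then show ?thesis
      using Suc.IH[of k' "drop_steps 1 \<omega>"] Suc.prems by (simp add: walk_Suc)
  qed simp
qed simp

lemma depth_mono: "depth n \<omega> \<le> depth (Suc n) \<omega>"
proof (induction n arbitrary: \<omega>)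
  case (Suc n)
  show ?case
    using Suc[of "drop_steps 1 \<omega>"] by auto
qed simp

lemma measurable_depth [measurable]: "depth n \<in> borel_measurable Paths"
proof (induction n)
  case 0
  have "depth 0 = (\<lambda>_. 0)" by auto
  then show ?case by simp
next
  case (Suc n)
  note [measurable] = Suc
  have "depth (Suc n) = (\<lambda>\<omega>. max 0 (depth n (drop_steps 1 \<omega>) - \<omega> 0))" by auto
  then show ?case by simp
qed

lemma integrable_drop_steps:
  fixes g :: "(nat \<Rightarrow> real) \<Rightarrow> real"
  assumes "integrable Paths g"
  shows "integrable Paths (\<lambda>\<omega>. g (drop_steps n \<omega>))" "(\<integral>\<omega>. g (drop_steps n \<omega>) \<partial>Paths) = (\<integral>\<omega>. g \<omega> \<partial>Paths)"
proof -
  have [measurable]: "g \<in> borel_measurable Paths" using assms by auto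
  have "integrable (distr Paths Paths (drop_steps n)) g" using assms by (simp add: distr_drop_steps)
  then show "integrable Paths (\<lambda>\<omega>. g (drop_steps n \<omega>))" by (subst (asm) integrable_distr_eq) auto
  have "(\<integral>\<omega>. g (drop_steps n \<omega>) \<partial>Paths) = (\<integral>\<omega>. g \<omega> \<partial>distr Paths Paths (drop_steps n))"
    by (rule integral_distr[symmetric]) auto
  then show "(\<integral>\<omega>. g (drop_steps n \<omega>) \<partial>Paths) = (\<integral>\<omega>. g \<omega> \<partial>Paths)" by (simp add: distr_drop_steps)
qed

text \<open>
  With \<open>D n\<close> the depth of the walk after its first step, which is independent of that step \<open>\<xi>\<close>,
  the recursion reads \<open>depth (n + 1) = D n - \<xi> + max 0 (\<xi> - D n)\<close>. Taking expectations, and using that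
  \<open>depth\<close> grows with \<open>n\<close>, gives \<open>E (max 0 (\<xi> - D n)) \<ge> E \<xi> > 0\<close> for every \<open>n\<close>. If the walk were
  unbounded below, \<open>D n\<close> would tend to infinity and this expectation to zero.
\<close>
lemma positive_mean_not_unbounded_below:
  assumes int: "integrable \<nu> (\<lambda>x. x)" and pos: "(\<integral>x. x \<partial>\<nu>) > 0"
  shows "\<not> (AE \<omega> in Paths. \<forall>L. \<exists>k. walk \<omega> k < - L)"
proof
  assume unb: "AE \<omega> in Paths. \<forall>L. \<exists>k. walk \<omega> k < - L"
  note int0 = integrable_component[OF int, of 0]
  have int_depth: "integrable Paths (depth n)" for n
  proof (induction n)
    case 0
    have "depth 0 = (\<lambda>_. 0)" by auto
    then show ?case by simp
  next
    case (Suc n)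
    have "depth (Suc n) = (\<lambda>\<omega>. max 0 (depth n (drop_steps 1 \<omega>) - \<omega> 0))" by auto
    then show ?case
      using integrable_drop_steps(1)[OF Suc, of 1] int0(1) by simp
  qed
  define f where "f n \<omega> = max 0 (\<omega> 0 - depth n (drop_steps 1 \<omega>))" for n and \<omega> :: "nat \<Rightarrow> real"
  have [measurable]: "f n \<in> borel_measurable Paths" for n
    unfolding f_def[abs_def] by measurable
  have int_f: "integrable Paths (f n)" for n
    unfolding f_def[abs_def] using integrable_drop_steps(1)[OF int_depth[of n], of 1] int0(1) by simp
  have ge: "(\<integral>x. x \<partial>\<nu>) \<le> (\<integral>\<omega>. f n \<omega> \<partial>Paths)" for n
  proof -
    have "(\<integral>\<omega>. depth n \<omega> \<partial>Paths) \<le> (\<integral>\<omega>. depth (Suc n) \<omega> \<partial>Paths)"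
      by (intro integral_mono int_depth depth_mono)
    also have "\<dots> = (\<integral>\<omega>. depth n (drop_steps 1 \<omega>) - \<omega> 0 + f n \<omega> \<partial>Paths)"
      by (intro Bochner_Integration.integral_cong) (auto simp: f_def)
    also have "\<dots> = (\<integral>\<omega>. depth n \<omega> \<partial>Paths) - (\<integral>x. x \<partial>\<nu>) + (\<integral>\<omega>. f n \<omega> \<partial>Paths)"
      using integrable_drop_steps[OF int_depth[of n], of 1] int0 int_f by simp
    finally show ?thesis by simp
  qed
  have "AE \<omega> in distr Paths Paths (drop_steps 1). \<forall>L. \<exists>k. walk \<omega> k < - L"
    using unb by (simp only: distr_drop_steps)
  then have unb': "AE \<omega> in Paths. \<forall>L. \<exists>k. walk (drop_steps 1 \<omega>) k < - L"
    by (rule AE_distrD[rotated]) measurable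
  have "(\<lambda>n. \<integral>\<omega>. f n \<omega> \<partial>Paths) \<longlonglongrightarrow> (\<integral>\<omega>. 0 \<partial>Paths)"
  proof (rule integral_dominated_convergence)
    show "integrable Paths (\<lambda>\<omega>. \<bar>\<omega> 0\<bar>)" using int0 by simp
    show "AE \<omega> in Paths. (\<lambda>n. f n \<omega>) \<longlonglongrightarrow> 0"
      using unb'
    proof eventually_elim
      fix \<omega> assume "\<forall>L. \<exists>k. walk (drop_steps 1 \<omega>) k < - L"
      then obtain k where k: "walk (drop_steps 1 \<omega>) k < - \<omega> 0" by blast
      have "f n \<omega> = 0" if "n \<ge> k" for n
        using depth_ge[of k n "drop_steps 1 \<omega>"] k that unfolding f_def by simp
      then show "(\<lambda>n. f n \<omega>) \<longlonglongrightarrow> 0"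
        by (intro tendsto_eventually) (auto simp: eventually_at_top_linorder)
    qed
    show "AE \<omega> in Paths. norm (f n \<omega>) \<le> \<bar>\<omega> 0\<bar>" for n
    proof (rule AE_I2)
      fix \<omega>
      have "0 \<le> depth n (drop_steps 1 \<omega>)" using depth_ge[of 0 n "drop_steps 1 \<omega>"] by simp
      then show "norm (f n \<omega>) \<le> \<bar>\<omega> 0\<bar>" unfolding f_def by simp
    qed
  qed measurable
  then have "(\<integral>x. x \<partial>\<nu>) \<le> 0"
    using ge by (intro LIMSEQ_le_const[of "\<lambda>n. \<integral>\<omega>. f n \<omega> \<partial>Paths"]) auto
  with pos show False by simp
qed

lemma negative_step:
  assumes "emeasure \<nu> {..<0} > 0"
  shows "\<exists>\<delta>>0. emeasure \<nu> {..- \<delta>} > 0"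
proof (rule ccontr)
  assume *: "\<not> (\<exists>\<delta>>0. emeasure \<nu> {..- \<delta>} > 0)"
  have "{..<0::real} = (\<Union>n. {..- (1 / real (Suc n))})"
  proof (intro set_eqI iffI)
    fix x :: real assume "x \<in> {..<0}"
    then obtain n where "1 / real (Suc n) < - x"
      using nat_approx_posE[of "- x"] by auto
    then have "x \<in> {..- (1 / real (Suc n))}" by simp
    then show "x \<in> (\<Union>n. {..- (1 / real (Suc n))})" by blast
  next
    fix x :: real assume "x \<in> (\<Union>n. {..- (1 / real (Suc n))})"
    then obtain n where "x \<le> - (1 / real (Suc n))" by blast
    also have "- (1 / real (Suc n)) < 0" by simp
    finally show "x \<in> {..<0}" by simp
  qed
  moreover have "emeasure \<nu> (\<Union>n. {..- (1 / real (Suc n))}) = 0"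
    by (rule emeasure_UN_eq_0) (use * in \<open>auto simp: sets_law\<close>)
  ultimately show False using assms by simp
qed

lemma positive_step:
  assumes "emeasure \<nu> {0<..} > 0"
  shows "\<exists>b>0. emeasure \<nu> {b<..} > 0"
proof (rule ccontr)
  assume *: "\<not> (\<exists>b>0. emeasure \<nu> {b<..} > 0)"
  have "{0<..} = (\<Union>n. {1 / real (Suc n)<..})"
  proof (intro set_eqI iffI)
    fix x :: real assume "x \<in> {0<..}"
    then obtain n where "1 / real (Suc n) < x"
      using nat_approx_posE[of x] by auto
    then have "x \<in> {1 / real (Suc n)<..}" by simp
    then show "x \<in> (\<Union>n. {1 / real (Suc n)<..})" by blast
  next
    fix x :: real assume "x \<in> (\<Union>n. {1 / real (Suc n)<..})"
    then obtain n where "1 / real (Suc n) < x" by auto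
    moreover have "0 < 1 / real (Suc n)" by simp
    ultimately have "0 < x" by (rule less_trans[rotated])
    then show "x \<in> {0<..}" by simp
  qed
  moreover have "emeasure \<nu> (\<Union>n. {1 / real (Suc n)<..}) = 0"
    by (rule emeasure_UN_eq_0) (use * in \<open>auto simp: sets_law\<close>)
  ultimately show False using assms by simp
qed

lemma emeasure_first_steps_ge:
  "emeasure Paths {\<omega>. \<forall>i<m. b \<le> \<omega> i} = emeasure \<nu> {b..} ^ m"
proof (induction m)
  case 0
  show ?case using seq.P.emeasure_space_1 by simp
next
  case (Suc m)
  have "emeasure Paths {\<omega>. \<forall>i<Suc m. b \<le> \<omega> i} = emeasure Paths {\<omega>. b \<le> \<omega> 0 \<and> (\<forall>i<m. b \<le> drop_steps 1 \<omega> i)}"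
    by (intro arg_cong[where f = "emeasure Paths"]) (auto simp: drop_steps_def less_Suc_eq_0_disj)
  also have "\<dots> = emeasure Paths {\<omega>. b \<le> \<omega> 0} * emeasure Paths {\<omega>. \<forall>i<m. b \<le> \<omega> i}"
    by (rule emeasure_past_future) auto
  also have "emeasure Paths {\<omega>. b \<le> \<omega> 0} = emeasure \<nu> {b..}"
    using seq.emeasure_PiM_Collect_single[of 0 "{b..}"] by (simp add: sets_law)
  finally show ?case using Suc by simp
qed

text \<open>
  Let the first \<open>m\<close> steps carry the walk so high that the remaining walk, which stays above some
  \<open>- L\<close> with positive probability, does not bring it below \<open>c\<close> again.
\<close>
lemma positive_mean_escapes:
  assumes int: "integrable \<nu> (\<lambda>x. x)" and pos: "(\<integral>x. x \<partial>\<nu>) > 0"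
  shows "\<exists>m. emeasure Paths {\<omega>. \<forall>j\<ge>m. c \<le> walk \<omega> j} > 0"
proof -
  have "\<exists>L::nat. emeasure Paths {\<omega>. \<forall>k. - real L \<le> walk \<omega> k} > 0"
  proof (rule ccontr)
    assume *: "\<nexists>L::nat. emeasure Paths {\<omega>. \<forall>k. - real L \<le> walk \<omega> k} > 0"
    have "AE \<omega> in Paths. \<forall>L::nat. \<not> (\<forall>k. - real L \<le> walk \<omega> k)"
      unfolding AE_all_countable
    proof
      fix L
      show "AE \<omega> in Paths. \<not> (\<forall>k. - real L \<le> walk \<omega> k)"
        by (rule AE_I[where N = "{\<omega>. \<forall>k. - real L \<le> walk \<omega> k}"]) (use * in \<open>auto intro!: sets_Collect_Paths\<close>)
    qed
    then have "AE \<omega> in Paths. \<forall>L. \<exists>k. walk \<omega> k < - L"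
    proof eventually_elim
      fix \<omega> assume *: "\<forall>L::nat. \<not> (\<forall>k. - real L \<le> walk \<omega> k)"
      show "\<forall>L. \<exists>k. walk \<omega> k < - L"
      proof
        fix L
        obtain N::nat where "L \<le> real N" using real_arch_simple by blast
        with * show "\<exists>k. walk \<omega> k < - L"
          by (smt (verit) not_le)
      qed
    qed
    then show False using positive_mean_not_unbounded_below[OF assms] by blast
  qed
  then obtain L :: nat where L: "emeasure Paths {\<omega>. \<forall>k. - real L \<le> walk \<omega> k} > 0" by blast
  have "emeasure \<nu> {0<..} > 0"
  proof (rule ccontr)
    assume "\<not> emeasure \<nu> {0<..} > 0"
    then have "AE x in \<nu>. x \<le> 0"
      by (intro AE_I[where N = "{0<..}"]) (auto simp: sets_law not_le)
    then have "(\<integral>x. x \<partial>\<nu>) \<le> (\<integral>x. 0 \<partial>\<nu>)"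
      using int by (intro integral_mono_AE) auto
    then show False using pos by simp
  qed
  then obtain b where b0: "b > 0" "emeasure \<nu> {b<..} > 0"
    using positive_step by blast
  have "emeasure \<nu> {b<..} \<le> emeasure \<nu> {b..}"
    by (intro emeasure_mono) (auto simp: sets_law)
  then have b: "b > 0" "emeasure \<nu> {b..} > 0"
    using b0 by (auto intro: less_le_trans)
  obtain m :: nat where m: "real m * b \<ge> real L + c"
    using b(1) by (metis pos_divide_le_eq real_arch_simple)
  have walk_ge: "real m * b \<le> walk \<omega> m" if "\<forall>i<m. b \<le> \<omega> i" for \<omega>
    using sum_bounded_below[of "{..<m}" b \<omega>] that by (simp add: walk_def)
  have "emeasure Paths {\<omega>. \<forall>i<m. b \<le> \<omega> i} \<noteq> 0"
    using b(2) unfolding emeasure_first_steps_ge by auto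
  then have "0 < emeasure Paths {\<omega>. \<forall>i<m. b \<le> \<omega> i} * emeasure Paths {\<omega>. \<forall>k. - real L \<le> walk \<omega> k}"
    using L by (intro ennreal_zero_less_mult_iff[THEN iffD2] conjI) (auto intro: not_gr_zero[THEN iffD1])
  also have "\<dots> = emeasure Paths {\<omega>. (\<forall>i<m. b \<le> \<omega> i) \<and> (\<forall>k. - real L \<le> walk (drop_steps m \<omega>) k)}"
  proof (rule emeasure_past_future[symmetric])
    show "(\<forall>i<m. b \<le> \<omega> i) = (\<forall>i<m. b \<le> \<omega>' i)" if "\<And>i. i < m \<Longrightarrow> \<omega> i = \<omega>' i" for \<omega> \<omega>'
      using that by simp
  qed measurable
  also have "\<dots> \<le> emeasure Paths {\<omega>. \<forall>j\<ge>m. c \<le> walk \<omega> j}"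
  proof (intro emeasure_mono subsetI CollectI allI impI)
    fix \<omega> j assume "\<omega> \<in> {\<omega>. (\<forall>i<m. b \<le> \<omega> i) \<and> (\<forall>k. - real L \<le> walk (drop_steps m \<omega>) k)}" and j: "m \<le> j"
    then have "real m * b \<le> walk \<omega> m" "- real L \<le> walk (drop_steps m \<omega>) (j - m)"
      using walk_ge by auto
    then show "c \<le> walk \<omega> j"
      using m j by (simp add: walk_drop_steps)
  qed (auto intro!: sets_Collect_Paths)
  finally show ?thesis by blast
qed

text \<open>
  Cut \<open>(-\<infinity>, x]\<close> into windows of length one. They all receive at most the same expected number
  of visits, and the weights decrease geometrically.
\<close>
lemma positive_mean_weighted_visits_finite:
  assumes int: "integrable \<nu> (\<lambda>x. x)" and pos: "(\<integral>x. x \<partial>\<nu>) > 0" and \<gamma>: "\<gamma> > 0"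
  shows "(\<Sum>n. \<integral>\<^sup>+\<omega>. ennreal (exp (\<gamma> * walk \<omega> n)) * indicator {..x} (walk \<omega> n) \<partial>Paths) < \<infinity>"
proof -
  obtain m where m: "emeasure Paths {\<omega>. \<forall>j\<ge>m. 1 \<le> walk \<omega> j} > 0"
    using positive_mean_escapes[OF int pos] by blast
  define p where "p = emeasure Paths {\<omega>. \<forall>j\<ge>m. 1 \<le> \<bar>walk \<omega> j\<bar>}"
  have "emeasure Paths {\<omega>. \<forall>j\<ge>m. 1 \<le> walk \<omega> j} \<le> p"
    unfolding p_def by (intro emeasure_mono) (force intro!: sets_Collect_Paths)+
  then have p: "p \<noteq> 0" using m by auto
  define C where "C = of_nat m / p"
  have C: "C < \<infinity>" using p by (simp add: C_def less_top[symmetric] ennreal_divide_eq_top_iff)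
  have win: "(\<Sum>n. emeasure Paths {\<omega>. y - 1 < walk \<omega> n \<and> walk \<omega> n \<le> y}) \<le> C" for y
  proof -
    have fin: "p < \<infinity>" unfolding p_def by (simp add: seq.P.emeasure_eq_measure)
    let ?A = "\<Sum>n. emeasure Paths {\<omega>. y - 1 < walk \<omega> n \<and> walk \<omega> n \<le> y}"
    have "?A = ?A * p / p"
      using p fin by (subst ennreal_mult_divide_eq) auto
    also have "\<dots> \<le> of_nat m / p"
      using sum_window_le[of y 1 m] by (intro divide_right_mono_ennreal) (simp add: p_def)
    finally show ?thesis by (simp add: C_def)
  qed
  have weight: "ennreal (exp (\<gamma> * w)) * indicator {..x} w
    \<le> (\<Sum>i. ennreal (exp (\<gamma> * (x - real i))) * (if x - real i - 1 < w \<and> w \<le> x - real i then 1 else 0))" for w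
  proof (cases "w \<le> x")
    case True
    define i where "i = nat \<lfloor>x - w\<rfloor>"
    have "real i = of_int \<lfloor>x - w\<rfloor>" using True by (simp add: i_def)
    then have i: "x - real i - 1 < w" "w \<le> x - real i" by linarith+
    have "ennreal (exp (\<gamma> * w)) * indicator {..x} w \<le> ennreal (exp (\<gamma> * (x - real i)))"
      using i \<gamma> True by (simp add: ennreal_leI)
    also have "\<dots> = (\<Sum>k\<in>{i}. ennreal (exp (\<gamma> * (x - real k))) * (if x - real k - 1 < w \<and> w \<le> x - real k then 1 else 0))"
      using i by simp
    also have "\<dots> \<le> (\<Sum>i. ennreal (exp (\<gamma> * (x - real i))) * (if x - real i - 1 < w \<and> w \<le> x - real i then 1 else 0))"
      by (rule sum_le_suminf) auto
    finally show ?thesis .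
  qed simp
  have "(\<Sum>n. \<integral>\<^sup>+\<omega>. ennreal (exp (\<gamma> * walk \<omega> n)) * indicator {..x} (walk \<omega> n) \<partial>Paths)
    \<le> (\<Sum>n. \<integral>\<^sup>+\<omega>. (\<Sum>i. ennreal (exp (\<gamma> * (x - real i))) *
        (if x - real i - 1 < walk \<omega> n \<and> walk \<omega> n \<le> x - real i then 1 else 0)) \<partial>Paths)"
    by (intro suminf_le nn_integral_mono weight) auto
  also have "\<dots> = (\<Sum>n. \<Sum>i. ennreal (exp (\<gamma> * (x - real i))) *
      emeasure Paths {\<omega>. x - real i - 1 < walk \<omega> n \<and> walk \<omega> n \<le> x - real i})"
    by (subst nn_integral_suminf) (auto simp: nn_integral_cmult emeasure_Collect_Paths)
  also have "\<dots> = (\<Sum>i. ennreal (exp (\<gamma> * (x - real i))) *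
      (\<Sum>n. emeasure Paths {\<omega>. x - real i - 1 < walk \<omega> n \<and> walk \<omega> n \<le> x - real i}))"
    by (subst ennreal_suminf_swap) simp
  also have "\<dots> \<le> (\<Sum>i. ennreal (exp (\<gamma> * (x - real i))) * C)"
    by (intro suminf_le mult_left_mono win) auto
  also have "\<dots> = (\<Sum>i. ennreal (exp (\<gamma> * (x - real i)))) * C"
    by simp
  also have "(\<Sum>i. ennreal (exp (\<gamma> * (x - real i)))) = ennreal (\<Sum>i. exp (\<gamma> * (x - real i)))"
  proof (rule suminf_ennreal2)
    have "summable (\<lambda>i. exp (\<gamma> * x) * exp (- \<gamma>) ^ i)"
      using \<gamma> by (intro summable_mult summable_geometric) simp
    moreover have "exp (\<gamma> * x) * exp (- \<gamma>) ^ i = exp (\<gamma> * (x - real i))" for i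
      by (simp add: exp_of_nat_mult[symmetric] exp_add[symmetric] algebra_simps)
    ultimately show "summable (\<lambda>i. exp (\<gamma> * (x - real i)))" by simp
  qed simp
  also have "ennreal (\<Sum>i. exp (\<gamma> * (x - real i))) * C < \<infinity>"
    using C by (simp add: ennreal_mult_less_top)
  finally show ?thesis .
qed

section \<open>Zero drift\<close>

lemma indep_vars_steps: "seq.P.indep_vars (\<lambda>_. \<nu>) (\<lambda>i \<omega>. \<omega> i) UNIV"
proof (subst seq.P.indep_vars_iff_distr_eq_PiM)
  have "distr Paths Paths (\<lambda>\<omega>. \<lambda>i\<in>UNIV. \<omega> i) = distr Paths Paths (\<lambda>\<omega>. \<omega>)"
    by (intro distr_cong) auto
  then show "distr Paths Paths (\<lambda>\<omega>. \<lambda>i\<in>UNIV. \<omega> i) = Pi\<^sub>M UNIV (\<lambda>i. distr Paths \<nu> (\<lambda>\<omega>. \<omega> i))"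
    by (simp add: seq.PiM_component distr_id2)
qed auto

text \<open>
  The mixed terms vanish by independence.
\<close>
lemma second_moment_centred_sum:
  assumes [measurable]: "g \<in> borel_measurable borel" and B: "\<And>x. \<bar>g x\<bar> \<le> B" and zero: "(\<integral>x. g x \<partial>\<nu>) = 0"
  shows "integrable Paths (\<lambda>\<omega>. (\<Sum>i<n. g (\<omega> i))\<^sup>2)" "(\<integral>\<omega>. (\<Sum>i<n. g (\<omega> i))\<^sup>2 \<partial>Paths) \<le> real n * B\<^sup>2"
proof -
  have g_int: "integrable \<nu> g"
    by (rule integrable_const_bound[where B = B]) (use B in auto)
  have sq: "(\<Sum>i<n. g (\<omega> i))\<^sup>2 = (\<Sum>i<n. \<Sum>j<n. g (\<omega> i) * g (\<omega> j))" for \<omega> :: "nat \<Rightarrow> real"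
    by (simp add: power2_eq_square sum_product)
  have "0 \<le> B" using B[of 0] by simp
  have int: "integrable Paths (\<lambda>\<omega>. g (\<omega> i) * g (\<omega> j))" for i j
    by (rule seq.P.integrable_const_bound[where B = "B * B"])
       (use B \<open>0 \<le> B\<close> in \<open>auto simp: abs_mult intro!: AE_I2 mult_mono\<close>)
  then show "integrable Paths (\<lambda>\<omega>. (\<Sum>i<n. g (\<omega> i))\<^sup>2)"
    unfolding sq by auto
  have val: "(\<integral>\<omega>. g (\<omega> i) * g (\<omega> j) \<partial>Paths) \<le> (if i = j then B\<^sup>2 else 0)" for i j
  proof (cases "i = j")
    case True
    have "(\<integral>\<omega>. g (\<omega> i) * g (\<omega> j) \<partial>Paths) \<le> (\<integral>\<omega>. B\<^sup>2 \<partial>Paths)"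
      using True by (intro integral_mono int)
        (auto simp: power2_eq_square[symmetric] abs_le_square_iff[symmetric] intro: order_trans[OF B])
    then show ?thesis
      using True by (simp add: seq.P.prob_space[simplified])
  next
    case False
    have "seq.P.indep_vars (\<lambda>_. borel) (\<lambda>i \<omega>. g (\<omega> i)) {i, j}"
      by (rule seq.P.indep_vars_compose2[OF seq.P.indep_vars_subset[OF indep_vars_steps]]) auto
    then have "(\<integral>\<omega>. (\<Prod>k\<in>{i, j}. g (\<omega> k)) \<partial>Paths) = (\<Prod>k\<in>{i, j}. \<integral>\<omega>. g (\<omega> k) \<partial>Paths)"
      by (rule seq.P.indep_vars_lebesgue_integral[rotated]) (auto intro: integrable_component g_int)
    then show ?thesis
      using False by (simp add: integrable_component(2)[OF g_int] zero)
  qed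
  have "(\<integral>\<omega>. (\<Sum>i<n. g (\<omega> i))\<^sup>2 \<partial>Paths) = (\<Sum>i<n. \<Sum>j<n. \<integral>\<omega>. g (\<omega> i) * g (\<omega> j) \<partial>Paths)"
    unfolding sq using int by simp
  also have "\<dots> \<le> (\<Sum>i<n. \<Sum>j<n. if i = j then B\<^sup>2 else 0)"
    by (intro sum_mono val)
  finally show "(\<integral>\<omega>. (\<Sum>i<n. g (\<omega> i))\<^sup>2 \<partial>Paths) \<le> real n * B\<^sup>2"
    by simp
qed

text \<open>
  A weak law of large numbers in \<open>L\<^sup>1\<close> for steps with a first moment only. Truncate and recentre
  the steps; the truncated part is controlled by its second moment, of order \<open>n\<close>, the rest by \<open>n\<close> times
  a small first moment.
\<close>
lemma mean_zero_sublinear: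
  assumes int: "integrable \<nu> (\<lambda>x. x)" and zero: "(\<integral>x. x \<partial>\<nu>) = 0" and \<epsilon>: "\<epsilon> > 0"
  shows "\<exists>D. \<forall>n. (\<integral>\<omega>. \<bar>walk \<omega> n\<bar> \<partial>Paths) \<le> \<epsilon> * real n + D"
proof -
  define tr where "tr K x = (if \<bar>x\<bar> \<le> K then x else 0)" for K x :: real
  have [measurable]: "tr K \<in> borel_measurable borel" for K
    unfolding tr_def[abs_def] by measurable
  have "(\<lambda>k. \<integral>x. \<bar>x - tr (real k) x\<bar> \<partial>\<nu>) \<longlonglongrightarrow> (\<integral>x. 0 \<partial>\<nu>)"
  proof (rule integral_dominated_convergence)
    show "integrable \<nu> (\<lambda>x. \<bar>x\<bar>)" using int by simp
    show "AE x in \<nu>. (\<lambda>k. \<bar>x - tr (real k) x\<bar>) \<longlonglongrightarrow> 0"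
    proof (rule AE_I2)
      fix x :: real
      obtain N :: nat where N: "\<bar>x\<bar> \<le> real N" using real_arch_simple by blast
      have "\<bar>x - tr (real k) x\<bar> = 0" if "k \<ge> N" for k
        using N that unfolding tr_def by auto
      then show "(\<lambda>k. \<bar>x - tr (real k) x\<bar>) \<longlonglongrightarrow> 0"
        by (intro tendsto_eventually) (auto simp: eventually_at_top_linorder)
    qed
    show "AE x in \<nu>. norm \<bar>x - tr (real k) x\<bar> \<le> \<bar>x\<bar>" for k
      unfolding tr_def by auto
  qed measurable
  then have "\<forall>\<^sub>F k in sequentially. (\<integral>x. \<bar>x - tr (real k) x\<bar> \<partial>\<nu>) < \<epsilon> / 4"
    using \<epsilon> by (intro order_tendstoD) auto
  then obtain k :: nat where k: "(\<integral>x. \<bar>x - tr (real k) x\<bar> \<partial>\<nu>) < \<epsilon> / 4"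
    using eventually_happens[of _ sequentially] by auto
  define K where "K = real k"
  have tr_int: "integrable \<nu> (tr K)"
    by (rule integrable_const_bound[where B = K]) (auto simp: tr_def K_def)
  define c where "c = (\<integral>x. tr K x \<partial>\<nu>)"
  have "\<bar>c\<bar> = \<bar>\<integral>x. x - tr K x \<partial>\<nu>\<bar>"
    unfolding c_def using int tr_int zero by simp
  also have "\<dots> \<le> (\<integral>x. \<bar>x - tr K x\<bar> \<partial>\<nu>)"
    by (rule integral_abs_bound)
  finally have c: "\<bar>c\<bar> \<le> \<epsilon> / 4" using k by (simp add: K_def)
  define g where "g x = tr K x - c" for x
  define h where "h x = x - g x" for x
  have [measurable]: "g \<in> borel_measurable borel" "h \<in> borel_measurable borel"
    unfolding g_def[abs_def] h_def[abs_def] by measurable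
  have g_bound: "\<bar>g x\<bar> \<le> K + \<bar>c\<bar>" for x
    unfolding g_def tr_def K_def by auto
  have g_int: "integrable \<nu> g" "(\<integral>x. g x \<partial>\<nu>) = 0"
    unfolding g_def[abs_def] using tr_int prob_space by (auto simp: c_def)
  have h_int: "integrable \<nu> (\<lambda>x. \<bar>h x\<bar>)"
    unfolding h_def[abs_def] using int g_int by simp
  have "(\<integral>x. \<bar>h x\<bar> \<partial>\<nu>) \<le> (\<integral>x. \<bar>x - tr K x\<bar> + \<bar>c\<bar> \<partial>\<nu>)"
    using h_int int tr_int by (intro integral_mono) (auto simp: h_def g_def)
  also have "\<dots> \<le> \<epsilon> / 2"
    using k c int tr_int prob_space by (simp add: K_def)
  finally have h_le: "(\<integral>x. \<bar>h x\<bar> \<partial>\<nu>) \<le> \<epsilon> / 2" .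
  define V where "V = (K + \<bar>c\<bar>)\<^sup>2"
  \<comment> \<open>the weight in \<open>\<bar>A\<bar> \<le> \<delta> A\<^sup>2 + 1 / \<delta>\<close>, chosen such that \<open>\<delta>\<close> times the second moment is at most \<open>\<epsilon> n / 2\<close>\<close>
  define \<delta> where "\<delta> = \<epsilon> / (2 * (V + 1))"
  have V: "V \<ge> 0" unfolding V_def by simp
  then have \<delta>: "\<delta> > 0" "\<delta> * V \<le> \<epsilon> / 2"
    unfolding \<delta>_def using \<epsilon> by (auto simp: field_simps)
  have "(\<integral>\<omega>. \<bar>walk \<omega> n\<bar> \<partial>Paths) \<le> \<epsilon> * real n + 1 / \<delta>" for n
  proof -
    have ints: "integrable Paths (\<lambda>\<omega>. (\<Sum>i<n. g (\<omega> i))\<^sup>2)" "integrable Paths (\<lambda>\<omega>. \<Sum>i<n. \<bar>h (\<omega> i)\<bar>)"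
      using second_moment_centred_sum(1)[OF _ g_bound g_int(2)] integrable_component(1)[OF h_int] by auto
    have "\<bar>walk \<omega> n\<bar> \<le> \<delta> * (\<Sum>i<n. g (\<omega> i))\<^sup>2 + 1 / \<delta> + (\<Sum>i<n. \<bar>h (\<omega> i)\<bar>)" for \<omega>
    proof -
      define A where "A = (\<Sum>i<n. g (\<omega> i))"
      have "\<bar>walk \<omega> n\<bar> = \<bar>A + (\<Sum>i<n. h (\<omega> i))\<bar>"
        unfolding A_def walk_def by (simp add: h_def flip: sum.distrib)
      also have "\<dots> \<le> \<bar>A\<bar> + (\<Sum>i<n. \<bar>h (\<omega> i)\<bar>)"
        by (intro order_trans[OF abs_triangle_ineq] add_left_mono sum_abs)
      also have "\<bar>A\<bar> \<le> \<delta> * A\<^sup>2 + 1 / \<delta>"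
      proof -
        have "0 \<le> (\<delta> * \<bar>A\<bar> - 1)\<^sup>2 + \<delta> * \<bar>A\<bar>" using \<delta> by simp
        then have "\<delta> * \<bar>A\<bar> \<le> \<delta> * (\<delta> * A\<^sup>2) + 1"
          by (simp add: power2_eq_square algebra_simps)
        then have "\<delta> * \<bar>A\<bar> \<le> \<delta> * (\<delta> * A\<^sup>2 + 1 / \<delta>)"
          using \<delta> by (simp add: distrib_left)
        then show ?thesis using \<delta> by (simp add: mult_le_cancel_left_pos)
      qed
      finally show ?thesis unfolding A_def by simp
    qed
    then have "(\<integral>\<omega>. \<bar>walk \<omega> n\<bar> \<partial>Paths) \<le> (\<integral>\<omega>. \<delta> * (\<Sum>i<n. g (\<omega> i))\<^sup>2 + 1 / \<delta> + (\<Sum>i<n. \<bar>h (\<omega> i)\<bar>) \<partial>Paths)"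
      using ints integrable_component(1)[OF int] unfolding walk_def by (intro integral_mono) auto
    also have "\<dots> = \<delta> * (\<integral>\<omega>. (\<Sum>i<n. g (\<omega> i))\<^sup>2 \<partial>Paths) + 1 / \<delta> + real n * (\<integral>x. \<bar>h x\<bar> \<partial>\<nu>)"
      using ints integrable_component[OF h_int] seq.P.prob_space by simp
    also have "\<dots> \<le> \<delta> * (real n * V) + 1 / \<delta> + real n * (\<epsilon> / 2)"
      using \<delta> h_le second_moment_centred_sum(2)[OF _ g_bound g_int(2), of n]
      by (intro add_mono mult_left_mono) (auto simp: V_def)
    also have "\<dots> = (\<delta> * V) * real n + 1 / \<delta> + real n * (\<epsilon> / 2)" by simp
    also have "\<dots> \<le> (\<epsilon> / 2) * real n + 1 / \<delta> + real n * (\<epsilon> / 2)"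
      using \<delta> \<epsilon> by (intro add_mono mult_right_mono) auto
    finally show ?thesis by (simp add: field_simps)
  qed
  then show ?thesis by blast
qed

text \<open>
  The Borel-Cantelli argument: choose \<open>m\<close> so that the tail of the series is below one half.
\<close>
lemma finite_green_avoids_origin:
  assumes fin: "(\<Sum>n. emeasure Paths {\<omega>. \<bar>walk \<omega> n\<bar> < b}) < \<infinity>"
  shows "\<exists>m. emeasure Paths {\<omega>. \<forall>j\<ge>m. b \<le> \<bar>walk \<omega> j\<bar>} \<ge> 1 / 2"
proof -
  let ?f = "\<lambda>n. seq.P.prob {\<omega>. \<bar>walk \<omega> n\<bar> < b}"
  have sum: "summable ?f"
    using fin by (intro summable_suminf_not_top) (auto simp: seq.P.emeasure_eq_measure)
  obtain m where "norm (\<Sum>i. ?f (i + m)) < 1 / 2"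
    using suminf_exist_split[OF _ sum, of "1/2"] by auto
  then have m: "(\<Sum>i. ?f (i + m)) < 1 / 2" by simp
  have sum': "summable (\<lambda>i. ?f (i + m))"
    using sum by (rule summable_ignore_initial_segment)
  have meas: "{\<omega>. \<bar>walk \<omega> (i + m)\<bar> < b} \<in> seq.P.events" for i
    by (rule sets_Collect_Paths) measurable
  have meas2: "{\<omega>. \<forall>j\<ge>m. b \<le> \<bar>walk \<omega> j\<bar>} \<in> seq.P.events"
    by (rule sets_Collect_Paths) measurable
  have "- {\<omega>. \<forall>j\<ge>m. b \<le> \<bar>walk \<omega> j\<bar>} = (\<Union>i. {\<omega>. \<bar>walk \<omega> (i + m)\<bar> < b})"
  proof (intro set_eqI iffI)
    fix \<omega> assume "\<omega> \<in> - {\<omega>. \<forall>j\<ge>m. b \<le> \<bar>walk \<omega> j\<bar>}"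
    then obtain j where j: "m \<le> j" "\<bar>walk \<omega> j\<bar> < b" by auto
    then have "\<omega> \<in> {\<omega>. \<bar>walk \<omega> (j - m + m)\<bar> < b}" by simp
    then show "\<omega> \<in> (\<Union>i. {\<omega>. \<bar>walk \<omega> (i + m)\<bar> < b})" by blast
  next
    fix \<omega> assume "\<omega> \<in> (\<Union>i. {\<omega>. \<bar>walk \<omega> (i + m)\<bar> < b})"
    then obtain i where i: "\<bar>walk \<omega> (i + m)\<bar> < b" by blast
    then have "\<not> b \<le> \<bar>walk \<omega> (i + m)\<bar>" "m \<le> i + m" by simp_all
    then show "\<omega> \<in> - {\<omega>. \<forall>j\<ge>m. b \<le> \<bar>walk \<omega> j\<bar>}" by blast
  qed
  then have "1 - seq.P.prob {\<omega>. \<forall>j\<ge>m. b \<le> \<bar>walk \<omega> j\<bar>} = seq.P.prob (\<Union>i. {\<omega>. \<bar>walk \<omega> (i + m)\<bar> < b})"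
    using seq.P.prob_compl[OF meas2] by (simp add: Compl_eq_Diff_UNIV)
  also have "\<dots> \<le> (\<Sum>i. ?f (i + m))"
    using meas sum' by (intro seq.P.finite_measure_subadditive_countably) auto
  finally have "1 / 2 \<le> seq.P.prob {\<omega>. \<forall>j\<ge>m. b \<le> \<bar>walk \<omega> j\<bar>}"
    using m by simp
  then have "ennreal (1 / 2) \<le> emeasure Paths {\<omega>. \<forall>j\<ge>m. b \<le> \<bar>walk \<omega> j\<bar>}"
    unfolding seq.P.emeasure_eq_measure by (rule ennreal_leI)
  moreover have "ennreal (1 / 2) = 1 / 2"
    using ennreal_divide_numeral[of 1 "num.Bit0 num.One"] by simp
  ultimately show ?thesis by metis
qed

text \<open>
  A form of the Chung-Fuchs recurrence theorem. If the series were finite, the walk would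
  visit each window of length \<open>b\<close> at most \<open>2 m\<close> times on average. By the \<open>L\<^sup>1\<close> law of large
  numbers it spends, on average, at least half of the first \<open>n\<close> steps in an interval of length
  \<open>2 \<epsilon> n\<close>, which is covered by about \<open>2 \<epsilon> n / b\<close> windows. For small \<open>\<epsilon>\<close> and large \<open>n\<close> this is a
  contradiction.
\<close>
lemma mean_zero_visits_infinite:
  assumes int: "integrable \<nu> (\<lambda>x. x)" and zero: "(\<integral>x. x \<partial>\<nu>) = 0" and b: "b > 0"
  shows "(\<Sum>n. emeasure Paths {\<omega>. \<bar>walk \<omega> n\<bar> < b}) = \<infinity>"
proof (rule ccontr)
  assume "(\<Sum>n. emeasure Paths {\<omega>. \<bar>walk \<omega> n\<bar> < b}) \<noteq> \<infinity>"
  then have "(\<Sum>n. emeasure Paths {\<omega>. \<bar>walk \<omega> n\<bar> < b}) < \<infinity>"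
    by (simp add: top.not_eq_extremum)
  then obtain m where m: "1 / 2 \<le> emeasure Paths {\<omega>. \<forall>j\<ge>m. b \<le> \<bar>walk \<omega> j\<bar>}"
    using finite_green_avoids_origin by blast
  define w where "w y n = seq.P.prob {\<omega>. y - b < walk \<omega> n \<and> walk \<omega> n \<le> y}" for y n
  have w: "(\<Sum>k<n. w y k) \<le> 2 * real m" for y n
  proof -
    have "ennreal ((\<Sum>k<n. w y k) / 2) = (\<Sum>k<n. ennreal (w y k)) * (1 / 2)"
      by (simp add: w_def sum_nonneg divide_ennreal_def ennreal_mult[symmetric] flip: divide_ennreal)
    also have "\<dots> \<le> (\<Sum>k. ennreal (w y k)) * emeasure Paths {\<omega>. \<forall>j\<ge>m. b \<le> \<bar>walk \<omega> j\<bar>}"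
      using m by (intro mult_mono sum_le_suminf) auto
    also have "\<dots> \<le> of_nat m"
      using sum_window_le[of y b m] by (simp add: w_def seq.P.emeasure_eq_measure)
    finally have "ennreal ((\<Sum>k<n. w y k) / 2) \<le> ennreal (real m)"
      by (simp add: ennreal_of_nat_eq_real_of_nat)
    then show ?thesis by (subst (asm) ennreal_le_iff) auto
  qed
  \<comment> \<open>small enough for \<open>2 \<epsilon> n / b\<close> windows with \<open>2 m\<close> visits each to account for at most \<open>n / 4\<close> steps\<close>
  define \<epsilon> where "\<epsilon> = b / (16 * (real m + 1))"
  have \<epsilon>: "\<epsilon> > 0" using b by (simp add: \<epsilon>_def)
  obtain D where D: "\<And>n. (\<integral>\<omega>. \<bar>walk \<omega> n\<bar> \<partial>Paths) \<le> \<epsilon> / 4 * real n + D"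
    using mean_zero_sublinear[OF int zero, of "\<epsilon> / 4"] \<epsilon> by auto
  have D0: "D \<ge> 0" using D[of 0] by simp
  obtain n :: nat where n: "real n \<ge> 16 * real m + 4 * D / \<epsilon> + 1"
    using real_arch_simple by blast
  have n': "real n > 16 * real m" "real n * \<epsilon> \<ge> 4 * D" "real n > 0"
  proof -
    have "4 * D / \<epsilon> \<ge> 0" using D0 \<epsilon> by simp
    then show "real n > 16 * real m" "real n > 0" using n by auto
    have "real n \<ge> 4 * D / \<epsilon>" using n by simp
    then show "real n * \<epsilon> \<ge> 4 * D" using \<epsilon> by (simp add: field_simps)
  qed
  have half: "1 / 2 \<le> seq.P.prob {\<omega>. \<bar>walk \<omega> k\<bar> < \<epsilon> * real n}" if k: "k < n" for k
  proof -
    let ?c = "\<epsilon> * real n"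
    have c: "?c > 0" using \<epsilon> n' by simp
    have wint: "integrable Paths (\<lambda>\<omega>. \<bar>walk \<omega> k\<bar>)"
      using integrable_component(1)[OF int] unfolding walk_def by auto
    have "?c * seq.P.prob {\<omega>. ?c \<le> \<bar>walk \<omega> k\<bar>} = (\<integral>\<omega>. ?c * indicator {\<omega>. ?c \<le> \<bar>walk \<omega> k\<bar>} \<omega> \<partial>Paths)"
      by simp
    also have "\<dots> \<le> (\<integral>\<omega>. \<bar>walk \<omega> k\<bar> \<partial>Paths)"
    proof (rule integral_mono[OF _ wint])
      have "{\<omega>. ?c \<le> \<bar>walk \<omega> k\<bar>} \<in> seq.P.events" by (rule sets_Collect_Paths) measurable
      then show "integrable Paths (\<lambda>\<omega>. ?c * indicator {\<omega>. ?c \<le> \<bar>walk \<omega> k\<bar>} \<omega>)"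
        by (intro integrable_mult_right integrable_real_indicator) (simp_all add: seq.P.emeasure_eq_measure)
      show "?c * indicator {\<omega>. ?c \<le> \<bar>walk \<omega> k\<bar>} \<omega> \<le> \<bar>walk \<omega> k\<bar>" for \<omega>
        by (auto simp: indicator_def)
    qed
    also have "\<dots> \<le> \<epsilon> / 4 * real k + D" by (rule D)
    also have "\<dots> \<le> \<epsilon> / 4 * real n + real n * \<epsilon> / 4"
      using k n' \<epsilon> by (intro add_mono mult_left_mono) auto
    also have "\<dots> = ?c * (1 / 2)" by simp
    finally have "seq.P.prob {\<omega>. ?c \<le> \<bar>walk \<omega> k\<bar>} \<le> 1 / 2"
      using c by (subst (asm) mult_le_cancel_left_pos) auto
    moreover have "{\<omega>. \<bar>walk \<omega> k\<bar> < ?c} = UNIV - {\<omega>. ?c \<le> \<bar>walk \<omega> k\<bar>}" by auto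
    moreover have "{\<omega>. ?c \<le> \<bar>walk \<omega> k\<bar>} \<in> seq.P.events" by (rule sets_Collect_Paths) measurable
    ultimately show ?thesis
      using seq.P.prob_compl[of "{\<omega>. ?c \<le> \<bar>walk \<omega> k\<bar>}"] by simp
  qed
  \<comment> \<open>the windows \<open>(y i - b, y i]\<close> with \<open>i \<le> N\<close> cover \<open>(- \<epsilon> n, \<epsilon> n)\<close>\<close>
  define N where "N = nat \<lceil>2 * \<epsilon> * real n / b\<rceil>"
  define y where "y i = real i * b - \<epsilon> * real n" for i :: nat
  have N: "real N \<le> 2 * \<epsilon> * real n / b + 1"
    unfolding N_def using \<epsilon> b n' by (simp add: of_nat_nat)
  have cover: "seq.P.prob {\<omega>. \<bar>walk \<omega> k\<bar> < \<epsilon> * real n} \<le> (\<Sum>i\<le>N. w (y i) k)" for k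
  proof -
    have "{\<omega>. \<bar>walk \<omega> k\<bar> < \<epsilon> * real n} \<subseteq> (\<Union>i\<le>N. {\<omega>. y i - b < walk \<omega> k \<and> walk \<omega> k \<le> y i})"
    proof clarify
      fix \<omega> assume x: "\<bar>walk \<omega> k\<bar> < \<epsilon> * real n"
      define t where "t = (walk \<omega> k + \<epsilon> * real n) / b"
      have t: "0 \<le> t" "t \<le> 2 * \<epsilon> * real n / b" and xt: "walk \<omega> k = t * b - \<epsilon> * real n"
        using x b by (auto simp: t_def field_simps)
      define i where "i = nat \<lceil>t\<rceil>"
      have i: "real i = of_int \<lceil>t\<rceil>" using t by (simp add: i_def)
      have "i \<le> N" unfolding i_def N_def using t by (intro nat_mono ceiling_mono)
      moreover have "t \<le> real i" "real i < t + 1" unfolding i by linarith+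
      then have "t * b \<le> real i * b" "real i * b < (t + 1) * b" using b by auto
      then have "y i - b < walk \<omega> k \<and> walk \<omega> k \<le> y i"
        unfolding y_def xt by (auto simp: algebra_simps)
      ultimately show "\<omega> \<in> (\<Union>i\<le>N. {\<omega>. y i - b < walk \<omega> k \<and> walk \<omega> k \<le> y i})" by auto
    qed
    then have "seq.P.prob {\<omega>. \<bar>walk \<omega> k\<bar> < \<epsilon> * real n} \<le> seq.P.prob (\<Union>i\<le>N. {\<omega>. y i - b < walk \<omega> k \<and> walk \<omega> k \<le> y i})"
      by (intro seq.P.finite_measure_mono sets.finite_UN) (auto intro!: sets_Collect_Paths)
    also have "\<dots> \<le> (\<Sum>i\<le>N. w (y i) k)"
      unfolding w_def by (intro seq.P.finite_measure_subadditive_finite) (auto intro!: sets_Collect_Paths)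
    finally show ?thesis .
  qed
  have "real n * (1 / 2) = (\<Sum>k<n. 1 / 2)" by simp
  also have "\<dots> \<le> (\<Sum>k<n. \<Sum>i\<le>N. w (y i) k)"
    by (intro sum_mono order_trans[OF half cover]) auto
  also have "\<dots> = (\<Sum>i\<le>N. \<Sum>k<n. w (y i) k)" by (rule sum.swap)
  also have "\<dots> \<le> (\<Sum>i\<le>N. 2 * real m)" by (intro sum_mono w)
  also have "\<dots> = (real N + 1) * (2 * real m)" by simp
  also have "\<dots> \<le> (2 * \<epsilon> * real n / b + 2) * (2 * real m)"
    using N by (intro mult_right_mono) auto
  also have "2 * \<epsilon> * real n / b = real n / (8 * (real m + 1))"
  proof -
    have "2 * (b / (16 * t)) * u / b = u / (8 * t)" if "t > 0" for t u :: real
      using b that by (simp add: field_simps)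
    from this[of "real m + 1"] show ?thesis unfolding \<epsilon>_def by (metis of_nat_0_le_iff zero_less_one add_nonneg_pos)
  qed
  also have "(real n / (8 * (real m + 1)) + 2) * (2 * real m) = real n / 4 * (real m / (real m + 1)) + 4 * real m"
  proof -
    have "(u / (8 * t) + 2) * (2 * v) = u / 4 * (v / t) + 4 * v" if "t > 0" for t u v :: real
      using that by (simp add: field_simps)
    from this[of "real m + 1"] show ?thesis by (metis of_nat_0_le_iff zero_less_one add_nonneg_pos)
  qed
  also have "\<dots> \<le> real n / 4 * 1 + 4 * real m"
    by (intro add_mono mult_left_mono) auto
  finally show False using n' by simp
qed

section \<open>Exponential moments of the last visit\<close>

text \<open>
  The expectation of \<open>e\<^sup>a\<^sup>N\<close>, where \<open>N\<close> is the time of the last visit to \<open>(-\<infinity>, x]\<close>. For \<open>a > 0\<close> the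
  supremum is infinite on paths with infinitely many visits. It is zero on paths without
  visits, which can occur for \<open>x < 0\<close>; with this convention the function is superharmonic on the whole
  line.
\<close>
definition last_visit_mgf :: "real \<Rightarrow> real \<Rightarrow> ennreal" where
  "last_visit_mgf a x = (\<integral>\<^sup>+\<omega>. (SUP n. if walk \<omega> n \<le> x then ennreal (exp (a * real n)) else 0) \<partial>Paths)"

lemma last_visit_mgf_mono: "x \<le> y \<Longrightarrow> last_visit_mgf a x \<le> last_visit_mgf a y"
  unfolding last_visit_mgf_def by (intro nn_integral_mono SUP_mono) (auto intro: order_trans)

lemma last_visit_mgf_le_green:
  "last_visit_mgf a x \<le> (\<Sum>n. ennreal (exp (a * real n)) * emeasure Paths {\<omega>. walk \<omega> n \<le> x})"
proof -
  have "last_visit_mgf a x \<le> (\<integral>\<^sup>+\<omega>. (\<Sum>n. ennreal (exp (a * real n)) * (if walk \<omega> n \<le> x then 1 else 0)) \<partial>Paths)"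
    unfolding last_visit_mgf_def
  proof (intro nn_integral_mono SUP_least)
    fix \<omega> n
    have "(if walk \<omega> n \<le> x then ennreal (exp (a * real n)) else 0)
        = (\<Sum>k\<in>{n}. ennreal (exp (a * real k)) * (if walk \<omega> k \<le> x then 1 else 0))" by simp
    also have "\<dots> \<le> (\<Sum>n. ennreal (exp (a * real n)) * (if walk \<omega> n \<le> x then 1 else 0))"
      by (rule sum_le_suminf) auto
    finally show "(if walk \<omega> n \<le> x then ennreal (exp (a * real n)) else 0) \<le> \<dots>" .
  qed
  also have "\<dots> = (\<Sum>n. ennreal (exp (a * real n)) * emeasure Paths {\<omega>. walk \<omega> n \<le> x})"
    by (subst nn_integral_suminf) (auto simp: nn_integral_cmult emeasure_Collect_Paths)
  finally show ?thesis .
qed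

text \<open>
  Splitting off the first step turns visits at times \<open>n + 1\<close> to \<open>(-\<infinity>, x]\<close> into visits at
  times \<open>n\<close> to \<open>(-\<infinity>, x - y]\<close>; only a visit at time \<open>0\<close> is lost.
\<close>
lemma last_visit_mgf_superharmonic:
  "ennreal (exp a) * (\<integral>\<^sup>+y. last_visit_mgf a (x - y) \<partial>\<nu>) \<le> last_visit_mgf a x"
proof -
  have "ennreal (exp a) * (\<integral>\<^sup>+y. last_visit_mgf a (x - y) \<partial>\<nu>)
     = (\<integral>\<^sup>+y. \<integral>\<^sup>+\<omega>. (SUP n. if walk (case_nat y \<omega>) (Suc n) \<le> x then ennreal (exp (a * real (Suc n))) else 0) \<partial>Paths \<partial>\<nu>)"
  proof -
    have eq: "(SUP n. if walk (case_nat y \<omega>) (Suc n) \<le> x then ennreal (exp (a * real (Suc n))) else 0)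
        = ennreal (exp a) * (SUP n. if walk \<omega> n \<le> x - y then ennreal (exp (a * real n)) else 0)" for y \<omega>
      unfolding SUP_mult_left_ennreal
      by (intro SUP_cong refl) (auto simp: ennreal_mult[symmetric] exp_add[symmetric] algebra_simps)
    have [measurable]: "(\<lambda>y. \<integral>\<^sup>+\<omega>. (SUP n. if walk \<omega> n \<le> x - y then ennreal (exp (a * real n)) else 0) \<partial>Paths) \<in> borel_measurable \<nu>"
      by measurable
    show ?thesis
      unfolding eq last_visit_mgf_def
      by (subst nn_integral_cmult[symmetric], measurable, intro nn_integral_cong, subst nn_integral_cmult, measurable)
  qed
  also have "\<dots> = (\<integral>\<^sup>+\<omega>. (SUP n. if walk \<omega> (Suc n) \<le> x then ennreal (exp (a * real (Suc n))) else 0) \<partial>Paths)"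
    by (rule nn_integral_first_step[symmetric]) measurable
  also have "\<dots> \<le> last_visit_mgf a x"
    unfolding last_visit_mgf_def by (intro nn_integral_mono SUP_mono) blast
  finally show ?thesis .
qed

text \<open>
  Superharmonicity and monotonicity combined: a downward jump by at least \<open>\<delta>\<close> replaces the level
  \<open>x\<close> by one that is at least \<open>x + \<delta>\<close>. This Harnack-type inequality transports finiteness
  and positivity between levels.
\<close>
lemma last_visit_mgf_shift:
  "ennreal (exp a) * emeasure \<nu> {..- \<delta>} * last_visit_mgf a (x + \<delta>) \<le> last_visit_mgf a x"
proof -
  have "emeasure \<nu> {..- \<delta>} * last_visit_mgf a (x + \<delta>) = (\<integral>\<^sup>+y. last_visit_mgf a (x + \<delta>) * indicator {..- \<delta>} y \<partial>\<nu>)"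
    by (subst nn_integral_cmult_indicator) (auto simp: sets_law mult.commute)
  also have "\<dots> \<le> (\<integral>\<^sup>+y. last_visit_mgf a (x - y) \<partial>\<nu>)"
    by (intro nn_integral_mono) (auto simp: indicator_def intro!: last_visit_mgf_mono)
  finally have "ennreal (exp a) * (emeasure \<nu> {..- \<delta>} * last_visit_mgf a (x + \<delta>))
      \<le> ennreal (exp a) * (\<integral>\<^sup>+y. last_visit_mgf a (x - y) \<partial>\<nu>)"
    by (rule mult_left_mono) simp
  with last_visit_mgf_superharmonic show ?thesis
    by (metis (no_types, lifting) mult.assoc order_trans)
qed

lemma last_visit_mgf_finite_everywhere:
  assumes neg: "emeasure \<nu> {..<0} > 0" and fin: "last_visit_mgf a r < \<infinity>"
  shows "last_visit_mgf a x < \<infinity>"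
proof -
  obtain \<delta> where \<delta>: "\<delta> > 0" "emeasure \<nu> {..- \<delta>} > 0"
    using negative_step[OF neg] by blast
  have "last_visit_mgf a (r + real k * \<delta>) < \<infinity>" for k
  proof (induction k)
    case (Suc k)
    have "ennreal (exp a) * emeasure \<nu> {..- \<delta>} * last_visit_mgf a (r + real k * \<delta> + \<delta>) < \<infinity>"
      using last_visit_mgf_shift Suc by (rule le_less_trans)
    then have "last_visit_mgf a (r + real k * \<delta> + \<delta>) < \<infinity>"
      using \<delta> by (auto simp: ennreal_mult_less_top)
    moreover have eq: "r + real (Suc k) * \<delta> = r + real k * \<delta> + \<delta>" by (simp add: algebra_simps)
    ultimately show ?case by (simp only: eq)
  qed (use fin in simp)
  moreover obtain k :: nat where "x - r \<le> real k * \<delta>"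
    using \<delta>(1) by (metis pos_divide_le_eq real_arch_simple)
  then have "x \<le> r + real k * \<delta>" by simp
  ultimately show ?thesis using last_visit_mgf_mono le_less_trans by blast
qed

lemma last_visit_mgf_pos:
  assumes neg: "emeasure \<nu> {..<0} > 0"
  shows "last_visit_mgf a x > 0"
proof -
  obtain \<delta> where \<delta>: "\<delta> > 0" "emeasure \<nu> {..- \<delta>} > 0"
    using negative_step[OF neg] by blast
  have "last_visit_mgf a (0 - real k * \<delta>) > 0" for k
  proof (induction k)
    case 0
    have "(1::ennreal) = (\<integral>\<^sup>+\<omega>. 1 \<partial>Paths)" using seq.P.emeasure_space_1 by simp
    also have "\<dots> \<le> last_visit_mgf a 0"
      unfolding last_visit_mgf_def by (intro nn_integral_mono SUP_upper2[of 0]) auto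
    finally show ?case by (auto intro: less_le_trans[OF zero_less_one])
  next
    case (Suc k)
    have "last_visit_mgf a (0 - real (Suc k) * \<delta> + \<delta>) > 0"
      using Suc by (simp add: algebra_simps)
    then have "0 < ennreal (exp a) * emeasure \<nu> {..- \<delta>} * last_visit_mgf a (0 - real (Suc k) * \<delta> + \<delta>)"
      using \<delta> by (simp add: ennreal_zero_less_mult_iff)
    also have "\<dots> \<le> last_visit_mgf a (0 - real (Suc k) * \<delta>)" by (rule last_visit_mgf_shift)
    finally show ?case .
  qed
  moreover obtain k :: nat where "- x \<le> real k * \<delta>"
    using \<delta>(1) by (metis pos_divide_le_eq real_arch_simple)
  then have "0 - real k * \<delta> \<le> x" by simp
  ultimately show ?thesis using last_visit_mgf_mono less_le_trans by blast
qed

section \<open>From superharmonic functions to exponentials\<close>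

text \<open>
  For a step \<open>h\<close> and a number \<open>k\<close> of translates consider the function
  \<open>y \<mapsto> (\<Prod>i<k. G (i h - y) / G (i h))\<close> raised to the power \<open>1 / k\<close>. By the inequality of arithmetic and
  geometric means its integral is at most \<open>e\<^sup>-\<^sup>a\<close>, because this holds for each factor. With \<open>L i\<close> the
  logarithm of \<open>G (i h)\<close>, the logarithm of the product is a telescoping sum for \<open>- y = j h\<close>, and tends
  to \<open>j \<beta>\<close> after division by \<open>k\<close> if \<open>L k / k\<close> tends to \<open>\<beta>\<close>. Such a limit exists along a subsequence
  because \<open>G\<close> grows at most exponentially. Fatou's lemma then yields \<open>\<theta> = \<beta> / h\<close>, up to a factor
  \<open>e\<^sup>\<beta>\<close> for rounding \<open>- y\<close> down to a multiple of \<open>h\<close>; the factor is harmless for small \<open>h\<close>.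
\<close>
lemma superharmonic_exponent:
  fixes G :: "real \<Rightarrow> real"
  assumes mono: "\<And>x y. x \<le> y \<Longrightarrow> G x \<le> G y" and pos: "\<And>x. G x > 0"
    and super: "\<And>x. (\<integral>\<^sup>+y. ennreal (G (x - y)) \<partial>\<nu>) \<le> ennreal (exp (- a) * G x)"
    and \<delta>: "\<delta> > 0" and growth: "\<And>x. G (x + \<delta>) \<le> B * G x"
    and \<eta>: "\<eta> > 0"
  shows "\<exists>\<theta>\<ge>0. laplace_tr \<theta> \<le> ennreal (exp (\<eta> - a))"
proof -
  define E where "E = ln B"
  have "G 0 \<le> G (0 + \<delta>)" using \<delta> by (intro mono) simp
  also have "\<dots> \<le> B * G 0" by (rule growth)
  finally have B: "B \<ge> 1" using pos[of 0] by simp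
  then have E: "E \<ge> 0" by (simp add: E_def)
  \<comment> \<open>the mesh \<open>h = \<delta> / N\<close> is so fine that \<open>L\<close> grows by at most \<open>\<eta>\<close> per mesh step on average, whence \<open>\<beta> \<le> \<eta>\<close>\<close>
  obtain N :: nat where "E / \<eta> < real N" using reals_Archimedean2 by blast
  then have N: "E < \<eta> * real N" using \<eta> by (simp add: field_simps)
  then have N0: "N > 0" using E \<eta> by (cases N) auto
  define h where "h = \<delta> / real N"
  have h: "h > 0" using \<delta> N0 by (simp add: h_def)
  define L where "L i = ln (G (of_int i * h))" for i :: int
  have L_mono: "L i \<le> L j" if "i \<le> j" for i j
    unfolding L_def using that h pos by (intro ln_mono mono mult_right_mono) auto
  have L_N: "L (i + int N) \<le> L i + E" for i
  proof -
    have "G (of_int (i + int N) * h) = G (of_int i * h + \<delta>)"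
      using N0 by (simp add: h_def field_simps)
    also have "\<dots> \<le> B * G (of_int i * h)" by (rule growth)
    finally have "L (i + int N) \<le> ln (B * G (of_int i * h))"
      unfolding L_def using pos B by (intro ln_mono) auto
    also have "\<dots> = L i + E"
      unfolding L_def E_def using pos B by (subst ln_mult_pos) (auto simp: less_le_trans[OF zero_less_one])
    finally show ?thesis .
  qed
  have L_Suc: "L (i + 1) \<le> L i + E" for i
    using L_mono[of "i + 1" "i + int N"] L_N[of i] N0 by linarith
  have L_qN: "L (int q * int N) \<le> L 0 + real q * E" for q
  proof (induction q)
    case (Suc q)
    have "L (int (Suc q) * int N) = L (int q * int N + int N)" by (simp add: algebra_simps)
    also have "\<dots> \<le> L 0 + real q * E + E" using L_N[of "int q * int N"] Suc by linarith
    finally show ?case by (simp add: algebra_simps)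
  qed simp
  have L_upper: "L (int k) \<le> L 0 + E + real k * (E / real N)" for k
  proof -
    have "k \<le> (k div N + 1) * N"
      using N0 by (metis Suc_eq_plus1 dividend_less_div_times less_imp_le mult.commute mult_Suc)
    then have "int k \<le> int (k div N + 1) * int N" by (metis of_nat_le_iff of_nat_mult)
    then have "L (int k) \<le> L (int (k div N + 1) * int N)" by (rule L_mono)
    also have "\<dots> \<le> L 0 + real (k div N + 1) * E" by (rule L_qN)
    also have "\<dots> \<le> L 0 + (real k / real N + 1) * E"
      using E of_nat_div_le_of_nat[of k N, where ?'a = real] by (intro add_left_mono mult_right_mono) auto
    finally show ?thesis by (simp add: algebra_simps)
  qed
  define s where "s k = L (int (Suc k)) / real (Suc k)" for k
  have s_lower: "s k \<ge> L 0 / real (Suc k)" for k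
    unfolding s_def by (intro divide_right_mono L_mono) auto
  have s_upper: "s k \<le> (L 0 + E) / real (Suc k) + E / real N" for k
  proof -
    have "s k \<le> (L 0 + E + real (Suc k) * (E / real N)) / real (Suc k)"
      unfolding s_def by (intro divide_right_mono L_upper) auto
    also have "\<dots> = (L 0 + E) / real (Suc k) + E / real N"
      by (simp add: add_divide_distrib)
    finally show ?thesis .
  qed
  have "bounded (range s)"
  proof (rule boundedI)
    fix x assume "x \<in> range s"
    then obtain k where x: "x = s k" by blast
    have 1: "- \<bar>c\<bar> \<le> c / real (Suc k) \<and> c / real (Suc k) \<le> \<bar>c\<bar>" for c :: real
    proof -
      have "\<bar>c / real (Suc k)\<bar> \<le> \<bar>c\<bar>"
        by (simp add: abs_divide divide_le_eq mult_le_cancel_left1)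
      then show ?thesis by linarith
    qed
    have "0 \<le> E / real N" using E by simp
    then show "norm x \<le> \<bar>L 0\<bar> + \<bar>L 0 + E\<bar> + E / real N"
      using s_lower[of k] s_upper[of k] 1[of "L 0"] 1[of "L 0 + E"] unfolding x real_norm_def by linarith
  qed
  then obtain \<beta> r where r: "strict_mono r" and lim: "(\<lambda>k. s (r k)) \<longlonglongrightarrow> \<beta>"
    using bounded_imp_convergent_subsequence unfolding o_def by blast
  have inv_lim: "(\<lambda>k. c / real (Suc (r k))) \<longlonglongrightarrow> 0" for c
  proof -
    have "(\<lambda>k. c / real (Suc k)) \<longlonglongrightarrow> 0"
      using tendsto_mult_right_zero[OF LIMSEQ_inverse_real_of_nat, of c] by (simp add: divide_inverse)
    then show ?thesis using r by (rule LIMSEQ_subseq_LIMSEQ[unfolded o_def])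
  qed
  have \<beta>0: "\<beta> \<ge> 0"
    by (rule LIMSEQ_le[OF inv_lim[of "L 0"] lim]) (use s_lower in auto)
  have "(\<lambda>k. (L 0 + E) / real (Suc (r k)) + E / real N) \<longlonglongrightarrow> 0 + E / real N"
    by (intro tendsto_add inv_lim tendsto_const)
  then have "\<beta> \<le> 0 + E / real N"
    by (rule LIMSEQ_le[OF lim]) (use s_upper in auto)
  also have "\<dots> \<le> \<eta>" using N N0 by (simp add: field_simps)
  finally have \<beta>\<eta>: "\<beta> \<le> \<eta>" .
  \<comment> \<open>the logarithm of the product of \<open>k + 1\<close> factors at \<open>- y = j h\<close>\<close>
  define D where "D k j = (\<Sum>i<Suc k. L (int i + j) - L (int i))" for k j
  have near: "(\<lambda>k. L (int (Suc (r k)) + j) / real (Suc (r k))) \<longlonglongrightarrow> \<beta>" for j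
  proof (induction j rule: int_induct[where k = 0])
    case base
    show ?case using lim by (simp add: s_def)
  next
    case (step1 j)
    show ?case
    proof (rule tendsto_sandwich[OF _ _ step1(2)])
      have "(\<lambda>k. L (int (Suc (r k)) + j) / real (Suc (r k)) + E / real (Suc (r k))) \<longlonglongrightarrow> \<beta> + 0"
        by (intro tendsto_add step1 inv_lim)
      then show "(\<lambda>k. L (int (Suc (r k)) + j) / real (Suc (r k)) + E / real (Suc (r k))) \<longlonglongrightarrow> \<beta>" by simp
      show "\<forall>\<^sub>F k in sequentially. L (int (Suc (r k)) + j) / real (Suc (r k)) \<le> L (int (Suc (r k)) + (j + 1)) / real (Suc (r k))"
        by (intro always_eventually allI divide_right_mono L_mono) auto
      have "L (int (Suc (r k)) + (j + 1)) \<le> L (int (Suc (r k)) + j) + E" for k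
        using L_Suc[of "int (Suc (r k)) + j"] by (simp add: add.assoc)
      then show "\<forall>\<^sub>F k in sequentially. L (int (Suc (r k)) + (j + 1)) / real (Suc (r k)) \<le> L (int (Suc (r k)) + j) / real (Suc (r k)) + E / real (Suc (r k))"
        by (intro always_eventually allI) (simp only: add_divide_distrib[symmetric], rule divide_right_mono, auto)
    qed
  next
    case (step2 j)
    show ?case
    proof (rule tendsto_sandwich[OF _ _ _ step2(2)])
      have "(\<lambda>k. L (int (Suc (r k)) + j) / real (Suc (r k)) - E / real (Suc (r k))) \<longlonglongrightarrow> \<beta> - 0"
        by (intro tendsto_diff step2 inv_lim)
      then show "(\<lambda>k. L (int (Suc (r k)) + j) / real (Suc (r k)) - E / real (Suc (r k))) \<longlonglongrightarrow> \<beta>" by simp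
      show "\<forall>\<^sub>F k in sequentially. L (int (Suc (r k)) + (j - 1)) / real (Suc (r k)) \<le> L (int (Suc (r k)) + j) / real (Suc (r k))"
        by (intro always_eventually allI divide_right_mono L_mono) auto
      have "L (int (Suc (r k)) + j) - E \<le> L (int (Suc (r k)) + (j - 1))" for k
      proof -
        have "L (int (Suc (r k)) + (j - 1) + 1) = L (int (Suc (r k)) + j)" by (rule arg_cong[where f = L]) simp
        then show ?thesis using L_Suc[of "int (Suc (r k)) + (j - 1)"] by linarith
      qed
      then show "\<forall>\<^sub>F k in sequentially. L (int (Suc (r k)) + j) / real (Suc (r k)) - E / real (Suc (r k)) \<le> L (int (Suc (r k)) + (j - 1)) / real (Suc (r k))"
        by (intro always_eventually allI) (simp only: diff_divide_distrib[symmetric], rule divide_right_mono, auto)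
    qed
  qed
  have D_step: "D k (j + 1) = D k j + (L (int (Suc k) + j) - L j)" for k j
  proof -
    have "D k (j + 1) - D k j = (\<Sum>i<Suc k. L (int (Suc i) + j) - L (int i + j))"
      unfolding D_def by (simp only: sum_subtractf[symmetric]) (auto intro!: sum.cong simp: algebra_simps)
    also have "\<dots> = L (int (Suc k) + j) - L (int 0 + j)"
      by (rule sum_lessThan_telescope)
    finally show ?thesis by simp
  qed
  have D_lim: "(\<lambda>k. D (r k) j / real (Suc (r k))) \<longlonglongrightarrow> of_int j * \<beta>" for j
  proof (induction j rule: int_induct[where k = 0])
    case base
    show ?case by (simp add: D_def)
  next
    case (step1 j)
    have "(\<lambda>k. D (r k) j / real (Suc (r k)) + (L (int (Suc (r k)) + j) / real (Suc (r k)) - L j / real (Suc (r k)))) \<longlonglongrightarrow> of_int j * \<beta> + (\<beta> - 0)"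
      by (intro tendsto_add tendsto_diff step1 near inv_lim)
    moreover have "D k j / c + (L (int (Suc k) + j) / c - L j / c) = D k (j + 1) / c" for k c
      using D_step[of k j] by (simp add: add_divide_distrib diff_divide_distrib)
    moreover have "of_int j * \<beta> + (\<beta> - 0) = of_int (j + 1) * \<beta>" by (simp add: algebra_simps)
    ultimately show ?case by (simp only:)
  next
    case (step2 j)
    have "(\<lambda>k. D (r k) j / real (Suc (r k)) - (L (int (Suc (r k)) + (j - 1)) / real (Suc (r k)) - L (j - 1) / real (Suc (r k)))) \<longlonglongrightarrow> of_int j * \<beta> - (\<beta> - 0)"
      by (intro tendsto_diff step2 near inv_lim)
    moreover have "D k j / c - (L (int (Suc k) + (j - 1)) / c - L (j - 1) / c) = D k (j - 1) / c" for k c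
      using D_step[of k "j - 1"] by (simp add: add_divide_distrib diff_divide_distrib)
    moreover have "of_int j * \<beta> - (\<beta> - 0) = of_int (j - 1) * \<beta>" by (simp add: algebra_simps)
    ultimately show ?case by (simp only:)
  qed
  define j where "j y = \<lfloor>- y / h\<rfloor>" for y :: real
  have [measurable]: "(\<lambda>y. exp (D k (j y) / real (Suc k))) \<in> borel_measurable borel" for k
    unfolding j_def D_def L_def by measurable
  have amgm: "exp (D k (j y) / real (Suc k)) \<le> (\<Sum>i<Suc k. G (real i * h - y) / G (real i * h)) / real (Suc k)" for k y
  proof -
    have "exp (\<Sum>i<Suc k. (1 / real (Suc k)) *\<^sub>R (L (int i + j y) - L (int i))) \<le>
       (\<Sum>i<Suc k. (1 / real (Suc k)) * exp (L (int i + j y) - L (int i)))"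
      by (intro convex_on_sum[OF _ _ exp_convex]) auto
    also have "(\<Sum>i<Suc k. (1 / real (Suc k)) * exp (L (int i + j y) - L (int i)))
      \<le> (\<Sum>i<Suc k. (1 / real (Suc k)) * (G (real i * h - y) / G (real i * h)))"
    proof (intro sum_mono mult_left_mono)
      fix i
      have "of_int (j y) \<le> - y / h" unfolding j_def by simp
      then have "of_int (j y) * h \<le> - y" using h by (simp add: field_simps)
      then have "G (of_int (int i + j y) * h) \<le> G (real i * h - y)"
        by (intro mono) (simp add: algebra_simps)
      then show "exp (L (int i + j y) - L (int i)) \<le> G (real i * h - y) / G (real i * h)"
        using pos unfolding L_def by (simp add: exp_diff divide_right_mono less_imp_le)
    qed simp
    finally have "exp (\<Sum>i<Suc k. (1 / real (Suc k)) *\<^sub>R (L (int i + j y) - L (int i))) \<le>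
       (\<Sum>i<Suc k. (1 / real (Suc k)) * (G (real i * h - y) / G (real i * h)))" .
    moreover have "(\<Sum>i\<in>A. (1 / c) * f i) = (\<Sum>i\<in>A. f i) / c" for A :: "nat set" and f and c :: real
      by (simp add: sum_divide_distrib)
    ultimately show ?thesis unfolding D_def real_scaleR_def by (simp only:)
  qed
  have G_meas [measurable]: "G \<in> borel_measurable borel"
    using mono by (intro borel_measurable_mono monoI)
  have bound: "(\<integral>\<^sup>+y. ennreal (exp (D k (j y) / real (Suc k))) \<partial>\<nu>) \<le> ennreal (exp (- a))" for k
  proof -
    have "(\<integral>\<^sup>+y. ennreal (exp (D k (j y) / real (Suc k))) \<partial>\<nu>)
      \<le> (\<integral>\<^sup>+y. (\<Sum>i<Suc k. ennreal (1 / (real (Suc k) * G (real i * h))) * ennreal (G (real i * h - y))) \<partial>\<nu>)"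
    proof (intro nn_integral_mono)
      fix y
      have "(\<Sum>i<Suc k. ennreal (1 / (real (Suc k) * G (real i * h))) * ennreal (G (real i * h - y)))
        = (\<Sum>i<Suc k. ennreal (G (real i * h - y) / G (real i * h) / real (Suc k)))"
        using pos by (intro sum.cong refl) (simp add: ennreal_mult[symmetric] less_imp_le mult.commute)
      also have "\<dots> = ennreal ((\<Sum>i<Suc k. G (real i * h - y) / G (real i * h)) / real (Suc k))"
        using pos unfolding sum_divide_distrib by (intro sum_ennreal) (simp add: less_imp_le)
      finally show "ennreal (exp (D k (j y) / real (Suc k))) \<le> (\<Sum>i<Suc k. ennreal (1 / (real (Suc k) * G (real i * h))) * ennreal (G (real i * h - y)))"
        using amgm by (simp add: ennreal_leI)
    qed
    also have "\<dots> = (\<Sum>i<Suc k. ennreal (1 / (real (Suc k) * G (real i * h))) * (\<integral>\<^sup>+y. ennreal (G (real i * h - y)) \<partial>\<nu>))"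
      by (subst nn_integral_sum, measurable, intro sum.cong refl nn_integral_cmult, measurable)
    also have "\<dots> \<le> (\<Sum>i<Suc k. ennreal (1 / (real (Suc k) * G (real i * h))) * ennreal (exp (- a) * G (real i * h)))"
      by (intro sum_mono mult_left_mono super) auto
    also have "\<dots> = (\<Sum>i<Suc k. ennreal (exp (- a) / real (Suc k)))"
    proof (intro sum.cong refl)
      fix i
      have "G (real i * h) \<noteq> 0" "G (real i * h) \<ge> 0" using pos[of "real i * h"] by auto
      then show "ennreal (1 / (real (Suc k) * G (real i * h))) * ennreal (exp (- a) * G (real i * h)) = ennreal (exp (- a) / real (Suc k))"
        by (simp add: ennreal_mult[symmetric])
    qed
    also have "\<dots> = ennreal (\<Sum>i<Suc k. exp (- a) / real (Suc k))"
      by (rule sum_ennreal) simp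
    also have "(\<Sum>i<Suc k. exp (- a) / real (Suc k)) = exp (- a)"
      by simp
    finally show ?thesis .
  qed
  have "(\<integral>\<^sup>+y. ennreal (exp (- (\<beta> / h) * y)) * ennreal (exp (- \<beta>)) \<partial>\<nu>)
     \<le> (\<integral>\<^sup>+y. liminf (\<lambda>k. ennreal (exp (D (r k) (j y) / real (Suc (r k))))) \<partial>\<nu>)"
  proof (intro nn_integral_mono)
    fix y
    have "(\<lambda>k. ennreal (exp (D (r k) (j y) / real (Suc (r k))))) \<longlonglongrightarrow> ennreal (exp (of_int (j y) * \<beta>))"
      by (intro tendsto_ennrealI tendsto_exp D_lim)
    then have eq: "liminf (\<lambda>k. ennreal (exp (D (r k) (j y) / real (Suc (r k))))) = ennreal (exp (of_int (j y) * \<beta>))"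
      by (intro lim_imp_Liminf) auto
    have "- y / h - 1 \<le> of_int (j y)" unfolding j_def by linarith
    then have "(- y / h - 1) * \<beta> \<le> of_int (j y) * \<beta>" using \<beta>0 by (rule mult_right_mono)
    then have "- (\<beta> / h) * y + - \<beta> \<le> of_int (j y) * \<beta>" by (simp add: algebra_simps)
    then show "ennreal (exp (- (\<beta> / h) * y)) * ennreal (exp (- \<beta>)) \<le> liminf (\<lambda>k. ennreal (exp (D (r k) (j y) / real (Suc (r k)))))"
      unfolding eq by (simp add: ennreal_mult[symmetric] exp_add[symmetric])
  qed
  also have "\<dots> \<le> liminf (\<lambda>k. \<integral>\<^sup>+y. ennreal (exp (D (r k) (j y) / real (Suc (r k)))) \<partial>\<nu>)"
    by (rule nn_integral_liminf) measurable
  also have "\<dots> \<le> ennreal (exp (- a))"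
    by (intro Liminf_le always_eventually allI bound) auto
  finally have "laplace_tr (\<beta> / h) * ennreal (exp (- \<beta>)) \<le> ennreal (exp (- a))"
    unfolding laplace_tr_def by (subst (asm) nn_integral_multc) auto
  then have "laplace_tr (\<beta> / h) * ennreal (exp (- \<beta>)) * ennreal (exp \<beta>) \<le> ennreal (exp (- a)) * ennreal (exp \<beta>)"
    by (rule mult_right_mono) simp
  also have "laplace_tr (\<beta> / h) * ennreal (exp (- \<beta>)) * ennreal (exp \<beta>) = laplace_tr (\<beta> / h)"
    by (simp add: mult.assoc ennreal_mult[symmetric] exp_add[symmetric])
  also have "ennreal (exp (- a)) * ennreal (exp \<beta>) \<le> ennreal (exp (\<eta> - a))"
    using \<beta>\<eta> by (simp add: ennreal_mult[symmetric] exp_add[symmetric] ennreal_leI)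
  finally show ?thesis
    using \<beta>0 h by (intro exI[of _ "\<beta> / h"]) simp
qed

text \<open>
  The real-valued version of the last visit function meets the requirements of
  \<open>superharmonic_exponent\<close>, the growth condition being the Harnack-type inequality.
\<close>
lemma laplace_tr_le_of_last_visit_mgf_finite:
  assumes neg: "emeasure \<nu> {..<0} > 0" and fin: "last_visit_mgf a r < \<infinity>" and \<eta>: "\<eta> > 0"
  shows "\<exists>\<theta>\<ge>0. laplace_tr \<theta> \<le> ennreal (exp (\<eta> - a))"
proof -
  obtain \<delta> where \<delta>: "\<delta> > 0" "emeasure \<nu> {..- \<delta>} > 0"
    using negative_step[OF neg] by blast
  define G where "G x = enn2real (last_visit_mgf a x)" for x
  have G: "last_visit_mgf a x = ennreal (G x)" for x
    using last_visit_mgf_finite_everywhere[OF neg fin, of x] by (simp add: G_def)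
  define c where "c = exp a * prob {..- \<delta>}"
  have c: "c > 0" using \<delta> by (simp add: c_def emeasure_eq_measure)
  have cG: "c * G (x + \<delta>) \<le> G x" for x
    using last_visit_mgf_shift[of a \<delta> x] unfolding G c_def
    by (simp add: emeasure_eq_measure G_def ennreal_mult[symmetric] mult.assoc)
  have growth: "G (x + \<delta>) \<le> (1 / c) * G x" for x
    using c cG[of x] by (simp add: field_simps)
  show ?thesis
  proof (rule superharmonic_exponent[where G = G, OF _ _ _ \<delta>(1) growth \<eta>])
    show "G x \<le> G y" if "x \<le> y" for x y
      using last_visit_mgf_mono[OF that, of a] unfolding G by (simp add: G_def)
    show "G x > 0" for x
      using last_visit_mgf_pos[OF neg, of a x] unfolding G by simp
    show "(\<integral>\<^sup>+y. ennreal (G (x - y)) \<partial>\<nu>) \<le> ennreal (exp (- a) * G x)" for x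
    proof -
      have "ennreal (exp (- a)) * (ennreal (exp a) * (\<integral>\<^sup>+y. ennreal (G (x - y)) \<partial>\<nu>)) \<le> ennreal (exp (- a)) * ennreal (G x)"
        using last_visit_mgf_superharmonic[of a x] unfolding G by (intro mult_left_mono) auto
      moreover have "ennreal (exp (- a)) * (ennreal (exp a) * z) = z" for z
        by (simp add: mult.assoc[symmetric] ennreal_mult[symmetric] exp_add[symmetric])
      ultimately show ?thesis by (simp add: ennreal_mult G_def)
    qed
  qed
qed

lemma emeasure_single_step: "A \<in> sets borel \<Longrightarrow> emeasure Paths {\<omega>. \<omega> 0 \<in> A} = emeasure \<nu> A"
  using seq.emeasure_PiM_Collect_single[of 0 A] by (simp add: sets_law)

section \<open>Exponential tilting at the critical rate\<close>

text \<open>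
  Almost every path has a last visit to \<open>(-\<infinity>, r]\<close>, hence for some \<open>n\<close> this visit happens at time \<open>n\<close>
  with positive probability, and from time \<open>n\<close> on the walk stays strictly above its position. One
  additional positive step at the beginning makes the distance to the starting point
  bounded below by a constant \<open>b\<close>.
\<close>
lemma escape_of_last_visit_mgf_finite:
  assumes a: "a > 0" and r: "r \<ge> 0" and fin: "last_visit_mgf a r < \<infinity>"
  shows "\<exists>b>0. emeasure Paths {\<omega>. \<forall>k\<ge>1. b < walk \<omega> k} > 0"
proof -
  have "AE \<omega> in Paths. (SUP n. if walk \<omega> n \<le> r then ennreal (exp (a * real n)) else 0) \<noteq> \<infinity>"
  proof (rule nn_integral_noteq_infinite)
    show "(\<integral>\<^sup>+\<omega>. (SUP n. if walk \<omega> n \<le> r then ennreal (exp (a * real n)) else 0) \<partial>Paths) \<noteq> \<infinity>"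
      using fin unfolding last_visit_mgf_def by (rule less_imp_neq)
  qed measurable
  then have last: "AE \<omega> in Paths. \<exists>n. walk \<omega> n \<le> r \<and> (\<forall>k\<ge>1. r < walk \<omega> (n + k))"
  proof eventually_elim
    fix \<omega> assume *: "(SUP n. if walk \<omega> n \<le> r then ennreal (exp (a * real n)) else 0) \<noteq> \<infinity>"
    define B where "B = enn2real (SUP n. if walk \<omega> n \<le> r then ennreal (exp (a * real n)) else 0)"
    have B: "(SUP n. if walk \<omega> n \<le> r then ennreal (exp (a * real n)) else 0) = ennreal B"
      using * unfolding B_def by (intro ennreal_enn2real[symmetric]) (simp only: less_top infinity_ennreal_def)
    have bound: "real n \<le> ln B / a" if "walk \<omega> n \<le> r" for n
    proof -
      have "ennreal (exp (a * real n)) = (if walk \<omega> n \<le> r then ennreal (exp (a * real n)) else 0)" using that by simp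
      also have "\<dots> \<le> ennreal B" unfolding B[symmetric] by (rule SUP_upper) simp
      finally have "exp (a * real n) \<le> B" by (auto simp: B_def)
      then have "a * real n \<le> ln B" by (metis exp_gt_zero ln_exp ln_mono order_less_le_trans)
      then show ?thesis using a by (simp add: field_simps)
    qed
    define V where "V = {n. walk \<omega> n \<le> r}"
    have "V \<subseteq> {..nat \<lceil>ln B / a\<rceil>}"
    proof
      fix n assume "n \<in> V"
      then have "real n \<le> ln B / a" using bound by (simp add: V_def)
      then show "n \<in> {..nat \<lceil>ln B / a\<rceil>}" by simp linarith
    qed
    then have V: "finite V" by (rule finite_subset) simp
    have "0 \<in> V" using r by (simp add: V_def)
    then have max: "Max V \<in> V" using V by (intro Max_in) auto
    have "r < walk \<omega> (Max V + k)" if "k \<ge> 1" for k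
    proof (rule ccontr)
      assume "\<not> r < walk \<omega> (Max V + k)"
      then have "Max V + k \<le> Max V" using V by (intro Max_ge) (auto simp: V_def)
      then show False using that by simp
    qed
    with max show "\<exists>n. walk \<omega> n \<le> r \<and> (\<forall>k\<ge>1. r < walk \<omega> (n + k))"
      by (auto simp: V_def)
  qed
  have "\<exists>n. emeasure Paths {\<omega>. walk \<omega> n \<le> r \<and> (\<forall>k\<ge>1. r < walk \<omega> (n + k))} > 0"
  proof (rule ccontr)
    assume *: "\<not> ?thesis"
    have "AE \<omega> in Paths. \<forall>n. \<not> (walk \<omega> n \<le> r \<and> (\<forall>k\<ge>1. r < walk \<omega> (n + k)))"
      unfolding AE_all_countable
    proof
      fix n
      show "AE \<omega> in Paths. \<not> (walk \<omega> n \<le> r \<and> (\<forall>k\<ge>1. r < walk \<omega> (n + k)))"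
        by (rule AE_I[where N = "{\<omega>. walk \<omega> n \<le> r \<and> (\<forall>k\<ge>1. r < walk \<omega> (n + k))}"])
           (use * in \<open>auto intro!: sets_Collect_Paths\<close>)
    qed
    with last have "AE \<omega> in Paths. False" by eventually_elim blast
    then show False by (simp add: seq.P.AE_False)
  qed
  then obtain n where n: "emeasure Paths {\<omega>. walk \<omega> n \<le> r \<and> (\<forall>k\<ge>1. r < walk \<omega> (n + k))} > 0" by blast
  have "emeasure Paths {\<omega>. walk \<omega> n \<le> r \<and> (\<forall>k\<ge>1. r < walk \<omega> (n + k))}
      \<le> emeasure Paths {\<omega>. True \<and> (\<forall>k\<ge>1. 0 < walk (drop_steps n \<omega>) k)}"
    by (rule emeasure_mono) (auto simp: walk_drop_steps intro: le_less_trans intro!: sets_Collect_Paths)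
  also have "\<dots> = emeasure Paths {\<omega>. True} * emeasure Paths {\<omega>. \<forall>k\<ge>1. 0 < walk \<omega> k}"
    by (rule emeasure_past_future) auto
  finally have pos: "emeasure Paths {\<omega>. \<forall>k\<ge>1. 0 < walk \<omega> k} > 0"
    using n by (auto simp: zero_less_iff_neq_zero)
  have "emeasure Paths {\<omega>. \<forall>k\<ge>1. 0 < walk \<omega> k} \<le> emeasure Paths {\<omega>. \<omega> 0 \<in> {0<..}}"
  proof (rule emeasure_mono)
    show "{\<omega>. \<forall>k\<ge>1. 0 < walk \<omega> k} \<subseteq> {\<omega>. \<omega> 0 \<in> {0<..}}"
    proof clarify
      fix \<omega> :: "nat \<Rightarrow> real" assume "\<forall>k\<ge>1. 0 < walk \<omega> k"
      then have "0 < walk \<omega> 1" by blast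
      then show "0 < \<omega> 0" by (simp add: walk_def)
    qed
  qed (auto intro!: sets_Collect_Paths)
  with pos have "emeasure Paths {\<omega>. \<omega> 0 \<in> {0<..}} > 0"
    by (rule less_le_trans)
  then have "emeasure \<nu> {0<..} > 0"
    by (subst (asm) emeasure_single_step) simp
  then obtain b where b: "b > 0" "emeasure \<nu> {b<..} > 0"
    using positive_step by blast
  have "0 < emeasure Paths {\<omega>. \<omega> 0 \<in> {b<..}} * emeasure Paths {\<omega>. \<forall>k\<ge>1. 0 < walk \<omega> k}"
    using b pos emeasure_single_step[of "{b<..}"] by (simp only: ennreal_zero_less_mult_iff) simp
  also have "\<dots> = emeasure Paths {\<omega>. \<omega> 0 \<in> {b<..} \<and> (\<forall>k\<ge>1. 0 < walk (drop_steps 1 \<omega>) k)}"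
  proof (rule emeasure_past_future[symmetric])
    show "(\<omega> 0 \<in> {b<..}) = (\<omega>' 0 \<in> {b<..})" if "\<And>i. i < 1 \<Longrightarrow> \<omega> i = \<omega>' i" for \<omega> \<omega>' :: "nat \<Rightarrow> real"
      using that by simp
  qed measurable
  also have "\<dots> \<le> emeasure Paths {\<omega>. \<forall>k\<ge>1. b < walk \<omega> k}"
  proof (intro emeasure_mono subsetI CollectI allI impI)
    fix \<omega> k assume \<omega>: "\<omega> \<in> {\<omega>. \<omega> 0 \<in> {b<..} \<and> (\<forall>k\<ge>1. 0 < walk (drop_steps 1 \<omega>) k)}" and k: "(1::nat) \<le> k"
    obtain k' where k': "k = Suc k'" using k by (cases k) auto
    have "0 \<le> walk (drop_steps 1 \<omega>) k'"
      using \<omega> by (cases "k' = 0") (auto intro: less_imp_le)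
    then show "b < walk \<omega> k"
      using \<omega> unfolding k' walk_Suc by auto
  qed (auto intro!: sets_Collect_Paths)
  finally show ?thesis using b(1) by blast
qed

text \<open>
  On a path, at most one visit to the window is followed by an escape to more than \<open>b\<close> above
  the visited point, and its weight is one of those in the supremum.
\<close>
lemma weighted_window_le_last_visit_mgf:
  "(\<Sum>n. ennreal (exp (a * real n)) * emeasure Paths {\<omega>. x - b < walk \<omega> n \<and> walk \<omega> n \<le> x})
      * emeasure Paths {\<omega>. \<forall>k\<ge>1. b < walk \<omega> k} \<le> last_visit_mgf a x"
proof -
  define A where "A n \<omega> \<longleftrightarrow> (x - b < walk \<omega> n \<and> walk \<omega> n \<le> x) \<and> (\<forall>k\<ge>1. b < walk (drop_steps n \<omega>) k)" for n \<omega>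
  have [measurable]: "Measurable.pred Paths (A n)" for n
    unfolding A_def[abs_def] by measurable
  have eq: "emeasure Paths {\<omega>. x - b < walk \<omega> n \<and> walk \<omega> n \<le> x} * emeasure Paths {\<omega>. \<forall>k\<ge>1. b < walk \<omega> k}
      = emeasure Paths {\<omega>. A n \<omega>}" for n
    unfolding A_def
  proof (rule emeasure_past_future[symmetric])
    show "(x - b < walk \<omega> n \<and> walk \<omega> n \<le> x) = (x - b < walk \<omega>' n \<and> walk \<omega>' n \<le> x)"
      if "\<And>i. i < n \<Longrightarrow> \<omega> i = \<omega>' i" for \<omega> \<omega>'
      using walk_cong[OF that] by simp
  qed measurable
  have uniq: "n = n'" if A: "A n \<omega>" "A n' \<omega>" for n n' \<omega>
  proof -
    have False if "A i \<omega>" "A j \<omega>" "i < j" for i j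
    proof -
      have "b < walk (drop_steps i \<omega>) (j - i)" using that unfolding A_def by auto
      then have "b < walk \<omega> j - walk \<omega> i" using that by (simp add: walk_drop_steps)
      then show False using that unfolding A_def by auto
    qed
    then show ?thesis using A by (metis linorder_neqE_nat)
  qed
  have "(\<Sum>n. ennreal (exp (a * real n)) * emeasure Paths {\<omega>. x - b < walk \<omega> n \<and> walk \<omega> n \<le> x})
      * emeasure Paths {\<omega>. \<forall>k\<ge>1. b < walk \<omega> k} = (\<Sum>n. ennreal (exp (a * real n)) * emeasure Paths {\<omega>. A n \<omega>})"
  proof -
    have swap: "(\<Sum>n. f n * g n) * c = (\<Sum>n. f n * (g n * c))" for f g :: "nat \<Rightarrow> ennreal" and c
      by (simp add: mult.assoc[symmetric])
    show ?thesis by (simp only: swap eq)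
  qed
  also have "\<dots> = (\<integral>\<^sup>+\<omega>. (\<Sum>n. ennreal (exp (a * real n)) * (if A n \<omega> then 1 else 0)) \<partial>Paths)"
    by (subst nn_integral_suminf) (auto simp: nn_integral_cmult emeasure_Collect_Paths)
  also have "\<dots> \<le> last_visit_mgf a x"
    unfolding last_visit_mgf_def
  proof (rule nn_integral_mono)
    fix \<omega>
    show "(\<Sum>n. ennreal (exp (a * real n)) * (if A n \<omega> then 1 else 0))
        \<le> (SUP n. if walk \<omega> n \<le> x then ennreal (exp (a * real n)) else 0)"
    proof (cases "\<exists>n. A n \<omega>")
      case True
      then obtain n where n: "A n \<omega>" by blast
      have "(\<Sum>n. ennreal (exp (a * real n)) * (if A n \<omega> then 1 else 0))
          = (\<Sum>k\<in>{n}. ennreal (exp (a * real k)) * (if A k \<omega> then 1 else 0))"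
        by (rule suminf_finite) (use uniq n in auto)
      also have "\<dots> = (if walk \<omega> n \<le> x then ennreal (exp (a * real n)) else 0)"
        using n by (simp add: A_def)
      also have "\<dots> \<le> (SUP n. if walk \<omega> n \<le> x then ennreal (exp (a * real n)) else 0)"
        by (rule SUP_upper) simp
      finally show ?thesis .
    qed simp
  qed
  finally show ?thesis .
qed

text \<open>
  The change of measure replaces \<open>e\<^sup>a\<^sup>n\<close> by a weight \<open>e\<^sup>\<gamma>\<^sup>x\<close> that is bounded on a window. So the
  tilted walk visits each window finitely often on average, which a walk with mean zero does not.
\<close>
lemma tilted_mean_nonzero:
  assumes neg: "emeasure \<nu> {..<0} > 0" and a: "a > 0" and r: "r \<ge> 0" and fin: "last_visit_mgf a r < \<infinity>"
    and tilt: "step_law \<mu>" and \<mu>: "\<mu> = density \<nu> (\<lambda>x. ennreal (exp a * exp (- \<gamma> * x)))" and \<gamma>: "\<gamma> > 0"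
    and int: "integrable \<mu> (\<lambda>x. x)"
  shows "(\<integral>x. x \<partial>\<mu>) \<noteq> 0"
proof
  assume zero: "(\<integral>x. x \<partial>\<mu>) = 0"
  interpret t: step_law \<mu> by fact
  obtain b where b: "b > 0" and p: "emeasure Paths {\<omega>. \<forall>k\<ge>1. b < walk \<omega> k} > 0"
    using escape_of_last_visit_mgf_finite[OF a r fin] by blast
  have window: "(\<Sum>n. emeasure t.Paths {\<omega>. x - b < walk \<omega> n \<and> walk \<omega> n \<le> x}) < \<infinity>" for x
  proof -
    have "emeasure t.Paths {\<omega>. x - b < walk \<omega> n \<and> walk \<omega> n \<le> x}
       \<le> ennreal (exp (- \<gamma> * (x - b))) * (ennreal (exp (a * real n)) * emeasure Paths {\<omega>. x - b < walk \<omega> n \<and> walk \<omega> n \<le> x})" for n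
    proof -
      have "emeasure t.Paths {\<omega>. x - b < walk \<omega> n \<and> walk \<omega> n \<le> x}
         = (\<integral>\<^sup>+\<omega>. indicator {x - b<..x} (walk \<omega> n) \<partial>t.Paths)"
        by (subst t.emeasure_Collect_Paths) (auto intro!: nn_integral_cong simp: indicator_def)
      also have "\<dots> = (\<integral>\<^sup>+\<omega>. ennreal (exp a ^ n * exp (- \<gamma> * walk \<omega> n)) * indicator {x - b<..x} (walk \<omega> n) \<partial>Paths)"
        by (rule nn_integral_tilt[OF tilt \<mu>]) auto
      also have "\<dots> \<le> (\<integral>\<^sup>+\<omega>. (ennreal (exp (- \<gamma> * (x - b))) * ennreal (exp (a * real n))) * (if x - b < walk \<omega> n \<and> walk \<omega> n \<le> x then 1 else 0) \<partial>Paths)"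
        using \<gamma> by (intro nn_integral_mono)
          (auto simp: indicator_def exp_of_nat_mult[symmetric] exp_add[symmetric] ennreal_mult[symmetric] mult.commute intro!: ennreal_leI)
      also have "\<dots> = ennreal (exp (- \<gamma> * (x - b))) * (ennreal (exp (a * real n)) * emeasure Paths {\<omega>. x - b < walk \<omega> n \<and> walk \<omega> n \<le> x})"
        by (subst nn_integral_cmult) (auto simp: emeasure_Collect_Paths mult.assoc)
      finally show ?thesis .
    qed
    then have "(\<Sum>n. emeasure t.Paths {\<omega>. x - b < walk \<omega> n \<and> walk \<omega> n \<le> x})
       \<le> (\<Sum>n. ennreal (exp (- \<gamma> * (x - b))) * (ennreal (exp (a * real n)) * emeasure Paths {\<omega>. x - b < walk \<omega> n \<and> walk \<omega> n \<le> x}))"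
      by (intro suminf_le) auto
    also have "\<dots> = ennreal (exp (- \<gamma> * (x - b))) * (\<Sum>n. ennreal (exp (a * real n)) * emeasure Paths {\<omega>. x - b < walk \<omega> n \<and> walk \<omega> n \<le> x})"
      by simp
    also have "\<dots> < \<infinity>"
    proof -
      have "(\<Sum>n. ennreal (exp (a * real n)) * emeasure Paths {\<omega>. x - b < walk \<omega> n \<and> walk \<omega> n \<le> x})
          * emeasure Paths {\<omega>. \<forall>k\<ge>1. b < walk \<omega> k} < \<infinity>"
        using weighted_window_le_last_visit_mgf last_visit_mgf_finite_everywhere[OF neg fin] by (rule le_less_trans)
      then show ?thesis using p by (auto simp: ennreal_mult_less_top)
    qed
    finally show ?thesis .
  qed
  have "(\<Sum>n. emeasure t.Paths {\<omega>. \<bar>walk \<omega> n\<bar> < b})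
     \<le> (\<Sum>n. emeasure t.Paths {\<omega>. 0 - b < walk \<omega> n \<and> walk \<omega> n \<le> 0} + emeasure t.Paths {\<omega>. b - b < walk \<omega> n \<and> walk \<omega> n \<le> b})"
  proof (intro suminf_le)
    fix n
    have meas: "{\<omega>. y < walk \<omega> n \<and> walk \<omega> n \<le> z} \<in> sets t.Paths" for y z
      by (rule t.sets_Collect_Paths) measurable
    have "emeasure t.Paths {\<omega>. \<bar>walk \<omega> n\<bar> < b}
       \<le> emeasure t.Paths ({\<omega>. 0 - b < walk \<omega> n \<and> walk \<omega> n \<le> 0} \<union> {\<omega>. b - b < walk \<omega> n \<and> walk \<omega> n \<le> b})"
      using meas by (intro emeasure_mono sets.Un) auto
    also have "\<dots> \<le> emeasure t.Paths {\<omega>. 0 - b < walk \<omega> n \<and> walk \<omega> n \<le> 0} + emeasure t.Paths {\<omega>. b - b < walk \<omega> n \<and> walk \<omega> n \<le> b}"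
      using meas by (intro emeasure_subadditive) auto
    finally show "emeasure t.Paths {\<omega>. \<bar>walk \<omega> n\<bar> < b} \<le> \<dots>" .
  qed auto
  also have "\<dots> = (\<Sum>n. emeasure t.Paths {\<omega>. 0 - b < walk \<omega> n \<and> walk \<omega> n \<le> 0}) + (\<Sum>n. emeasure t.Paths {\<omega>. b - b < walk \<omega> n \<and> walk \<omega> n \<le> b})"
    by (rule suminf_add[symmetric]) auto
  also have "\<dots> < \<infinity>"
    using window[of 0] window[of b] by simp
  finally show False
    using t.mean_zero_visits_infinite[OF int zero b] by simp
qed

lemma weighted_visits_finite_of_tilted_mean_pos:
  assumes tilt: "step_law \<mu>" and \<mu>: "\<mu> = density \<nu> (\<lambda>x. ennreal (exp a * exp (- \<gamma> * x)))" and \<gamma>: "\<gamma> > 0"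
    and int: "integrable \<mu> (\<lambda>x. x)" and pos: "(\<integral>x. x \<partial>\<mu>) > 0"
  shows "(\<Sum>n. ennreal (exp (a * real n)) * emeasure Paths {\<omega>. walk \<omega> n \<le> x}) < \<infinity>"
proof -
  interpret t: step_law \<mu> by fact
  have "ennreal (exp (a * real n)) * emeasure Paths {\<omega>. walk \<omega> n \<le> x}
     = (\<integral>\<^sup>+\<omega>. ennreal (exp (\<gamma> * walk \<omega> n)) * indicator {..x} (walk \<omega> n) \<partial>t.Paths)" for n
  proof -
    have "(\<integral>\<^sup>+\<omega>. ennreal (exp (\<gamma> * walk \<omega> n)) * indicator {..x} (walk \<omega> n) \<partial>t.Paths)
       = (\<integral>\<^sup>+\<omega>. ennreal (exp a ^ n * exp (- \<gamma> * walk \<omega> n)) * (ennreal (exp (\<gamma> * walk \<omega> n)) * indicator {..x} (walk \<omega> n)) \<partial>Paths)"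
      by (rule nn_integral_tilt[OF tilt \<mu>]) auto
    also have "\<dots> = (\<integral>\<^sup>+\<omega>. ennreal (exp (a * real n)) * (if walk \<omega> n \<le> x then 1 else 0) \<partial>Paths)"
      by (intro nn_integral_cong)
         (auto simp: indicator_def exp_of_nat_mult[symmetric] exp_add[symmetric] ennreal_mult[symmetric] mult.commute)
    also have "\<dots> = ennreal (exp (a * real n)) * emeasure Paths {\<omega>. walk \<omega> n \<le> x}"
      by (subst nn_integral_cmult) (auto simp: emeasure_Collect_Paths)
    finally show ?thesis by simp
  qed
  then show ?thesis
    using t.positive_mean_weighted_visits_finite[OF int pos \<gamma>] by simp
qed

section \<open>The minimum of the Laplace transform\<close>

lemma laplace_tr_0 [simp]: "laplace_tr 0 = 1"
  using emeasure_space_1 by (simp add: laplace_tr_def)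

lemma laplace_tr_lower_bound: "\<theta> \<ge> 0 \<Longrightarrow> ennreal (exp (\<theta> * \<delta>)) * emeasure \<nu> {..- \<delta>} \<le> laplace_tr \<theta>"
proof -
  assume \<theta>: "\<theta> \<ge> 0"
  have "ennreal (exp (\<theta> * \<delta>)) * emeasure \<nu> {..- \<delta>} = (\<integral>\<^sup>+x. ennreal (exp (\<theta> * \<delta>)) * indicator {..- \<delta>} x \<partial>\<nu>)"
    by (subst nn_integral_cmult_indicator) (auto simp: sets_law)
  also have "\<dots> \<le> laplace_tr \<theta>"
    unfolding laplace_tr_def
  proof (intro nn_integral_mono)
    fix x
    show "ennreal (exp (\<theta> * \<delta>)) * indicator {..- \<delta>} x \<le> ennreal (exp (- \<theta> * x))"
    proof (cases "x \<le> - \<delta>")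
      case True
      then have "\<theta> * x \<le> \<theta> * (- \<delta>)" using \<theta> by (rule mult_left_mono)
      then show ?thesis using True by (simp add: ennreal_leI)
    qed simp
  qed
  finally show ?thesis .
qed

lemma INF_laplace_tr_pos:
  assumes neg: "emeasure \<nu> {..<0} > 0"
  shows "(INF \<theta>\<in>{0..}. laplace_tr \<theta>) > 0"
proof -
  obtain \<delta> where \<delta>: "\<delta> > 0" "emeasure \<nu> {..- \<delta>} > 0"
    using negative_step[OF neg] by blast
  have "emeasure \<nu> {..- \<delta>} \<le> (INF \<theta>\<in>{0..}. laplace_tr \<theta>)"
  proof (rule INF_greatest)
    fix \<theta> :: real assume "\<theta> \<in> {0..}"
    then have \<theta>: "\<theta> \<ge> 0" by simp
    have "1 * emeasure \<nu> {..- \<delta>} \<le> ennreal (exp (\<theta> * \<delta>)) * emeasure \<nu> {..- \<delta>}"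
      using \<theta> \<delta> by (intro mult_right_mono) (simp_all add: ennreal_leI flip: ennreal_1)
    also have "\<dots> \<le> laplace_tr \<theta>" by (rule laplace_tr_lower_bound[OF \<theta>])
    finally show "emeasure \<nu> {..- \<delta>} \<le> laplace_tr \<theta>" by simp
  qed
  then show ?thesis using \<delta>(2) by (rule less_le_trans[rotated])
qed

text \<open>
  Mass on the negative half-line makes the Laplace transform grow exponentially, so a
  minimising sequence is bounded; Fatou's lemma gives lower semicontinuity. The minimiser is not
  \<open>0\<close>, where the value is \<open>1\<close>.
\<close>
lemma INF_laplace_tr_attained:
  assumes neg: "emeasure \<nu> {..<0} > 0" and less: "(INF \<theta>\<in>{0..}. laplace_tr \<theta>) < 1"
  shows "\<exists>\<gamma>>0. laplace_tr \<gamma> = (INF \<theta>\<in>{0..}. laplace_tr \<theta>)"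
proof -
  let ?m = "INF \<theta>\<in>{0..}. laplace_tr \<theta>"
  obtain \<delta> where \<delta>: "\<delta> > 0" "emeasure \<nu> {..- \<delta>} > 0"
    using negative_step[OF neg] by blast
  obtain f :: "nat \<Rightarrow> ennreal" where f: "decseq f" "range f \<subseteq> laplace_tr ` {0..}" "?m = (INF i. f i)"
    using ennreal_Inf_countable_INF[of "laplace_tr ` {0..}"] by auto
  have "\<forall>i. \<exists>\<theta>. \<theta> \<ge> 0 \<and> f i = laplace_tr \<theta>" using f(2) by (auto simp: subset_iff image_iff)
  then obtain \<theta> where \<theta>: "\<And>i. \<theta> i \<ge> 0" "\<And>i. f i = laplace_tr (\<theta> i)" by metis
  have lim: "(\<lambda>i. laplace_tr (\<theta> i)) \<longlonglongrightarrow> ?m"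
    using LIMSEQ_INF[OF f(1)] unfolding f(3) \<theta>(2)[symmetric] .
  then have "\<forall>\<^sub>F i in sequentially. laplace_tr (\<theta> i) < 1"
    using less by (rule order_tendstoD)
  then obtain n0 where n0: "\<And>i. i \<ge> n0 \<Longrightarrow> laplace_tr (\<theta> i) < 1"
    by (auto simp: eventually_sequentially)
  have bound: "\<theta> i \<le> ln (1 / prob {..- \<delta>}) / \<delta>" if "i \<ge> n0" for i
  proof -
    have p: "prob {..- \<delta>} > 0" using \<delta> by (simp add: emeasure_eq_measure)
    have "ennreal (exp (\<theta> i * \<delta>)) * emeasure \<nu> {..- \<delta>} \<le> laplace_tr (\<theta> i)" by (rule laplace_tr_lower_bound[OF \<theta>(1)])
    also have "\<dots> \<le> 1" using n0[OF that] by simp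
    finally have "ennreal (exp (\<theta> i * \<delta>) * prob {..- \<delta>}) \<le> ennreal 1"
      by (simp add: emeasure_eq_measure ennreal_mult)
    then have "exp (\<theta> i * \<delta>) * prob {..- \<delta>} \<le> 1" by (subst (asm) ennreal_le_iff) auto
    then have "exp (\<theta> i * \<delta>) \<le> 1 / prob {..- \<delta>}" using p by (simp add: field_simps)
    then have "\<theta> i * \<delta> \<le> ln (1 / prob {..- \<delta>})" by (metis exp_gt_zero ln_exp ln_mono order_less_le_trans)
    then show ?thesis using \<delta> by (simp add: field_simps)
  qed
  define \<psi> where "\<psi> i = \<theta> (i + n0)" for i
  have "bounded (range \<psi>)"
    using bound \<theta>(1) by (intro boundedI[of _ "ln (1 / prob {..- \<delta>}) / \<delta>"]) (auto simp: \<psi>_def)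
  then obtain \<gamma> r where r: "strict_mono r" and lim_\<gamma>: "(\<lambda>k. \<psi> (r k)) \<longlonglongrightarrow> \<gamma>"
    using bounded_imp_convergent_subsequence unfolding o_def by blast
  have lim': "(\<lambda>k. laplace_tr (\<psi> (r k))) \<longlonglongrightarrow> ?m"
    using LIMSEQ_subseq_LIMSEQ[OF LIMSEQ_ignore_initial_segment[OF lim, of n0] r] by (simp add: o_def \<psi>_def)
  have \<gamma>0: "\<gamma> \<ge> 0"
    by (rule LIMSEQ_le_const[OF lim_\<gamma>]) (use \<theta>(1) in \<open>auto simp: \<psi>_def\<close>)
  have "laplace_tr \<gamma> = (\<integral>\<^sup>+x. liminf (\<lambda>k. ennreal (exp (- \<psi> (r k) * x))) \<partial>\<nu>)"
    unfolding laplace_tr_def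
  proof (intro nn_integral_cong)
    fix x
    have "(\<lambda>k. ennreal (exp (- \<psi> (r k) * x))) \<longlonglongrightarrow> ennreal (exp (- \<gamma> * x))"
      by (intro tendsto_ennrealI tendsto_intros lim_\<gamma>)
    then show "ennreal (exp (- \<gamma> * x)) = liminf (\<lambda>k. ennreal (exp (- \<psi> (r k) * x)))"
      by (intro lim_imp_Liminf[symmetric]) auto
  qed
  also have "\<dots> \<le> liminf (\<lambda>k. laplace_tr (\<psi> (r k)))"
    unfolding laplace_tr_def by (rule nn_integral_liminf) measurable
  also have "\<dots> = ?m" by (rule lim_imp_Liminf[OF _ lim']) simp
  finally have "laplace_tr \<gamma> \<le> ?m" .
  moreover have "?m \<le> laplace_tr \<gamma>" using \<gamma>0 by (intro INF_lower) simp
  ultimately have eq: "laplace_tr \<gamma> = ?m" by (rule antisym)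
  then have "\<gamma> \<noteq> 0" using less by auto
  then show ?thesis using eq \<gamma>0 by (intro exI[of _ \<gamma>]) auto
qed

text \<open>
  Strict convexity: the mean of the two exponentials exceeds the exponential at the midpoint by
  half of a square, which then has integral zero and forces the step to vanish almost surely.
\<close>
lemma INF_laplace_tr_unique:
  assumes neg: "emeasure \<nu> {..<0} > 0"
    and "0 \<le> \<theta>1" "0 \<le> \<theta>2" and eq: "laplace_tr \<theta>1 = (INF \<theta>\<in>{0..}. laplace_tr \<theta>)" "laplace_tr \<theta>2 = (INF \<theta>\<in>{0..}. laplace_tr \<theta>)"
  shows "\<theta>1 = \<theta>2"
proof (rule ccontr)
  assume ne: "\<theta>1 \<noteq> \<theta>2"
  let ?m = "INF \<theta>\<in>{0..}. laplace_tr \<theta>"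
  have "?m \<le> laplace_tr 0" by (rule INF_lower) simp
  then have fin: "?m < \<infinity>" by (auto intro: le_less_trans)
  have int: "integrable \<nu> (\<lambda>x. exp (- \<theta>1 * x))" "integrable \<nu> (\<lambda>x. exp (- \<theta>2 * x))"
    using fin eq unfolding laplace_tr_def by (auto intro!: integrableI_nonneg)
  have val: "(\<integral>x. exp (- \<theta>1 * x) \<partial>\<nu>) = enn2real ?m" "(\<integral>x. exp (- \<theta>2 * x) \<partial>\<nu>) = enn2real ?m"
    using eq unfolding laplace_tr_def by (auto simp: integral_eq_nn_integral)
  define \<theta> where "\<theta> = (\<theta>1 + \<theta>2) / 2"
  have sq: "(exp (- \<theta>1 * x) + exp (- \<theta>2 * x)) / 2 - exp (- \<theta> * x) = (exp (- \<theta>1 * x / 2) - exp (- \<theta>2 * x / 2))\<^sup>2 / 2" for x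
    by (simp add: power2_diff \<theta>_def exp_of_nat_mult[symmetric] exp_double[symmetric] exp_add[symmetric] power2_eq_square field_simps)
  have le: "exp (- \<theta> * x) \<le> (exp (- \<theta>1 * x) + exp (- \<theta>2 * x)) / 2" for x
    using sq[of x] by (smt (verit) divide_nonneg_pos zero_le_power2)
  have int\<theta>: "integrable \<nu> (\<lambda>x. exp (- \<theta> * x))"
    by (rule Bochner_Integration.integrable_bound[where f = "\<lambda>x. (exp (- \<theta>1 * x) + exp (- \<theta>2 * x)) / 2"])
       (use int le in \<open>auto intro!: AE_I2\<close>)
  have "?m \<le> laplace_tr \<theta>" using assms by (intro INF_lower) (simp add: \<theta>_def)
  also have "laplace_tr \<theta> = ennreal (\<integral>x. exp (- \<theta> * x) \<partial>\<nu>)"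
    unfolding laplace_tr_def by (rule nn_integral_eq_integral[OF int\<theta>]) simp
  finally have "enn2real ?m \<le> (\<integral>x. exp (- \<theta> * x) \<partial>\<nu>)"
    by (metis enn2real_ennreal enn2real_mono ennreal_less_top integral_nonneg_AE AE_I2 exp_ge_zero)
  moreover have "(\<integral>x. (exp (- \<theta>1 * x / 2) - exp (- \<theta>2 * x / 2))\<^sup>2 / 2 \<partial>\<nu>) = enn2real ?m - (\<integral>x. exp (- \<theta> * x) \<partial>\<nu>)"
    unfolding sq[symmetric] using int int\<theta> val by simp
  moreover have int_sq: "integrable \<nu> (\<lambda>x. (exp (- \<theta>1 * x / 2) - exp (- \<theta>2 * x / 2))\<^sup>2 / 2)"
    unfolding sq[symmetric] using int int\<theta> by simp
  moreover have "0 \<le> (\<integral>x. (exp (- \<theta>1 * x / 2) - exp (- \<theta>2 * x / 2))\<^sup>2 / 2 \<partial>\<nu>)" by simp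
  ultimately have "(\<integral>x. (exp (- \<theta>1 * x / 2) - exp (- \<theta>2 * x / 2))\<^sup>2 / 2 \<partial>\<nu>) = 0" by linarith
  then have "AE x in \<nu>. (exp (- \<theta>1 * x / 2) - exp (- \<theta>2 * x / 2))\<^sup>2 / 2 = 0"
    using int_sq by (subst (asm) integral_nonneg_eq_0_iff_AE) auto
  then have "AE x in \<nu>. x \<notin> {..<0}"
    by eventually_elim (use ne in auto)
  then have "emeasure \<nu> {..<0} = 0"
    by (subst (asm) AE_iff_measurable[of "{..<0}"]) (auto simp: sets_law)
  with neg show False by simp
qed

text \<open>
  The mean is minus the left derivative of the Laplace transform at its minimiser. Only first-order
  information on one side is available, as the transform may be infinite to the right of \<open>\<gamma>\<close>, and
  integrability is part of the claim. The difference quotients \<open>f n\<close> have nonnegative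
  integrals and are bounded above by \<open>2 / \<gamma>\<close>, so Fatou's lemma applies to \<open>2 / \<gamma> - f n\<close>.
\<close>
lemma tilted_mean_nonneg:
  assumes \<gamma>: "\<gamma> > 0" and fin: "laplace_tr \<gamma> < \<infinity>" and min: "\<And>\<theta>. 0 \<le> \<theta> \<Longrightarrow> laplace_tr \<gamma> \<le> laplace_tr \<theta>"
  shows "integrable \<nu> (\<lambda>x. x * exp (- \<gamma> * x))" "(\<integral>x. x * exp (- \<gamma> * x) \<partial>\<nu>) \<ge> 0"
proof -
  have int: "integrable \<nu> (\<lambda>x. exp (- \<theta> * x))" if "0 \<le> \<theta>" "\<theta> \<le> \<gamma>" for \<theta>
  proof (rule Bochner_Integration.integrable_bound[where f = "\<lambda>x. 1 + exp (- \<gamma> * x)"])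
    show "integrable \<nu> (\<lambda>x. 1 + exp (- \<gamma> * x))"
    proof (rule Bochner_Integration.integrable_add)
      show "integrable \<nu> (\<lambda>x. exp (- \<gamma> * x))"
        using fin unfolding laplace_tr_def by (auto intro!: integrableI_nonneg)
    qed simp
    have "exp (- \<theta> * x) \<le> 1 + exp (- \<gamma> * x)" for x
    proof (cases "x \<ge> 0")
      case True
      then have "exp (- \<theta> * x) \<le> 1" using that by simp
      then show ?thesis by (simp add: add_increasing2)
    next
      case False
      then have "exp (- \<theta> * x) \<le> exp (- \<gamma> * x)" using that by (simp add: mult_right_mono_neg)
      then show ?thesis by (rule add_increasing[OF zero_le_one])
    qed
    then show "AE x in \<nu>. norm (exp (- \<theta> * x)) \<le> norm (1 + exp (- \<gamma> * x))"
      by (intro AE_I2) (simp add: abs_of_nonneg add_nonneg_nonneg)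
  qed simp
  \<comment> \<open>at most \<open>\<gamma> / 2\<close>, so that \<open>x exp (- (\<gamma> - e n) x) \<le> x exp (- \<gamma> x / 2) \<le> 2 / \<gamma>\<close> for \<open>x \<ge> 0\<close>\<close>
  define e where "e n = \<gamma> / 2 / real (Suc n)" for n
  have e: "0 < e n" "e n \<le> \<gamma> / 2" for n
    using \<gamma> by (auto simp: e_def divide_le_eq mult_le_cancel_left1)
  define f where "f n x = (exp (- (\<gamma> - e n) * x) - exp (- \<gamma> * x)) / e n" for n x
  have f_eq: "f n x = exp (- \<gamma> * x) * ((exp (e n * x) - 1) / e n)" for n x
    by (simp add: f_def exp_add[symmetric] algebra_simps diff_divide_distrib)
  have f_le: "f n x \<le> 2 / \<gamma>" for n x
  proof (cases "x \<ge> 0")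
    case True
    have "exp (e n * x) - 1 \<le> (e n * x) * exp (e n * x)"
    proof -
      have "1 - e n * x \<le> exp (- (e n * x))" using exp_ge_add_one_self[of "- (e n * x)"] by simp
      then have "(1 - e n * x) * exp (e n * x) \<le> exp (- (e n * x)) * exp (e n * x)" by (rule mult_right_mono) simp
      then show ?thesis by (simp add: exp_add[symmetric] algebra_simps)
    qed
    then have "(exp (e n * x) - 1) / e n \<le> x * exp (e n * x)"
      using e(1)[of n] by (simp add: field_simps)
    then have "f n x \<le> exp (- \<gamma> * x) * (x * exp (e n * x))"
      unfolding f_eq by (rule mult_left_mono) simp
    also have "\<dots> = x * exp (- ((\<gamma> - e n) * x))" by (simp add: exp_add[symmetric] algebra_simps)
    also have "\<dots> \<le> x * exp (- (\<gamma> / 2 * x))"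
    proof -
      have "\<gamma> / 2 * x \<le> (\<gamma> - e n) * x"
        using True e(2)[of n] by (intro mult_right_mono) auto
      then show ?thesis using True by (intro mult_left_mono) auto
    qed
    also have "\<dots> \<le> 2 / \<gamma>"
    proof -
      have "\<gamma> / 2 * x \<le> exp (\<gamma> / 2 * x)" using exp_ge_add_one_self[of "\<gamma> / 2 * x"] by linarith
      then have "(\<gamma> / 2 * x) * exp (- (\<gamma> / 2 * x)) \<le> exp (\<gamma> / 2 * x) * exp (- (\<gamma> / 2 * x))" by (rule mult_right_mono) simp
      then have "(\<gamma> / 2 * x) * exp (- (\<gamma> / 2 * x)) \<le> 1" by (simp add: exp_add[symmetric])
      then show ?thesis using \<gamma> by (simp add: field_simps)
    qed
    finally show ?thesis .
  next
    case False
    then have "exp (e n * x) \<le> 1" using e(1)[of n] by (simp add: mult_nonneg_nonpos less_imp_le)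
    then have "(exp (e n * x) - 1) / e n \<le> 0" using e(1)[of n] by (simp add: divide_nonpos_pos)
    then have "f n x \<le> 0" unfolding f_eq by (intro mult_nonneg_nonpos) simp_all
    then show ?thesis using \<gamma> by (smt (verit) divide_nonneg_pos)
  qed
  have f_lim: "(\<lambda>n. f n x) \<longlonglongrightarrow> x * exp (- \<gamma> * x)" for x
  proof -
    have "((\<lambda>h. exp (h * x)) has_real_derivative x * exp (0 * x)) (at 0)"
      by (rule derivative_eq_intros refl | simp)+
    then have "((\<lambda>h. (exp (h * x) - 1) / h) \<longlongrightarrow> x) (at 0)"
      by (simp add: DERIV_def)
    moreover have "filterlim e (at 0) sequentially"
    proof -
      have "e = (\<lambda>n. \<gamma> / 2 * inverse (real (Suc n)))"
        unfolding e_def[abs_def] divide_inverse[of _ "real (Suc _)"] ..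
      then have "e \<longlonglongrightarrow> 0"
        using tendsto_mult_right_zero[OF LIMSEQ_inverse_real_of_nat, of "\<gamma> / 2"] by (simp only:)
      moreover have "e n \<noteq> 0" for n using e(1)[of n] by simp
      ultimately show ?thesis unfolding filterlim_at by simp
    qed
    ultimately have "(\<lambda>n. (exp (e n * x) - 1) / e n) \<longlonglongrightarrow> x"
      by (rule filterlim_compose)
    then have "(\<lambda>n. exp (- \<gamma> * x) * ((exp (e n * x) - 1) / e n)) \<longlonglongrightarrow> exp (- \<gamma> * x) * x"
      by (rule tendsto_mult_left)
    then show ?thesis by (simp only: f_eq mult.commute)
  qed
  have f_int: "integrable \<nu> (f n)" for n
    unfolding f_def[abs_def] using int[of "\<gamma> - e n"] int[of \<gamma>] e[of n] \<gamma> by simp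
  have f_nonneg: "(\<integral>x. f n x \<partial>\<nu>) \<ge> 0" for n
  proof -
    have "ennreal (\<integral>x. exp (- \<gamma> * x) \<partial>\<nu>) = laplace_tr \<gamma>"
      unfolding laplace_tr_def using int[of \<gamma>] \<gamma> by (intro nn_integral_eq_integral[symmetric]) auto
    also have "\<dots> \<le> laplace_tr (\<gamma> - e n)" using e[of n] \<gamma> by (intro min) simp
    also have "\<dots> = ennreal (\<integral>x. exp (- (\<gamma> - e n) * x) \<partial>\<nu>)"
      unfolding laplace_tr_def using int[of "\<gamma> - e n"] e[of n] \<gamma> by (intro nn_integral_eq_integral) auto
    finally have "(\<integral>x. exp (- \<gamma> * x) \<partial>\<nu>) \<le> (\<integral>x. exp (- (\<gamma> - e n) * x) \<partial>\<nu>)"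
      by (subst (asm) ennreal_le_iff) auto
    moreover have "(\<integral>x. f n x \<partial>\<nu>) = ((\<integral>x. exp (- (\<gamma> - e n) * x) \<partial>\<nu>) - (\<integral>x. exp (- \<gamma> * x) \<partial>\<nu>)) / e n"
      unfolding f_def using int[of "\<gamma> - e n"] int[of \<gamma>] e[of n] \<gamma> by simp
    ultimately show ?thesis using e(1)[of n] by simp
  qed
  define g where "g x = 2 / \<gamma> - x * exp (- \<gamma> * x)" for x
  have g_nonneg: "g x \<ge> 0" for x
    unfolding g_def using LIMSEQ_le_const2[OF f_lim[of x]] f_le by (auto simp: algebra_simps)
  have "(\<integral>\<^sup>+x. ennreal (g x) \<partial>\<nu>) = (\<integral>\<^sup>+x. liminf (\<lambda>n. ennreal (2 / \<gamma> - f n x)) \<partial>\<nu>)"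
  proof (intro nn_integral_cong)
    fix x
    have "(\<lambda>n. ennreal (2 / \<gamma> - f n x)) \<longlonglongrightarrow> ennreal (g x)"
      unfolding g_def by (intro tendsto_ennrealI tendsto_diff tendsto_const f_lim)
    then show "ennreal (g x) = liminf (\<lambda>n. ennreal (2 / \<gamma> - f n x))"
      by (intro lim_imp_Liminf[symmetric]) auto
  qed
  also have "\<dots> \<le> liminf (\<lambda>n. \<integral>\<^sup>+x. ennreal (2 / \<gamma> - f n x) \<partial>\<nu>)"
    by (rule nn_integral_liminf) (use f_int in auto)
  also have "\<dots> \<le> ennreal (2 / \<gamma>)"
  proof (intro Liminf_le always_eventually allI)
    fix n
    have "(\<integral>\<^sup>+x. ennreal (2 / \<gamma> - f n x) \<partial>\<nu>) = ennreal (\<integral>x. 2 / \<gamma> - f n x \<partial>\<nu>)"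
      using f_int f_le by (intro nn_integral_eq_integral) auto
    also have "(\<integral>x. 2 / \<gamma> - f n x \<partial>\<nu>) = 2 / \<gamma> - (\<integral>x. f n x \<partial>\<nu>)"
      using f_int prob_space by simp
    also have "ennreal \<dots> \<le> ennreal (2 / \<gamma>)"
      using f_nonneg by (intro ennreal_leI) simp
    finally show "(\<integral>\<^sup>+x. ennreal (2 / \<gamma> - f n x) \<partial>\<nu>) \<le> ennreal (2 / \<gamma>)" .
  qed simp
  finally have g_fin: "(\<integral>\<^sup>+x. ennreal (g x) \<partial>\<nu>) \<le> ennreal (2 / \<gamma>)" .
  have g_meas: "g \<in> borel_measurable \<nu>"
    unfolding g_def[abs_def] by measurable
  have g_int: "integrable \<nu> g"
    using g_nonneg g_fin by (intro integrableI_nonneg g_meas) (auto intro: le_less_trans)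
  have "(\<lambda>x. x * exp (- \<gamma> * x)) = (\<lambda>x. 2 / \<gamma> - g x)" by (auto simp: g_def)
  then show "integrable \<nu> (\<lambda>x. x * exp (- \<gamma> * x))" using g_int by simp
  have "ennreal (\<integral>x. g x \<partial>\<nu>) \<le> ennreal (2 / \<gamma>)"
    using g_fin nn_integral_eq_integral[OF g_int] g_nonneg by simp
  then have "(\<integral>x. g x \<partial>\<nu>) \<le> 2 / \<gamma>" using \<gamma> by (subst (asm) ennreal_le_iff) auto
  moreover have "(\<integral>x. x * exp (- \<gamma> * x) \<partial>\<nu>) = (\<integral>x. 2 / \<gamma> - g x \<partial>\<nu>)" by (simp add: g_def)
  ultimately show "(\<integral>x. x * exp (- \<gamma> * x) \<partial>\<nu>) \<ge> 0"
    using g_int prob_space by simp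
qed

section \<open>The criterion for random walks\<close>

lemma tilted_law:
  assumes \<gamma>: "laplace_tr \<gamma> = ennreal (exp (- a))" and \<mu>: "\<mu> = density \<nu> (\<lambda>x. ennreal (exp a * exp (- \<gamma> * x)))"
  shows "step_law \<mu>"
    "integrable \<mu> (\<lambda>x. x) \<longleftrightarrow> integrable \<nu> (\<lambda>x. x * exp (- \<gamma> * x))"
    "(\<integral>x. x \<partial>\<mu>) = exp a * (\<integral>x. x * exp (- \<gamma> * x) \<partial>\<nu>)"
proof -
  show "step_law \<mu>"
  proof (intro step_law.intro step_law_axioms.intro prob_spaceI)
    have "emeasure \<mu> (space \<mu>) = (\<integral>\<^sup>+x. ennreal (exp a) * ennreal (exp (- \<gamma> * x)) \<partial>\<nu>)"
      unfolding \<mu> by (subst emeasure_density) (auto intro!: nn_integral_cong simp: ennreal_mult)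
    also have "\<dots> = ennreal (exp a) * laplace_tr \<gamma>"
      unfolding laplace_tr_def by (rule nn_integral_cmult) simp
    also have "\<dots> = 1"
      unfolding \<gamma> by (simp add: ennreal_mult[symmetric] exp_add[symmetric])
    finally show "emeasure \<mu> (space \<mu>) = 1" .
    show "sets \<mu> = sets borel" unfolding \<mu> by (simp add: sets_law)
  qed
  have "integrable \<mu> (\<lambda>x. x) \<longleftrightarrow> integrable \<nu> (\<lambda>x. (exp a * exp (- \<gamma> * x)) *\<^sub>R x)"
    unfolding \<mu> by (rule integrable_density) auto
  also have "(\<lambda>x. (exp a * exp (- \<gamma> * x)) *\<^sub>R x) = (\<lambda>x. exp a * (x * exp (- \<gamma> * x)))" by (auto simp: ac_simps)
  finally show "integrable \<mu> (\<lambda>x. x) \<longleftrightarrow> integrable \<nu> (\<lambda>x. x * exp (- \<gamma> * x))"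
    using integrable_mult_left_iff[of \<nu> "exp a" "\<lambda>x. x * exp (- \<gamma> * x)"] by (simp only: exp_not_eq_zero simp_thms)
  have "(\<integral>x. x \<partial>\<mu>) = (\<integral>x. (exp a * exp (- \<gamma> * x)) *\<^sub>R x \<partial>\<nu>)"
    unfolding \<mu> by (rule integral_density) auto
  also have "\<dots> = (\<integral>x. exp a * (x * exp (- \<gamma> * x)) \<partial>\<nu>)" by (simp add: ac_simps)
  finally show "(\<integral>x. x \<partial>\<mu>) = exp a * (\<integral>x. x * exp (- \<gamma> * x) \<partial>\<nu>)" by simp
qed

definition green :: "real \<Rightarrow> real \<Rightarrow> ennreal" where
  "green a x = (\<Sum>n. ennreal (exp (a * real n)) * emeasure Paths {\<omega>. walk \<omega> n \<le> x})"

lemma green_finite_subcritical: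
  assumes "(INF \<theta>\<in>{0..}. laplace_tr \<theta>) < ennreal (exp (- a))"
  shows "green a x < \<infinity>"
proof -
  obtain \<theta> where \<theta>: "\<theta> \<ge> 0" "laplace_tr \<theta> < ennreal (exp (- a))"
    using assms by (auto simp: INF_less_iff)
  define q where "q = enn2real (laplace_tr \<theta>)"
  have q: "laplace_tr \<theta> = ennreal q" "q \<ge> 0"
    using \<theta>(2) by (auto simp: q_def intro!: ennreal_enn2real[symmetric] less_trans[OF \<theta>(2)])
  have "q < exp (- a)" using \<theta>(2) q by (simp add: ennreal_less_iff)
  then have "exp a * q < exp a * exp (- a)" by simp
  then have qa: "exp a * q < 1" by (simp add: exp_add[symmetric])
  have "green a x \<le> (\<Sum>n. ennreal (exp (a * real n)) * (ennreal (exp (\<theta> * x)) * laplace_tr \<theta> ^ n))"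
    unfolding green_def by (intro suminf_le mult_left_mono chernoff \<theta>) auto
  also have "\<dots> = (\<Sum>n. ennreal (exp (\<theta> * x) * (exp a * q) ^ n))"
    using q(2) by (intro suminf_cong)
      (simp add: q(1) ennreal_power ennreal_mult[symmetric] power_mult_distrib exp_of_nat_mult[symmetric] ac_simps)
  also have "\<dots> = ennreal (\<Sum>n. exp (\<theta> * x) * (exp a * q) ^ n)"
    using q(2) qa by (intro suminf_ennreal2 summable_mult summable_geometric) auto
  finally show ?thesis by (auto intro: le_less_trans)
qed

lemma green_finite_critical:
  assumes \<gamma>: "\<gamma> > 0" "laplace_tr \<gamma> = ennreal (exp (- a))" and pos: "(\<integral>x. x * exp (- \<gamma> * x) \<partial>\<nu>) > 0"
  shows "green a x < \<infinity>"
proof -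
  define \<mu> where "\<mu> = density \<nu> (\<lambda>x. ennreal (exp a * exp (- \<gamma> * x)))"
  note \<mu> = tilted_law[OF \<gamma>(2) \<mu>_def]
  have "integrable \<nu> (\<lambda>x. x * exp (- \<gamma> * x))"
    using pos not_integrable_integral_eq by fastforce
  then show ?thesis
    unfolding green_def using pos \<gamma>(1) \<mu> by (intro weighted_visits_finite_of_tilted_mean_pos[OF \<mu>(1) \<mu>_def]) auto
qed

lemma last_visit_mgf_finite_imp_decay:
  assumes neg: "emeasure \<nu> {..<0} > 0" and fin: "last_visit_mgf a r < \<infinity>"
  shows "(INF \<theta>\<in>{0..}. laplace_tr \<theta>) \<le> ennreal (exp (- a))"
proof (rule LIMSEQ_le_const)
  show "(\<lambda>n. ennreal (exp (inverse (real (Suc n)) - a))) \<longlonglongrightarrow> ennreal (exp (- a))"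
  proof -
    have "(\<lambda>n. inverse (real (Suc n)) - a) \<longlonglongrightarrow> 0 - a"
      by (intro tendsto_diff tendsto_const LIMSEQ_inverse_real_of_nat)
    then show ?thesis by (intro tendsto_ennrealI tendsto_exp) simp
  qed
  have "(INF \<theta>\<in>{0..}. laplace_tr \<theta>) \<le> ennreal (exp (inverse (real (Suc n)) - a))" for n
  proof -
    obtain \<theta> where "\<theta> \<ge> 0" "laplace_tr \<theta> \<le> ennreal (exp (inverse (real (Suc n)) - a))"
      using laplace_tr_le_of_last_visit_mgf_finite[OF neg fin, of "inverse (real (Suc n))"] by auto
    then show ?thesis by (intro INF_lower2[of \<theta>]) auto
  qed
  then show "\<exists>N. \<forall>n\<ge>N. (INF \<theta>\<in>{0..}. laplace_tr \<theta>) \<le> ennreal (exp (inverse (real (Suc n)) - a))" by blast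
qed

text \<open>
  The tilted mean is nonnegative by minimality and nonzero by transience of the tilted walk.
\<close>
lemma last_visit_mgf_finite_imp_tilted_mean_pos:
  assumes neg: "emeasure \<nu> {..<0} > 0" and a: "a > 0" and r: "r \<ge> 0" and fin: "last_visit_mgf a r < \<infinity>"
    and \<gamma>: "\<gamma> > 0" "laplace_tr \<gamma> = ennreal (exp (- a))" and min: "laplace_tr \<gamma> = (INF \<theta>\<in>{0..}. laplace_tr \<theta>)"
  shows "(\<integral>x. x * exp (- \<gamma> * x) \<partial>\<nu>) > 0"
proof -
  define \<mu> where "\<mu> = density \<nu> (\<lambda>x. ennreal (exp a * exp (- \<gamma> * x)))"
  note \<mu> = tilted_law[OF \<gamma>(2) \<mu>_def]
  have "laplace_tr \<gamma> < \<infinity>" by (simp add: \<gamma>(2))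
  moreover have "laplace_tr \<gamma> \<le> laplace_tr \<theta>" if "0 \<le> \<theta>" for \<theta>
    unfolding min using that by (intro INF_lower) simp
  ultimately have m: "integrable \<nu> (\<lambda>x. x * exp (- \<gamma> * x))" "(\<integral>x. x * exp (- \<gamma> * x) \<partial>\<nu>) \<ge> 0"
    using tilted_mean_nonneg[OF \<gamma>(1)] by auto
  have "(\<integral>x. x \<partial>\<mu>) \<noteq> 0"
    using m(1) \<mu>(2) by (intro tilted_mean_nonzero[OF neg a r fin \<mu>(1) \<mu>_def \<gamma>(1)]) simp
  then show ?thesis using m(2) \<mu>(3) by auto
qed

end

section \<open>Skeleton walks of a Levy process\<close>

context levy_process
begin

definition law :: "real \<Rightarrow> real measure" where
  "law h = distr M borel (X h)"

definition steps :: "real \<Rightarrow> 'w \<Rightarrow> nat \<Rightarrow> real" where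
  "steps h \<omega> k = X (real (Suc k) * h) \<omega> - X (real k * h) \<omega>"

lemma step_law_law: "h \<ge> 0 \<Longrightarrow> step_law (law h)"
  unfolding law_def
  by (intro step_law.intro step_law_axioms.intro prob_space_distr random_variable) auto

lemma walk_steps: "\<omega> \<in> space M \<Longrightarrow> walk (steps h \<omega>) n = X (real n * h) \<omega>"
  unfolding walk_def steps_def
  by (subst sum_lessThan_telescope) (simp add: start_zero)

lemma measurable_X [measurable]: "t \<ge> 0 \<Longrightarrow> X t \<in> borel_measurable M"
  by (rule random_variable)

lemma indep_steps:
  assumes h: "h \<ge> 0"
  shows "indep_vars (\<lambda>_. borel) (\<lambda>k \<omega>. steps h \<omega> k) UNIV"
  unfolding indep_vars_def2
proof (intro conjI ballI)
  show "(\<lambda>\<omega>. steps h \<omega> k) \<in> borel_measurable M" for k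
    unfolding steps_def using h by (intro borel_measurable_diff random_variable) auto
  show "indep_sets (\<lambda>k. {(\<lambda>\<omega>. steps h \<omega> k) -` A \<inter> space M |A. A \<in> sets borel}) UNIV"
  proof (subst indep_sets_finite_index_sets, intro allI impI)
    fix J :: "nat set" assume J: "J \<subseteq> UNIV" "J \<noteq> {}" "finite J"
    have "indep_vars (\<lambda>_. borel) (\<lambda>i \<omega>. X (real (Suc i) * h) \<omega> - X (real i * h) \<omega>) {..<Suc (Max J)}"
      using h by (intro indep_increments[where \<tau> = "\<lambda>i. real i * h"]) (auto intro: mult_right_mono)
    then have "indep_sets (\<lambda>k. {(\<lambda>\<omega>. steps h \<omega> k) -` A \<inter> space M |A. A \<in> sets borel}) {..<Suc (Max J)}"
      unfolding indep_vars_def2 steps_def by blast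
    moreover have "J \<subseteq> {..<Suc (Max J)}" using J by (auto simp: less_Suc_eq_le)
    ultimately show "indep_sets (\<lambda>k. {(\<lambda>\<omega>. steps h \<omega> k) -` A \<inter> space M |A. A \<in> sets borel}) J"
      by (meson indep_sets_mono_index)
  qed
qed

text \<open>
  The increments over a grid of mesh \<open>h\<close> form a random walk, to which all results about path
  spaces apply. The mesh is \<open>1\<close> for the embedded walk, dyadic for the maximal inequality, and a fraction
  of a given time in \<open>uniform_lower_bound\<close>.
\<close>
lemma distr_steps:
  assumes h: "h \<ge> 0"
  shows "distr M (Pi\<^sub>M UNIV (\<lambda>_. borel)) (steps h) = Pi\<^sub>M UNIV (\<lambda>_. law h)"
proof -
  have rv: "(\<lambda>\<omega>. steps h \<omega> k) \<in> borel_measurable M" for k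
    unfolding steps_def using h by (intro borel_measurable_diff random_variable) auto
  have "distr M borel (\<lambda>\<omega>. steps h \<omega> k) = law h" for k
  proof -
    have "distr M borel (\<lambda>\<omega>. steps h \<omega> k) = distr M borel (\<lambda>\<omega>. X (real k * h + h) \<omega> - X (real k * h) \<omega>)"
      by (simp add: steps_def algebra_simps)
    also have "\<dots> = distr M borel (\<lambda>\<omega>. X h \<omega> - X 0 \<omega>)"
      using h by (intro stationary_increments) auto
    also have "\<dots> = law h"
      unfolding law_def by (intro distr_cong refl) (simp add: start_zero)
    finally show ?thesis .
  qed
  moreover have "distr M (Pi\<^sub>M UNIV (\<lambda>_. borel)) (\<lambda>\<omega>. \<lambda>k\<in>UNIV. steps h \<omega> k) = Pi\<^sub>M UNIV (\<lambda>k. distr M borel (\<lambda>\<omega>. steps h \<omega> k))"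
    using indep_steps[OF h] by (subst (asm) indep_vars_iff_distr_eq_PiM) (auto intro: rv)
  ultimately show ?thesis by (simp add: restrict_UNIV)
qed

lemma measurable_steps:
  assumes h: "h \<ge> 0"
  shows "steps h \<in> measurable M (Pi\<^sub>M UNIV (\<lambda>_. law h))"
proof -
  have "sets (Pi\<^sub>M (UNIV :: nat set) (\<lambda>_. law h)) = sets (Pi\<^sub>M UNIV (\<lambda>_. borel))"
    by (intro sets_PiM_cong) (simp_all add: law_def)
  moreover have "steps h \<in> measurable M (Pi\<^sub>M UNIV (\<lambda>_. borel))"
    unfolding steps_def[abs_def] using h
    by (intro measurable_PiM_single') (auto intro!: borel_measurable_diff random_variable simp: space_PiM)
  ultimately show ?thesis by (metis measurable_cong_sets)
qed

lemma nn_integral_steps: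
  fixes F :: "(nat \<Rightarrow> real) \<Rightarrow> ennreal"
  assumes h: "h \<ge> 0" and F: "F \<in> borel_measurable (Pi\<^sub>M UNIV (\<lambda>_. law h))"
  shows "(\<integral>\<^sup>+\<omega>. F (steps h \<omega>) \<partial>M) = (\<integral>\<^sup>+\<omega>. F \<omega> \<partial>(Pi\<^sub>M UNIV (\<lambda>_. law h)))"
proof -
  have sets: "sets (Pi\<^sub>M (UNIV :: nat set) (\<lambda>_. law h)) = sets (Pi\<^sub>M UNIV (\<lambda>_. borel))"
    by (intro sets_PiM_cong) (simp_all add: law_def)
  have meas: "steps h \<in> measurable M (Pi\<^sub>M UNIV (\<lambda>_. borel))"
    using measurable_steps[OF h] sets by (metis measurable_cong_sets)
  have F': "F \<in> borel_measurable (Pi\<^sub>M UNIV (\<lambda>_. borel))"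
    using F sets by (metis measurable_cong_sets)
  show ?thesis
    unfolding distr_steps[OF h, symmetric] by (rule nn_integral_distr[OF meas, symmetric]) (use F' in simp)
qed

lemma emeasure_steps:
  assumes h: "h \<ge> 0" and A: "Measurable.pred (Pi\<^sub>M UNIV (\<lambda>_. law h)) A"
    and eq: "\<And>\<omega>. \<omega> \<in> space M \<Longrightarrow> A (steps h \<omega>) = B \<omega>"
  shows "emeasure M {\<omega> \<in> space M. B \<omega>} = emeasure (Pi\<^sub>M UNIV (\<lambda>_. law h)) {\<omega>. A \<omega>}"
    "{\<omega> \<in> space M. B \<omega>} \<in> sets M"
proof -
  interpret W: step_law "law h" by (rule step_law_law[OF h])
  have "{\<omega> \<in> space M. B \<omega>} = steps h -` {\<omega>. A \<omega>} \<inter> space M"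
    using eq by auto
  then show meas: "{\<omega> \<in> space M. B \<omega>} \<in> sets M"
    using measurable_sets[OF measurable_steps[OF h] W.sets_Collect_Paths[OF A]] by simp
  note [measurable] = A
  have "emeasure M {\<omega> \<in> space M. B \<omega>} = (\<integral>\<^sup>+\<omega>. indicator {\<omega> \<in> space M. B \<omega>} \<omega> \<partial>M)"
    using meas by simp
  also have "\<dots> = (\<integral>\<^sup>+\<omega>. (if A (steps h \<omega>) then 1 else 0) \<partial>M)"
    by (intro nn_integral_cong) (simp add: eq indicator_def)
  also have "\<dots> = (\<integral>\<^sup>+\<omega>. (if A \<omega> then 1 else 0) \<partial>W.Paths)"
    by (rule nn_integral_steps[OF h, where F = "\<lambda>\<omega>. if A \<omega> then 1 else 0"]) measurable
  finally show "emeasure M {\<omega> \<in> space M. B \<omega>} = emeasure W.Paths {\<omega>. A \<omega>}"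
    by (simp add: W.emeasure_Collect_Paths)
qed

lemma emeasure_walk_eq:
  assumes h: "h \<ge> 0"
  shows "emeasure (Pi\<^sub>M UNIV (\<lambda>_. law h)) {\<omega>. walk \<omega> n \<le> x} = emeasure M {\<omega> \<in> space M. X (real n * h) \<omega> \<le> x}"
proof -
  interpret W: step_law "law h" by (rule step_law_law[OF h])
  show ?thesis
    by (rule emeasure_steps(1)[OF h, symmetric]) (auto simp: walk_steps)
qed

section \<open>Comparison of integer times with intermediate times\<close>

lemma emeasure_add_le:
  assumes s: "s \<ge> 0" and u: "u \<ge> 0"
  shows "emeasure M {\<omega> \<in> space M. X s \<omega> \<le> x} * emeasure M {\<omega> \<in> space M. X u \<omega> \<le> y}
    \<le> emeasure M {\<omega> \<in> space M. X (s + u) \<omega> \<le> x + y}"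
proof -
  define \<tau> where "\<tau> i = (if i = 0 then 0 else if i = 1 then s else s + u)" for i :: nat
  have "indep_vars (\<lambda>_. borel) (\<lambda>i \<omega>. X (\<tau> (Suc i)) \<omega> - X (\<tau> i) \<omega>) {..<2}"
    using s u by (intro indep_increments) (auto simp: \<tau>_def)
  then have "prob (\<Inter>i\<in>{0, 1}. (\<lambda>\<omega>. X (\<tau> (Suc i)) \<omega> - X (\<tau> i) \<omega>) -` (if i = 0 then {..x} else {..y}) \<inter> space M)
      = (\<Prod>i\<in>{0, 1}. prob ((\<lambda>\<omega>. X (\<tau> (Suc i)) \<omega> - X (\<tau> i) \<omega>) -` (if i = 0 then {..x} else {..y}) \<inter> space M))"
    by (rule indep_varsD) auto
  also have "\<dots> = prob {\<omega> \<in> space M. X s \<omega> \<le> x} * prob {\<omega> \<in> space M. X (s + u) \<omega> - X s \<omega> \<le> y}"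
    by (simp add: \<tau>_def) (intro arg_cong2[where f = "(*)"] arg_cong[where f = prob]; auto simp: start_zero)
  also have "prob {\<omega> \<in> space M. X (s + u) \<omega> - X s \<omega> \<le> y} = prob {\<omega> \<in> space M. X u \<omega> \<le> y}"
  proof -
    have rv: "(\<lambda>\<omega>. X (s + u) \<omega> - X s \<omega>) \<in> borel_measurable M" "(\<lambda>\<omega>. X u \<omega> - X 0 \<omega>) \<in> borel_measurable M"
      using s u by (auto intro!: borel_measurable_diff random_variable)
    have "prob {\<omega> \<in> space M. X (s + u) \<omega> - X s \<omega> \<le> y} = measure (distr M borel (\<lambda>\<omega>. X (s + u) \<omega> - X s \<omega>)) {..y}"
      using rv by (subst measure_distr) (auto intro!: arg_cong[where f = prob])
    also have "\<dots> = measure (distr M borel (\<lambda>\<omega>. X u \<omega> - X 0 \<omega>)) {..y}"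
      by (simp only: stationary_increments[OF s u])
    also have "\<dots> = prob {\<omega> \<in> space M. X u \<omega> \<le> y}"
      using rv by (subst measure_distr) (auto intro!: arg_cong[where f = prob] simp: start_zero)
    finally show ?thesis .
  qed
  finally have eq: "prob {\<omega> \<in> space M. X s \<omega> \<le> x} * prob {\<omega> \<in> space M. X u \<omega> \<le> y}
      = prob (\<Inter>i\<in>{0, 1::nat}. (\<lambda>\<omega>. X (\<tau> (Suc i)) \<omega> - X (\<tau> i) \<omega>) -` (if i = 0 then {..x} else {..y}) \<inter> space M)" ..
  have m: "X (s + u) \<in> borel_measurable M" using s u by (intro random_variable) simp
  have "prob (\<Inter>i\<in>{0, 1::nat}. (\<lambda>\<omega>. X (\<tau> (Suc i)) \<omega> - X (\<tau> i) \<omega>) -` (if i = 0 then {..x} else {..y}) \<inter> space M)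
      \<le> prob {\<omega> \<in> space M. X (s + u) \<omega> \<le> x + y}"
    by (rule finite_measure_mono) (use m in \<open>auto simp: \<tau>_def start_zero\<close>)
  then show ?thesis
    unfolding emeasure_eq_measure eq[symmetric] by (simp add: ennreal_mult[symmetric] ennreal_leI)
qed

text \<open>
  Stochastic continuity at \<open>0\<close> gives the bound \<open>1 / 2\<close> for short times, with \<open>1\<close> in place of \<open>C\<close>.
  A time in \<open>[0, 1]\<close> is the sum of \<open>N\<close> equal short times, which costs a power.
\<close>
lemma uniform_lower_bound:
  obtains C \<kappa> :: real where "\<kappa> > 0"
    "\<And>s. 0 \<le> s \<Longrightarrow> s \<le> 1 \<Longrightarrow> ennreal \<kappa> \<le> emeasure M {\<omega> \<in> space M. X s \<omega> \<le> C}"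
proof -
  have "((\<lambda>s. prob {\<omega> \<in> space M. \<bar>X s \<omega> - X 0 \<omega>\<bar> > 1}) \<longlongrightarrow> 0) (at 0 within {0..})"
    by (rule stochastically_continuous) auto
  then have "\<forall>\<^sub>F s in at 0 within {0..}. prob {\<omega> \<in> space M. \<bar>X s \<omega> - X 0 \<omega>\<bar> > 1} < 1 / 2"
    by (rule order_tendstoD) simp
  then obtain d where d: "d > 0" "\<And>s. 0 < s \<Longrightarrow> s < d \<Longrightarrow> prob {\<omega> \<in> space M. \<bar>X s \<omega> - X 0 \<omega>\<bar> > 1} < 1 / 2"
    unfolding eventually_at by (auto simp: dist_real_def)
  have half: "ennreal (1 / 2) \<le> emeasure M {\<omega> \<in> space M. X s \<omega> \<le> 1}" if s: "0 \<le> s" "s < d" for s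
  proof (cases "s = 0")
    case True
    then have "{\<omega> \<in> space M. X s \<omega> \<le> 1} = space M" by (auto simp: start_zero)
    moreover have "ennreal (1 / 2) \<le> ennreal 1" by (rule ennreal_leI) simp
    ultimately show ?thesis by (simp only: emeasure_space_1 ennreal_1)
  next
    case False
    have meas: "{\<omega> \<in> space M. \<bar>X s \<omega> - X 0 \<omega>\<bar> > 1} \<in> events"
      using s by measurable
    have meas2: "{\<omega> \<in> space M. X s \<omega> \<le> 1} \<in> events"
      using s by measurable
    have "1 / 2 \<le> 1 - prob {\<omega> \<in> space M. \<bar>X s \<omega> - X 0 \<omega>\<bar> > 1}"
      using d(2)[of s] s False by simp
    also have "\<dots> = prob (space M - {\<omega> \<in> space M. \<bar>X s \<omega> - X 0 \<omega>\<bar> > 1})"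
      by (rule prob_compl[OF meas, symmetric])
    also have "\<dots> \<le> prob {\<omega> \<in> space M. X s \<omega> \<le> 1}"
      by (rule finite_measure_mono[OF _ meas2]) (auto simp: start_zero)
    finally show ?thesis unfolding emeasure_eq_measure by (rule ennreal_leI)
  qed
  obtain N :: nat where N: "1 / d < real N" using reals_Archimedean2 by blast
  moreover have "0 < 1 / d" using d(1) by simp
  ultimately have N0: "real N > 0" by (rule less_trans[rotated])
  then have N': "real N > 0" "1 / real N < d" using N d(1) by (simp_all add: field_simps)
  show ?thesis
  proof (rule that[of "(1 / 2) ^ N" "real N * 1"])
    show "(1 / 2 :: real) ^ N > 0" by simp
    fix s :: real assume s: "0 \<le> s" "s \<le> 1"
    define h where "h = s / real N"
    have h: "h \<ge> 0" "h < d" "real N * h = s"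
      using s N' by (auto simp: h_def intro: le_less_trans[OF divide_right_mono])
    interpret W: step_law "law h" by (rule step_law_law[OF h(1)])
    have "ennreal ((1 / 2) ^ N) = ennreal (1 / 2) ^ N" by (rule ennreal_power[symmetric]) simp
    also have "\<dots> \<le> emeasure W.Paths {\<omega>. walk \<omega> 1 \<le> 1} ^ N"
      using half[of h] h by (intro power_mono) (simp_all add: emeasure_walk_eq)
    also have "\<dots> \<le> emeasure W.Paths {\<omega>. walk \<omega> N \<le> real N * 1}"
      by (rule W.emeasure_walk_power)
    also have "\<dots> = emeasure M {\<omega> \<in> space M. X s \<omega> \<le> real N * 1}"
      using h by (simp add: emeasure_walk_eq)
    finally show "ennreal ((1 / 2) ^ N) \<le> emeasure M {\<omega> \<in> space M. X s \<omega> \<le> real N * 1}" .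
  qed
qed

text \<open>
  The paths that fall below \<open>r\<close> at a dyadic time in \<open>[k, k + 1]\<close>. Dyadic times make this the
  increasing limit of events that belong to the walks with meshes \<open>1 / 2 ^ m\<close>.
\<close>
definition dips :: "nat \<Rightarrow> real \<Rightarrow> 'w set" where
  "dips k r = {\<omega> \<in> space M. \<exists>m. \<exists>j\<in>{k * 2 ^ m..k * 2 ^ m + 2 ^ m}. X (real j * (1 / 2 ^ m)) \<omega> < r}"

text \<open>
  The maximal inequality on the grid of mesh \<open>1 / 2 ^ m\<close> has constants independent of \<open>m\<close>, and
  the grids increase with \<open>m\<close>.
\<close>
lemma dips_bound:
  assumes \<kappa>: "\<And>s. 0 \<le> s \<Longrightarrow> s \<le> 1 \<Longrightarrow> \<kappa> \<le> emeasure M {\<omega> \<in> space M. X s \<omega> \<le> C}"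
  shows "dips k r \<in> events" "\<kappa> * emeasure M (dips k r) \<le> emeasure M {\<omega> \<in> space M. X (real (Suc k)) \<omega> \<le> r + C}"
proof -
  define D where "D m = {\<omega> \<in> space M. \<exists>j\<in>{k * 2 ^ m..k * 2 ^ m + 2 ^ m}. X (real j * (1 / 2 ^ m)) \<omega> < r}" for m :: nat
  have D: "D m \<in> events" "\<kappa> * emeasure M (D m) \<le> emeasure M {\<omega> \<in> space M. X (real (Suc k)) \<omega> \<le> r + C}" for m
  proof -
    define h :: real where "h = 1 / 2 ^ m"
    have h: "h \<ge> 0" by (simp add: h_def)
    interpret W: step_law "law h" by (rule step_law_law[OF h])
    have pred: "Measurable.pred W.Paths (\<lambda>\<omega>. \<exists>j\<in>{k * 2 ^ m..k * 2 ^ m + 2 ^ m}. walk \<omega> j < r)"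
      by measurable
    have eq: "(\<exists>j\<in>{k * 2 ^ m..k * 2 ^ m + 2 ^ m}. walk (steps h \<omega>) j < r) = (\<exists>j\<in>{k * 2 ^ m..k * 2 ^ m + 2 ^ m}. X (real j * (1 / 2 ^ m)) \<omega> < r)"
      if "\<omega> \<in> space M" for \<omega>
      using that by (simp add: walk_steps h_def)
    show "D m \<in> events"
      unfolding D_def by (rule emeasure_steps(2)[OF h pred eq])
    have "\<kappa> * emeasure M (D m) = \<kappa> * emeasure W.Paths {\<omega>. \<exists>j\<in>{k * 2 ^ m..k * 2 ^ m + 2 ^ m}. walk \<omega> j < r}"
      unfolding D_def by (subst emeasure_steps(1)[OF h pred eq]) auto
    also have "\<dots> \<le> emeasure W.Paths {\<omega>. walk \<omega> (k * 2 ^ m + 2 ^ m) \<le> r + C}"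
    proof (rule W.ottaviani)
      fix i :: nat assume "i \<le> 2 ^ m"
      then have "real i \<le> 2 ^ m" by (metis of_nat_le_iff of_nat_numeral of_nat_power)
      then have "real i * h \<le> 1" by (simp add: h_def)
      then show "\<kappa> \<le> emeasure W.Paths {\<omega>. walk \<omega> i \<le> C}"
        unfolding emeasure_walk_eq[OF h] using h by (intro \<kappa>) simp_all
    qed
    also have "\<dots> = emeasure M {\<omega> \<in> space M. X (real (k * 2 ^ m + 2 ^ m) * h) \<omega> \<le> r + C}"
      by (rule emeasure_walk_eq[OF h])
    also have "real (k * 2 ^ m + 2 ^ m) * h = real (Suc k)"
      by (simp add: h_def field_simps)
    finally show "\<kappa> * emeasure M (D m) \<le> emeasure M {\<omega> \<in> space M. X (real (Suc k)) \<omega> \<le> r + C}" .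
  qed
  have Un: "dips k r = (\<Union>m. D m)"
    unfolding dips_def D_def by auto
  then show "dips k r \<in> events" using D(1) by auto
  have inc: "incseq D"
  proof (rule incseq_SucI, rule subsetI)
    fix m \<omega> assume "\<omega> \<in> D m"
    then obtain j where \<omega>: "\<omega> \<in> space M" and j: "j \<in> {k * 2 ^ m..k * 2 ^ m + 2 ^ m}" "X (real j * (1 / 2 ^ m)) \<omega> < r"
      unfolding D_def by blast
    have "2 * j \<in> {k * 2 ^ Suc m..k * 2 ^ Suc m + 2 ^ Suc m}" using j(1) by auto
    moreover have "real (2 * j) * (1 / 2 ^ Suc m) = real j * (1 / 2 ^ m)" by simp
    then have "X (real (2 * j) * (1 / 2 ^ Suc m)) \<omega> < r" using j(2) by (simp only:)
    ultimately show "\<omega> \<in> D (Suc m)" unfolding D_def using \<omega> by blast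
  qed
  have "emeasure M (dips k r) = (SUP m. emeasure M (D m))"
    unfolding Un using D(1) inc by (intro SUP_emeasure_incseq[symmetric]) auto
  then have "\<kappa> * emeasure M (dips k r) = (SUP m. \<kappa> * emeasure M (D m))"
    by (simp add: SUP_mult_left_ennreal)
  also have "\<dots> \<le> emeasure M {\<omega> \<in> space M. X (real (Suc k)) \<omega> \<le> r + C}"
    by (intro SUP_least D)
  finally show "\<kappa> * emeasure M (dips k r) \<le> emeasure M {\<omega> \<in> space M. X (real (Suc k)) \<omega> \<le> r + C}" .
qed

text \<open>
  By right-continuity a value at most \<open>r\<close> at time \<open>t\<close> persists below \<open>r'\<close> at slightly later times, among
  which there is a dyadic one before the next integer.
\<close>
lemma dips_of_visit:
  assumes \<omega>: "\<omega> \<in> space M" and t: "0 \<le> t" "X t \<omega> \<le> r" and r: "r < r'"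
  shows "\<omega> \<in> dips (nat \<lfloor>t\<rfloor>) r'"
proof -
  define k where "k = nat \<lfloor>t\<rfloor>"
  have k: "real k \<le> t" "t < real k + 1" using t(1) unfolding k_def by linarith+
  have "((\<lambda>s. X s \<omega>) \<longlongrightarrow> X t \<omega>) (at_right t)"
    using right_continuous_paths[OF \<omega> t(1)] by (simp add: continuous_within)
  then have "\<forall>\<^sub>F s in at_right t. X s \<omega> < r'"
    by (rule order_tendstoD) (use t r in simp)
  then obtain b where b: "b > t" "\<And>s. t < s \<Longrightarrow> s < b \<Longrightarrow> X s \<omega> < r'"
    unfolding eventually_at_right_field by auto
  define d where "d = min (b - t) (real k + 1 - t)"
  have d: "d > 0" using b(1) k by (simp add: d_def)
  obtain m where m: "(1 / 2) ^ m < d" using real_arch_pow_inv[OF d, of "1/2"] by auto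
  \<comment> \<open>the first point of the grid of mesh \<open>1 / 2 ^ m\<close> strictly after \<open>t\<close>\<close>
  define j where "j = nat (\<lfloor>t * 2 ^ m\<rfloor> + 1)"
  have j: "real j = of_int \<lfloor>t * 2 ^ m\<rfloor> + 1" using t(1) by (simp add: j_def)
  have jl: "t * 2 ^ m < real j" "real j \<le> t * 2 ^ m + 1" unfolding j by linarith+
  define s where "s = real j * (1 / 2 ^ m)"
  have s1: "t < s" using jl(1) by (simp add: s_def field_simps)
  have s2: "s \<le> t + (1 / 2) ^ m" using jl(2) by (simp add: s_def field_simps power_one_over)
  then have s3: "s < b" "s < real k + 1" using m by (auto simp: d_def)
  have "real (k * 2 ^ m) \<le> t * 2 ^ m" using k by simp
  then have "k * 2 ^ m \<le> j" using jl(1) by (metis less_imp_le of_nat_le_iff order_trans)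
  moreover have "real j < real (k * 2 ^ m + 2 ^ m)"
    using s3(2) by (simp add: s_def field_simps)
  then have "j \<le> k * 2 ^ m + 2 ^ m" by (metis less_imp_le of_nat_le_iff)
  ultimately have "j \<in> {k * 2 ^ m..k * 2 ^ m + 2 ^ m}" by simp
  moreover have "X (real j * (1 / 2 ^ m)) \<omega> < r'" using b(2)[of s] s1 s3 by (simp add: s_def)
  ultimately show ?thesis unfolding dips_def k_def[symmetric] using \<omega> by blast
qed

end

section \<open>Last exits and potentials of the process\<close>

definition exp_ext :: "real \<Rightarrow> ennreal \<Rightarrow> ennreal" where
  "exp_ext a y = (if y = \<infinity> then \<infinity> else ennreal (exp (a * enn2real y)))"

lemma exp_ext_ennreal: "t \<ge> 0 \<Longrightarrow> exp_ext a (ennreal t) = ennreal (exp (a * t))"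
  by (simp add: exp_ext_def)

lemma exp_ext_mono:
  assumes "a > 0" "x \<le> y"
  shows "exp_ext a x \<le> exp_ext a y"
proof (cases "y = \<infinity>")
  case False
  then have "y < \<infinity>" by (simp add: less_top)
  then have "x \<noteq> \<infinity>" "enn2real x \<le> enn2real y" using assms(2) by (auto intro: enn2real_mono)
  then show ?thesis using False assms(1) by (auto simp: exp_ext_def intro!: ennreal_leI)
qed (simp add: exp_ext_def)

text \<open>
  Continuity of the exponential function at suprema. The set of times has to be nonempty, since
  the supremum of the empty set is \<open>0\<close>, at which the exponential function is \<open>1\<close>.
\<close>
lemma exp_ext_SUP_le:
  assumes a: "a > 0" and T: "T \<noteq> {}" "\<And>t. t \<in> T \<Longrightarrow> 0 \<le> t" and B: "\<And>t. t \<in> T \<Longrightarrow> ennreal (exp (a * t)) \<le> B"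
  shows "exp_ext a (SUP t\<in>T. ennreal t) \<le> B"
proof (cases "B = \<infinity>")
  case False
  define b where "b = enn2real B"
  have b: "B = ennreal b" "b \<ge> 0" using False by (simp_all add: b_def less_top)
  have le: "exp (a * t) \<le> b" if "t \<in> T" for t
    using B[OF that] b by simp
  obtain t0 where t0: "t0 \<in> T" using T by blast
  have b0: "b > 0" using le[OF t0] by (rule less_le_trans[OF exp_gt_zero])
  have bound: "t \<le> ln b / a" if "t \<in> T" for t
  proof -
    have "a * t \<le> ln b" using le[OF that] b0 by (simp add: ln_ge_iff)
    then show ?thesis using a by (simp add: field_simps)
  qed
  have "0 \<le> ln b / a" using bound[OF t0] T(2)[OF t0] by simp
  have "(SUP t\<in>T. ennreal t) \<le> ennreal (ln b / a)"
    by (intro SUP_least ennreal_leI bound)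
  then have "exp_ext a (SUP t\<in>T. ennreal t) \<le> exp_ext a (ennreal (ln b / a))"
    using a by (rule exp_ext_mono[rotated])
  also have "\<dots> = B" using \<open>0 \<le> ln b / a\<close> a b0 by (simp add: exp_ext_ennreal b)
  finally show ?thesis .
qed simp

lemma exp_moment_eq: "exp_moment M a Y = (\<integral>\<^sup>+\<omega>. exp_ext a (Y \<omega>) \<partial>M)"
  by (simp add: exp_moment_def exp_ext_def)

lemma last_exit_walk_le_last_exit: "last_exit_walk X r \<omega> \<le> last_exit X r \<omega>"
  unfolding last_exit_walk_def last_exit_def
  by (rule SUP_least) (auto intro!: SUP_upper2[of "real _"] simp: ennreal_of_nat_eq_real_of_nat)

lemma nn_integral_staircase:
  fixes c :: "nat \<Rightarrow> ennreal"
  shows "(\<integral>\<^sup>+(t::real). c (nat \<lfloor>t\<rfloor>) * indicator {0..} t \<partial>lborel) = (\<Sum>k. c k)"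
proof -
  have "c (nat \<lfloor>t\<rfloor>) * indicator {0..} t = (\<Sum>k. c k * indicator {real k..<real k + 1} t)" for t :: real
  proof (cases "t \<ge> 0")
    case True
    have iff: "t \<in> {real k..<real k + 1} \<longleftrightarrow> k = nat \<lfloor>t\<rfloor>" for k
      using True by (auto simp: nat_eq_iff2) linarith+
    have "(\<Sum>k. c k * indicator {real k..<real k + 1} t) = (\<Sum>k\<in>{nat \<lfloor>t\<rfloor>}. c k * indicator {real k..<real k + 1} t)"
      by (rule suminf_finite) (use iff in \<open>auto simp: indicator_def\<close>)
    then show ?thesis using iff[of "nat \<lfloor>t\<rfloor>"] True by (simp add: indicator_def)
  next
    case False
    then have "t \<notin> {real k..<real k + 1}" for k by simp
    then show ?thesis using False by (simp add: indicator_def)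
  qed
  then have "(\<integral>\<^sup>+(t::real). c (nat \<lfloor>t\<rfloor>) * indicator {0..} t \<partial>lborel) = (\<integral>\<^sup>+t. (\<Sum>k. c k * indicator {real k..<real k + 1} t) \<partial>lborel)"
    by simp
  also have "\<dots> = (\<Sum>k. \<integral>\<^sup>+t. c k * indicator {real k..<real k + 1} t \<partial>lborel)"
    by (rule nn_integral_suminf) simp
  also have "\<dots> = (\<Sum>k. c k)"
    by (simp add: nn_integral_cmult_indicator)
  finally show ?thesis .
qed

context levy_process
begin

lemma step_law_1: "step_law (law 1)"
  by (rule step_law_law) simp

interpretation W: step_law "law 1"
  by (rule step_law_1)

lemma potential_walk_eq_green: "potential_walk M X a r = W.green a r"
  unfolding potential_walk_def W.green_def
  by (intro suminf_cong) (simp add: emeasure_walk_eq emeasure_eq_measure ennreal_mult)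

lemma laplace_eq_laplace_tr: "laplace M X \<theta> = W.laplace_tr \<theta>"
  unfolding laplace_def W.laplace_tr_def unfolding law_def
  by (subst nn_integral_distr) (auto intro: random_variable)

lemma tilted_mean_eq: "tilted_mean M X \<gamma> = (\<integral>x. x * exp (- \<gamma> * x) \<partial>law 1)"
  unfolding tilted_mean_def law_def
  by (subst integral_distr) (auto intro: random_variable)

lemma last_visit_mgf_le_exp_moment:
  assumes a: "a > 0"
  shows "W.last_visit_mgf a r \<le> exp_moment M a (last_exit_walk X r)"
proof -
  have "W.last_visit_mgf a r = (\<integral>\<^sup>+\<omega>. (SUP n. if walk (steps 1 \<omega>) n \<le> r then ennreal (exp (a * real n)) else 0) \<partial>M)"
    unfolding W.last_visit_mgf_def
    by (rule nn_integral_steps[symmetric], simp, measurable)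
  also have "\<dots> \<le> exp_moment M a (last_exit_walk X r)"
    unfolding exp_moment_eq
  proof (intro nn_integral_mono SUP_least)
    fix \<omega> n assume \<omega>: "\<omega> \<in> space M"
    show "(if walk (steps 1 \<omega>) n \<le> r then ennreal (exp (a * real n)) else 0) \<le> exp_ext a (last_exit_walk X r \<omega>)"
    proof (cases "walk (steps 1 \<omega>) n \<le> r")
      case True
      then have "X (real n) \<omega> \<le> r" by (simp add: walk_steps[OF \<omega>])
      then have "ennreal (real n) \<le> last_exit_walk X r \<omega>"
        unfolding last_exit_walk_def by (intro SUP_upper2[of n]) (auto simp: ennreal_of_nat_eq_real_of_nat)
      then have "exp_ext a (ennreal (real n)) \<le> exp_ext a (last_exit_walk X r \<omega>)"
        by (rule exp_ext_mono[OF a])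
      then show ?thesis using True by (simp add: exp_ext_ennreal)
    qed simp
  qed
  finally show ?thesis .
qed

lemma exp_moment_walk_le:
  assumes a: "a > 0"
  shows "exp_moment M a (last_exit_walk X r) \<le> exp_moment M a (last_exit X r)"
  unfolding exp_moment_eq
  by (intro nn_integral_mono exp_ext_mono[OF a] last_exit_walk_le_last_exit)

lemma emeasure_X_eq_walk: "emeasure M {\<omega> \<in> space M. X (real n) \<omega> \<le> x} = emeasure W.Paths {\<omega>. walk \<omega> n \<le> x}"
  by (simp add: emeasure_walk_eq)

lemma law_negative:
  assumes "prob {\<omega> \<in> space M. X 1 \<omega> < 0} > 0"
  shows "emeasure (law 1) {..<0} > 0"
proof -
  have "emeasure (law 1) {..<0} = emeasure M {\<omega> \<in> space M. X 1 \<omega> < 0}"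
    unfolding law_def by (subst emeasure_distr) (auto intro: random_variable intro!: arg_cong[where f = "emeasure M"])
  then show ?thesis using assms by (simp add: emeasure_eq_measure)
qed

lemma green_tail_le:
  "(\<Sum>k. ennreal (exp (a * real (Suc k))) * emeasure W.Paths {\<omega>. walk \<omega> (Suc k) \<le> x}) \<le> W.green a x"
proof -
  have "(\<Sum>k. f (Suc k)) \<le> (\<Sum>k. f k)" for f :: "nat \<Rightarrow> ennreal"
    using suminf_offset[OF summableI, of f 1] by (simp add: add_increasing)
  from this[of "\<lambda>k. ennreal (exp (a * real k)) * emeasure W.Paths {\<omega>. walk \<omega> k \<le> x}"] show ?thesis
    unfolding W.green_def .
qed

text \<open>
  The last exit is at most \<open>k + 1\<close> for the last \<open>k\<close> such that the path dips below \<open>r + 1\<close> during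
  \<open>[k, k + 1]\<close>; sum the corresponding weights over all such \<open>k\<close>. The sum is a measurable
  upper bound, although the last exit itself need not be measurable.
\<close>
lemma exp_moment_last_exit_le:
  assumes a: "a > 0" and r: "r \<ge> 0"
    and \<kappa>: "\<And>s. 0 \<le> s \<Longrightarrow> s \<le> 1 \<Longrightarrow> ennreal \<kappa> \<le> emeasure M {\<omega> \<in> space M. X s \<omega> \<le> C}"
  shows "ennreal \<kappa> * exp_moment M a (last_exit X r) \<le> W.green a (r + 1 + C)"
proof -
  have "exp_moment M a (last_exit X r) \<le> (\<integral>\<^sup>+\<omega>. (\<Sum>k. ennreal (exp (a * real (Suc k))) * indicator (dips k (r + 1)) \<omega>) \<partial>M)"
    unfolding exp_moment_eq
  proof (rule nn_integral_mono)
    fix \<omega> assume \<omega>: "\<omega> \<in> space M"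
    let ?S = "\<Sum>k. ennreal (exp (a * real (Suc k))) * indicator (dips k (r + 1)) \<omega>"
    show "exp_ext a (last_exit X r \<omega>) \<le> ?S"
      unfolding last_exit_def
    proof (rule exp_ext_SUP_le[OF a])
      have "0 \<in> {t. 0 \<le> t \<and> X t \<omega> \<le> r}" using r start_zero[OF \<omega>] by simp
      then show "{t. 0 \<le> t \<and> X t \<omega> \<le> r} \<noteq> {}" by blast
      fix t assume t: "t \<in> {t. 0 \<le> t \<and> X t \<omega> \<le> r}"
      then show "0 \<le> t" by simp
      define k where "k = nat \<lfloor>t\<rfloor>"
      have k: "t \<le> real (Suc k)" using t unfolding k_def by (simp, linarith)
      have dip: "\<omega> \<in> dips k (r + 1)"
        unfolding k_def using t by (intro dips_of_visit[OF \<omega>, of _ r]) auto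
      have "ennreal (exp (a * t)) \<le> ennreal (exp (a * real (Suc k)))"
        using a k by (intro ennreal_leI) (simp del: of_nat_Suc)
      also have "\<dots> = (\<Sum>k\<in>{k}. ennreal (exp (a * real (Suc k))) * indicator (dips k (r + 1)) \<omega>)"
        using dip by simp
      also have "\<dots> \<le> ?S" by (rule sum_le_suminf) auto
      finally show "ennreal (exp (a * t)) \<le> ?S" .
    qed
  qed
  also have "\<dots> = (\<Sum>k. ennreal (exp (a * real (Suc k))) * emeasure M (dips k (r + 1)))"
    using dips_bound(1)[OF \<kappa>]
    by (subst nn_integral_suminf) (auto simp: nn_integral_cmult_indicator)
  finally have "ennreal \<kappa> * exp_moment M a (last_exit X r) \<le> ennreal \<kappa> * (\<Sum>k. ennreal (exp (a * real (Suc k))) * emeasure M (dips k (r + 1)))"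
    by (rule mult_left_mono) simp
  also have "\<dots> = (\<Sum>k. ennreal (exp (a * real (Suc k))) * (ennreal \<kappa> * emeasure M (dips k (r + 1))))"
    by (subst ennreal_suminf_cmult[symmetric]) (simp only: mult.left_commute)
  also have "\<dots> \<le> (\<Sum>k. ennreal (exp (a * real (Suc k))) * emeasure W.Paths {\<omega>. walk \<omega> (Suc k) \<le> r + 1 + C})"
    unfolding emeasure_X_eq_walk[symmetric]
    by (intro suminf_le mult_left_mono dips_bound(2)[OF \<kappa>]) auto
  also have "\<dots> \<le> W.green a (r + 1 + C)"
    by (rule green_tail_le)
  finally show ?thesis .
qed

text \<open>
  On \<open>[k, k + 1]\<close> compare \<open>X t\<close> with \<open>X (k + 1)\<close>.
\<close>
lemma potential_le:
  assumes a: "a > 0" and pos: "\<kappa> > 0"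
    and \<kappa>: "\<And>s. 0 \<le> s \<Longrightarrow> s \<le> 1 \<Longrightarrow> ennreal \<kappa> \<le> emeasure M {\<omega> \<in> space M. X s \<omega> \<le> C}"
  shows "potential M X a r \<le> ennreal (1 / \<kappa>) * W.green a (r + C)"
proof -
  define c where "c k = ennreal (1 / \<kappa>) * (ennreal (exp (a * real (Suc k))) * emeasure W.Paths {\<omega>. walk \<omega> (Suc k) \<le> r + C})" for k
  have "potential M X a r \<le> (\<integral>\<^sup>+(t::real). c (nat \<lfloor>t\<rfloor>) * indicator {0..} t \<partial>lborel)"
    unfolding potential_def
  proof (intro nn_integral_mono)
    fix t :: real
    show "ennreal (exp (a * t) * prob {\<omega> \<in> space M. X t \<omega> \<le> r}) * indicator {0..} t \<le> c (nat \<lfloor>t\<rfloor>) * indicator {0..} t"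
    proof (cases "t \<ge> 0")
      case True
      define k where "k = nat \<lfloor>t\<rfloor>"
      have k: "real k \<le> t" "t \<le> real (Suc k)" using True unfolding k_def by (simp_all, linarith)
      define u where "u = real (Suc k) - t"
      have u: "0 \<le> u" "u \<le> 1" using k by (simp_all add: u_def)
      have "ennreal (prob {\<omega> \<in> space M. X t \<omega> \<le> r}) * ennreal \<kappa> \<le> emeasure M {\<omega> \<in> space M. X t \<omega> \<le> r} * emeasure M {\<omega> \<in> space M. X u \<omega> \<le> C}"
        unfolding emeasure_eq_measure[of "{\<omega> \<in> space M. X t \<omega> \<le> r}"] by (intro mult_left_mono \<kappa> u) simp
      also have "\<dots> \<le> emeasure M {\<omega> \<in> space M. X (t + u) \<omega> \<le> r + C}"
        by (rule emeasure_add_le[OF True u(1)])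
      also have "t + u = real (Suc k)" by (simp add: u_def)
      finally have *: "ennreal (prob {\<omega> \<in> space M. X t \<omega> \<le> r}) * ennreal \<kappa> \<le> emeasure W.Paths {\<omega>. walk \<omega> (Suc k) \<le> r + C}"
        unfolding emeasure_X_eq_walk .
      have "ennreal (exp (a * t) * prob {\<omega> \<in> space M. X t \<omega> \<le> r})
          = ennreal (1 / \<kappa>) * (ennreal (exp (a * t)) * (ennreal (prob {\<omega> \<in> space M. X t \<omega> \<le> r}) * ennreal \<kappa>))"
        using pos by (simp add: ennreal_mult[symmetric])
      also have "\<dots> \<le> c k"
        unfolding c_def using a k * by (intro mult_left_mono mult_mono ennreal_leI) (auto simp del: of_nat_Suc)
      finally show ?thesis by (simp add: k_def True)
    qed simp
  qed
  also have "\<dots> = (\<Sum>k. c k)" by (rule nn_integral_staircase)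
  also have "\<dots> = ennreal (1 / \<kappa>) * (\<Sum>k. ennreal (exp (a * real (Suc k))) * emeasure W.Paths {\<omega>. walk \<omega> (Suc k) \<le> r + C})"
    unfolding c_def by (rule ennreal_suminf_cmult)
  also have "\<dots> \<le> ennreal (1 / \<kappa>) * W.green a (r + C)"
    by (intro mult_left_mono green_tail_le) simp
  finally show ?thesis .
qed

text \<open>
  On \<open>[k, k + 1]\<close> compare \<open>X t\<close> with \<open>X k\<close>.
\<close>
lemma green_le_potential:
  assumes a: "a > 0"
    and \<kappa>: "\<And>s. 0 \<le> s \<Longrightarrow> s \<le> 1 \<Longrightarrow> ennreal \<kappa> \<le> emeasure M {\<omega> \<in> space M. X s \<omega> \<le> C}"
  shows "ennreal \<kappa> * W.green a (r - C) \<le> potential M X a r"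
proof -
  define c where "c k = ennreal \<kappa> * (ennreal (exp (a * real k)) * emeasure W.Paths {\<omega>. walk \<omega> k \<le> r - C})" for k
  have "ennreal \<kappa> * W.green a (r - C) = (\<Sum>k. c k)"
    unfolding c_def W.green_def by (rule ennreal_suminf_cmult[symmetric])
  also have "\<dots> = (\<integral>\<^sup>+(t::real). c (nat \<lfloor>t\<rfloor>) * indicator {0..} t \<partial>lborel)"
    by (rule nn_integral_staircase[symmetric])
  also have "\<dots> \<le> potential M X a r"
    unfolding potential_def
  proof (intro nn_integral_mono)
    fix t :: real
    show "c (nat \<lfloor>t\<rfloor>) * indicator {0..} t \<le> ennreal (exp (a * t) * prob {\<omega> \<in> space M. X t \<omega> \<le> r}) * indicator {0..} t"
    proof (cases "t \<ge> 0")
      case True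
      define k where "k = nat \<lfloor>t\<rfloor>"
      have k: "real k \<le> t" "t \<le> real (Suc k)" using True unfolding k_def by (simp_all, linarith)
      define u where "u = t - real k"
      have u: "0 \<le> u" "u \<le> 1" using k by (simp_all add: u_def)
      have "c k = ennreal (exp (a * real k)) * (emeasure M {\<omega> \<in> space M. X (real k) \<omega> \<le> r - C} * ennreal \<kappa>)"
        unfolding c_def emeasure_X_eq_walk by (simp only: mult.commute mult.left_commute)
      also have "\<dots> \<le> ennreal (exp (a * t)) * emeasure M {\<omega> \<in> space M. X (real k + u) \<omega> \<le> (r - C) + C}"
      proof (intro mult_mono)
        have "emeasure M {\<omega> \<in> space M. X (real k) \<omega> \<le> r - C} * ennreal \<kappa>
           \<le> emeasure M {\<omega> \<in> space M. X (real k) \<omega> \<le> r - C} * emeasure M {\<omega> \<in> space M. X u \<omega> \<le> C}"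
          by (intro mult_left_mono \<kappa> u) simp
        also have "\<dots> \<le> emeasure M {\<omega> \<in> space M. X (real k + u) \<omega> \<le> (r - C) + C}"
          by (rule emeasure_add_le) (use u in auto)
        finally show "emeasure M {\<omega> \<in> space M. X (real k) \<omega> \<le> r - C} * ennreal \<kappa>
          \<le> emeasure M {\<omega> \<in> space M. X (real k + u) \<omega> \<le> (r - C) + C}" .
      qed (use a k in \<open>auto intro!: ennreal_leI\<close>)
      also have "\<dots> = ennreal (exp (a * t) * prob {\<omega> \<in> space M. X t \<omega> \<le> r})"
        by (simp add: u_def emeasure_eq_measure ennreal_mult)
      finally show ?thesis by (simp add: k_def True)
    qed simp
  qed
  finally show ?thesis .
qed

text \<open>
  Since the infimum of the Laplace transform is \<open>exp (- R)\<close>, comparing \<open>a\<close> with \<open>R\<close> amounts to comparing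
  the infimum with \<open>exp (- a)\<close>, and a tilt parameter is the same as a positive minimiser.
\<close>
lemma decay_rate_criterion:
  assumes neg: "prob {\<omega> \<in> space M. X 1 \<omega> < 0} > 0" and a: "a > 0"
  shows "a = decay_rate M X \<Longrightarrow> \<exists>!\<gamma>. is_tilt_parameter M X \<gamma>"
    and "a < decay_rate M X \<or> a = decay_rate M X \<and> tilted_mean M X (tilt_parameter M X) > 0 \<Longrightarrow> W.green a r < \<infinity>"
    and "r \<ge> 0 \<Longrightarrow> W.last_visit_mgf a r < \<infinity> \<Longrightarrow>
      a < decay_rate M X \<or> a = decay_rate M X \<and> tilted_mean M X (tilt_parameter M X) > 0"
proof -
  note neg' = law_negative[OF neg]
  define m where "m = (INF \<theta>\<in>{0..}. W.laplace_tr \<theta>)"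
  have m_pos: "m > 0" unfolding m_def by (rule W.INF_laplace_tr_pos[OF neg'])
  have m_le: "m \<le> 1" unfolding m_def by (rule INF_lower2[of 0]) auto
  have m: "m = ennreal (exp (- decay_rate M X))"
  proof -
    have "m < \<infinity>" using m_le by (rule le_less_trans) simp
    then have m': "m = ennreal (enn2real m)" by (simp add: less_top)
    then have "enn2real m > 0" using m_pos by (metis ennreal_0 ennreal_less_zero_iff ennreal_neg not_le zero_less_iff_neq_zero)
    then show ?thesis using m' by (simp add: decay_rate_def laplace_eq_laplace_tr m_def[symmetric])
  qed
  have tilt: "is_tilt_parameter M X \<gamma> \<longleftrightarrow> \<gamma> > 0 \<and> W.laplace_tr \<gamma> = m" for \<gamma>
    unfolding is_tilt_parameter_def laplace_eq_laplace_tr m ..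
  have unique: "\<exists>!\<gamma>. is_tilt_parameter M X \<gamma>" if "a = decay_rate M X"
  proof -
    have "m < ennreal 1" unfolding m using that a by (intro ennreal_lessI) auto
    then have "m < 1" by simp
    then obtain \<gamma> where "\<gamma> > 0" "W.laplace_tr \<gamma> = m"
      using W.INF_laplace_tr_attained[OF neg'] unfolding m_def by blast
    then show ?thesis
      unfolding tilt m_def by (intro ex1I[of _ \<gamma>]) (auto intro: W.INF_laplace_tr_unique[OF neg'])
  qed
  then show "a = decay_rate M X \<Longrightarrow> \<exists>!\<gamma>. is_tilt_parameter M X \<gamma>" .
  have param: "tilt_parameter M X > 0" "W.laplace_tr (tilt_parameter M X) = m" if "a = decay_rate M X"
  proof -
    have "is_tilt_parameter M X (tilt_parameter M X)"
      unfolding tilt_parameter_def by (rule theI'[OF unique[OF that]])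
    then show "tilt_parameter M X > 0" "W.laplace_tr (tilt_parameter M X) = m" by (simp_all add: tilt)
  qed
  show "W.green a r < \<infinity>" if "a < decay_rate M X \<or> a = decay_rate M X \<and> tilted_mean M X (tilt_parameter M X) > 0"
    using that
  proof (elim disjE conjE)
    assume "a < decay_rate M X"
    then show ?thesis
      by (intro W.green_finite_subcritical) (simp add: m_def[symmetric] m ennreal_lessI)
  next
    assume "a = decay_rate M X" "tilted_mean M X (tilt_parameter M X) > 0"
    then show ?thesis
      using param by (intro W.green_finite_critical[of "tilt_parameter M X"]) (simp_all add: m tilted_mean_eq)
  qed
  show "a < decay_rate M X \<or> a = decay_rate M X \<and> tilted_mean M X (tilt_parameter M X) > 0"
    if r: "r \<ge> 0" and fin: "W.last_visit_mgf a r < \<infinity>"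
  proof -
    have "m \<le> ennreal (exp (- a))"
      unfolding m_def by (rule W.last_visit_mgf_finite_imp_decay[OF neg' fin])
    then have "a \<le> decay_rate M X" unfolding m by simp
    moreover have "tilted_mean M X (tilt_parameter M X) > 0" if eq: "a = decay_rate M X"
      unfolding tilted_mean_eq using param[OF eq] eq
      by (intro W.last_visit_mgf_finite_imp_tilted_mean_pos[OF neg' a r fin]) (simp_all add: m m_def[symmetric])
    ultimately show ?thesis by linarith
  qed
qed

end

theorem theorem1p3:
  fixes M :: "'w measure" and X :: "real \<Rightarrow> 'w \<Rightarrow> real" and a :: real
  assumes "levy_process M X"
    and "measure M {\<omega> \<in> space M. X 1 \<omega> < 0} > 0"
    and "a > 0"
  shows "(a = decay_rate M X \<longrightarrow> (\<exists>!\<gamma>. is_tilt_parameter M X \<gamma>)) \<and>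
   (let crit = (a < decay_rate M X \<or>
      a = decay_rate M X \<and> tilted_mean M X (tilt_parameter M X) > 0)
    in
    ((\<exists>r\<ge>0. exp_moment M a (last_exit X r) < \<infinity>) \<longleftrightarrow> crit) \<and>
    ((\<forall>r\<ge>0. exp_moment M a (last_exit X r) < \<infinity>) \<longleftrightarrow> crit) \<and>
    ((\<exists>r. potential M X a r < \<infinity>) \<longleftrightarrow> crit) \<and>
    ((\<forall>r. potential M X a r < \<infinity>) \<longleftrightarrow> crit) \<and>
    ((\<exists>r\<ge>0. exp_moment M a (last_exit_walk X r) < \<infinity>) \<longleftrightarrow> crit) \<and>
    ((\<forall>r\<ge>0. exp_moment M a (last_exit_walk X r) < \<infinity>) \<longleftrightarrow> crit) \<and>
    ((\<exists>r. potential_walk M X a r < \<infinity>) \<longleftrightarrow> crit) \<and>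
    ((\<forall>r. potential_walk M X a r < \<infinity>) \<longleftrightarrow> crit))"
proof -
  interpret L: levy_process M X by fact
  interpret W: step_law "L.law 1" by (rule L.step_law_1)
  note a = assms(3)
  note eqv = L.decay_rate_criterion[OF assms(2) a]
  define crit where "crit \<longleftrightarrow> a < decay_rate M X \<or> a = decay_rate M X \<and> tilted_mean M X (tilt_parameter M X) > 0"
  obtain C \<kappa> :: real where \<kappa>: "\<kappa> > 0"
    "\<And>s. 0 \<le> s \<Longrightarrow> s \<le> 1 \<Longrightarrow> ennreal \<kappa> \<le> emeasure M {\<omega> \<in> space M. X s \<omega> \<le> C}"
    using L.uniform_lower_bound by blast
  have green: "W.green a r < \<infinity>" if crit for r
    using eqv(2) that unfolding crit_def by blast
  have exit: "exp_moment M a (last_exit X r) < \<infinity>" if crit "r \<ge> 0" for r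
  proof -
    have "ennreal \<kappa> * exp_moment M a (last_exit X r) < \<infinity>"
      using L.exp_moment_last_exit_le[OF a that(2) \<kappa>(2)] green[OF that(1)] by (rule le_less_trans)
    then show ?thesis using \<kappa>(1) by (auto simp: ennreal_mult_less_top)
  qed
  have exit_walk: "exp_moment M a (last_exit_walk X r) < \<infinity>" if "exp_moment M a (last_exit X r) < \<infinity>" for r
    using L.exp_moment_walk_le[OF a] that by (rule le_less_trans)
  have walk_crit: crit if "r \<ge> 0" "exp_moment M a (last_exit_walk X r) < \<infinity>" for r
  proof -
    have "W.last_visit_mgf a r < \<infinity>"
      using L.last_visit_mgf_le_exp_moment[OF a] that(2) by (rule le_less_trans)
    then show ?thesis using eqv(3) that(1) unfolding crit_def by blast
  qed
  have green_crit: crit if "W.green a r < \<infinity>" for r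
  proof -
    have "W.last_visit_mgf a r < \<infinity>"
      using W.last_visit_mgf_le_green that unfolding W.green_def by (rule le_less_trans)
    then have "W.last_visit_mgf a 0 < \<infinity>"
      by (rule W.last_visit_mgf_finite_everywhere[OF L.law_negative[OF assms(2)]])
    then show ?thesis using eqv(3) unfolding crit_def by blast
  qed
  have pot: "potential M X a r < \<infinity>" if crit for r
  proof -
    have "ennreal (1 / \<kappa>) * W.green a (r + C) < \<infinity>"
      using green[OF that] by (simp add: ennreal_mult_less_top)
    with L.potential_le[OF a \<kappa>] show ?thesis by (rule le_less_trans)
  qed
  have pot_crit: crit if "potential M X a r < \<infinity>" for r
  proof -
    have "ennreal \<kappa> * W.green a (r - C) < \<infinity>"
      using L.green_le_potential[OF a \<kappa>(2)] that by (rule le_less_trans)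
    then have "W.green a (r - C) < \<infinity>" using \<kappa>(1) by (auto simp: ennreal_mult_less_top)
    then show ?thesis by (rule green_crit)
  qed
  note pw = L.potential_walk_eq_green
  have "(\<exists>r\<ge>0. exp_moment M a (last_exit X r) < \<infinity>) \<longleftrightarrow> crit" "(\<forall>r\<ge>0. exp_moment M a (last_exit X r) < \<infinity>) \<longleftrightarrow> crit"
    using exit exit_walk walk_crit by blast+
  moreover have "(\<exists>r. potential M X a r < \<infinity>) \<longleftrightarrow> crit" "(\<forall>r. potential M X a r < \<infinity>) \<longleftrightarrow> crit"
    using pot pot_crit by blast+
  moreover have "(\<exists>r\<ge>0. exp_moment M a (last_exit_walk X r) < \<infinity>) \<longleftrightarrow> crit" "(\<forall>r\<ge>0. exp_moment M a (last_exit_walk X r) < \<infinity>) \<longleftrightarrow> crit"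
    using exit exit_walk walk_crit by blast+
  moreover have "(\<exists>r. potential_walk M X a r < \<infinity>) \<longleftrightarrow> crit" "(\<forall>r. potential_walk M X a r < \<infinity>) \<longleftrightarrow> crit"
    unfolding pw using green green_crit by blast+
  ultimately show ?thesis
    unfolding Let_def crit_def[symmetric] using eqv(1) by simp
qed

end
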